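(* Let $\mathbb{K}$ be a field, $\mathcal{E}$ a finite non-empty set, and $W\subseteq\mathbb{K}^{\mathcal{E}}$ a configuration with matroid $\mathsf{M}=\mathsf{M}_W$. If $e,f\in\mathcal{E}$ are in series in $\mathsf{M}$ with $\mathrm{rk}(\mathsf{M}/e)>0$, $\mathrm{rk}(\mathsf{M}\setminus\{e,f\})>0$, $\mathrm{cl}_{\mathsf{M}}(\{e,f\})\neq\mathcal{E}$ and $f$ is not a coloop in $\mathsf{M}/e$, then in $\mathrm{K}_0(\mathrm{Var}_{\mathbb{K}})$ \[ [Y_W]+[Y_{W/e}]\equiv[Y_{W\setminus\{e,f\}}]\mod\mathbb{T}. \]
   Context: $\mathrm{K}_0(\mathrm{Var}_{\mathbb{K}})$ is the Grothendieck ring of varieties over $\mathbb{K}$, $[-]$ denotes classes in it, $\mathbb{T}:=[\mathbb{G}_m]$ is the class of the $1$-torus, and "$\mathrm{mod}\ \mathbb{T}$" means modulo the ideal generated by $\mathbb{T}$. Configurations: a configuration is a subspace $W\subseteq V:=\mathbb{K}^{\mathcal{E}}$, where $\mathcal{E}$ is identified with the standard basis of $V$; $x_e=e^\vee$, $e\in\mathcal{E}$, are the coordinates on $V$. Its matroid $\mathsf{M}_W$ on $\mathcal{E}$ is defined by the linear dependence relations of the family $(e^\vee|_W)_{e\in\mathcal{E}}$ in $W^\vee$; $\mathrm{cl}$ and $\mathrm{rk}$ denote closure and rank. For $S\subseteq\mathcal{E}$, the deletion $W\setminus S\subseteq\mathbb{K}^{\mathcal{E}\setminus S}$ is the image of $W$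 under the coordinate projection $\mathbb{K}^{\mathcal{E}}\to\mathbb{K}^{\mathcal{E}\setminus S}$, and the contraction is $W/S:=W\cap\mathbb{K}^{\mathcal{E}\setminus S}\subseteq\mathbb{K}^{\mathcal{E}\setminus S}$; they have matroids $\mathsf{M}\setminus S$ and $\mathsf{M}/S$. One writes $W/e$ for $W/\{e\}$. Parallel and series: $e,f\in\mathcal{E}$ are parallel in $\mathsf{M}$ if $\{e,f\}$ is a circuit of $\mathsf{M}$, and in series if the corresponding elements are parallel in the dual matroid $\mathsf{M}^\perp$. (Thus if $e,f$ are in series, then either $e=f$ is a coloop, or $e\ne f$ are both non-coloops. If $e=f$, the element $f$ does not belong to the ground set of $\mathsf{M}/e$, and the condition that $f$ is not a coloop in $\mathsf{M}/e$ is void.) Configuration hypersurface: $Q_W$ is the restriction to $W\times W$ of the symmetric bilinear form $V\times V\to V^\vee$, $(w,w')\mapsto\sum_{e}w_ew'_e\cdot x_e$. Its determinant with respect to a basis of $W$ is the configuration polynomial $\psi_W=\det Q_W\in\mathrm{Sym}\,V^\vee=\mathbb{K}[V]$ (well-defined up to a factor in $\mathbb{K}^*$; $\psi_W=1$ if $W=0$). Set $X_W:=V(\psi_W)\subseteq\mathbb{P}V$ and $Y_W:=\mathbb{P}V\setminus X_W$. *)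

theory Defs
  imports
    "HOL-Analysis.Abstract_Topology"
    "HOL-Algebra.Algebraic_Closure_Type"
    "HOL-Library.Poly_Mapping"
    "HOL-Library.Function_Algebras"
    "Jordan_Normal_Form.Determinant"
begin

section \<open>Polynomials in several variables\<close>

type_synonym ('i, 'k) mpoly = "('i \<Rightarrow>\<^sub>0 nat) \<Rightarrow>\<^sub>0 'k"

definition mvar :: "'i \<Rightarrow> ('i, 'k::field) mpoly" where
  "mvar i = Poly_Mapping.single (Poly_Mapping.single i 1) 1"

definition mpoly_at :: "('i, 'k::field) mpoly \<Rightarrow> ('i \<Rightarrow> 'k alg_closure) \<Rightarrow> 'k alg_closure" where
  "mpoly_at p v = (\<Sum>m\<in>Poly_Mapping.keys p. to_ac (Poly_Mapping.lookup p m) *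
     (\<Prod>i\<in>Poly_Mapping.keys m. v i ^ Poly_Mapping.lookup m i))"

definition homogeneous :: "nat \<Rightarrow> ('i, 'k::field) mpoly \<Rightarrow> bool" where
  "homogeneous d p \<longleftrightarrow>
     (\<forall>m\<in>Poly_Mapping.keys p. (\<Sum>i\<in>Poly_Mapping.keys m. Poly_Mapping.lookup m i) = d)"

section \<open>Varieties over a field\<close>

text \<open>
  A variety over a field \<open>k\<close> (a reduced separated scheme of finite type over \<open>k\<close>) is represented
  by the set of its geometric points, i.e. points with values in an algebraic closure of \<open>k\<close>,
  together with the Zariski topology whose closed sets are defined over \<open>k\<close> and the sheaf of
  regular functions defined over \<open>k\<close>, regarded as functions on geometric points.  Conjugate
  geometric points are topologically indistinguishable, so this is not a T0 space if \<open>k\<close> is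
  not separably closed.  Since schemes are reduced, a regular function is determined by its values at
  the geometric points, and morphisms over \<open>k\<close> are the maps of geometric points below.
  No assumption on \<open>k\<close> (perfect, infinite, ...) is made.

  The values outside \<open>U\<close> of an element of \<open>reg A U\<close> are irrelevant, and so is \<open>reg A U\<close> for sets \<open>U\<close>
  that are not open.
\<close>

record ('p, 'c) fspace =
  zar :: "'p topology"
  reg :: "'p set \<Rightarrow> ('p \<Rightarrow> 'c) set"

abbreviation pts :: "('p, 'c) fspace \<Rightarrow> 'p set" where
  "pts A \<equiv> topspace (zar A)"

definition morphism :: "('p, 'c) fspace \<Rightarrow> ('q, 'c) fspace \<Rightarrow> ('p \<Rightarrow> 'q) \<Rightarrow> bool" where
  "morphism A B \<phi> \<longleftrightarrow> continuous_map (zar A) (zar B) \<phi> \<and>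
     (\<forall>V f. openin (zar B) V \<and> f \<in> reg B V \<longrightarrow> f \<circ> \<phi> \<in> reg A {x \<in> pts A. \<phi> x \<in> V})"

definition isomorphic :: "('p, 'c) fspace \<Rightarrow> ('q, 'c) fspace \<Rightarrow> bool" where
  "isomorphic A B \<longleftrightarrow> (\<exists>\<phi> \<psi>. morphism A B \<phi> \<and> morphism B A \<psi> \<and>
     (\<forall>x\<in>pts A. \<psi> (\<phi> x) = x) \<and> (\<forall>y\<in>pts B. \<phi> (\<psi> y) = y))"

definition locally_regular :: "('p, 'c) fspace \<Rightarrow> 'p set \<Rightarrow> ('p \<Rightarrow> 'c) \<Rightarrow> bool" where
  "locally_regular A U f \<longleftrightarrow>
     (\<forall>x\<in>U. \<exists>N g. openin (zar A) N \<and> x \<in> N \<and> g \<in> reg A N \<and> (\<forall>y\<in>N \<inter> U. f y = g y))"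

text \<open>
  The structure induced on a subset \<open>S\<close>.  For closed \<open>S\<close> it is that of the reduced closed subscheme,
  for open \<open>S\<close> that of the open subscheme.
\<close>

definition induced :: "('p, 'c) fspace \<Rightarrow> 'p set \<Rightarrow> ('p, 'c) fspace" where
  "induced A S = \<lparr>zar = subtopology (zar A) S, reg = (\<lambda>U. {f. locally_regular A U f})\<rparr>"

text \<open>The geometric points of affine \<open>n\<close>-space are sequences vanishing from index \<open>n\<close> on.\<close>

definition affine_points :: "nat \<Rightarrow> (nat \<Rightarrow> 'c::zero) set" where
  "affine_points n = {v. \<forall>i\<ge>n. v i = 0}"

definition affine_space :: "nat \<Rightarrow> (nat \<Rightarrow> 'k::field alg_closure, 'k alg_closure) fspace" where
  "affine_space n =
     (let T = topology_generated_by
        {{v \<in> affine_points n. mpoly_at p v \<noteq> 0} | p :: (nat, 'k) mpoly. True}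
      in \<lparr>zar = T,
          reg = (\<lambda>U. {f. \<forall>x\<in>U. \<exists>N (p :: (nat, 'k) mpoly) q. openin T N \<and> x \<in> N \<and>
            (\<forall>v\<in>N \<inter> U. mpoly_at q v \<noteq> 0 \<and> f v = mpoly_at p v / mpoly_at q v)})\<rparr>)"

definition sheaf_condition :: "('p, 'c) fspace \<Rightarrow> bool" where
  "sheaf_condition A \<longleftrightarrow> (\<forall>U. openin (zar A) U \<longrightarrow> reg A U = {f. locally_regular A U f})"

definition prevariety :: "('p, 'k::field alg_closure) fspace \<Rightarrow> bool" where
  "prevariety A \<longleftrightarrow> sheaf_condition A \<and>
     (\<exists>\<U>. finite \<U> \<and> \<Union>\<U> = pts A \<and>
        (\<forall>U\<in>\<U>. openin (zar A) U \<and>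
           (\<exists>n Z. closedin (zar (affine_space n)) Z \<and>
              isomorphic (induced A U) (induced (affine_space n :: (_, 'k alg_closure) fspace) Z))))"

text \<open>Separatedness: two morphisms from an affine variety agree on a closed set.\<close>

definition separated :: "('p, 'k::field alg_closure) fspace \<Rightarrow> bool" where
  "separated A \<longleftrightarrow>
     (\<forall>n Z \<phi> \<psi>. closedin (zar (affine_space n)) Z \<and>
        morphism (induced (affine_space n :: (_, 'k alg_closure) fspace) Z) A \<phi> \<and>
        morphism (induced (affine_space n) Z) A \<psi> \<longrightarrow>
        closedin (zar (induced (affine_space n :: (_, 'k alg_closure) fspace) Z))
          {z \<in> Z. \<phi> z = \<psi> z})"

definition variety :: "('p, 'k::field alg_closure) fspace \<Rightarrow> bool" where
  "variety A \<longleftrightarrow> prevariety A \<and> separated A"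

section \<open>The Grothendieck ring of varieties\<close>

text \<open>
  A variety over \<open>k\<close> has at most as many geometric points as the algebraic closure has elements.
  Hence every variety is isomorphic to one whose points are taken from the type
  \<open>nat \<Rightarrow> 'k alg_closure\<close>, and these provide enough generators.
\<close>

lemma variety_empty:
  "variety (\<lparr>zar = discrete_topology {}, reg = \<lambda>_. UNIV\<rparr> :: ('p, 'k::field alg_closure) fspace)"
  (is "variety ?E")
proof -
  have "prevariety ?E"
    unfolding prevariety_def
    by (auto simp: sheaf_condition_def locally_regular_def intro!: exI[of _ "{}"])
  moreover have "separated ?E"
    unfolding separated_def
  proof (intro allI impI, elim conjE)
    fix n and Z :: "(nat \<Rightarrow> 'k alg_closure) set" and \<phi> \<psi> :: "(nat \<Rightarrow> 'k alg_closure) \<Rightarrow> 'p"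
    assume Z: "closedin (zar (affine_space n)) Z"
      and \<phi>: "morphism (induced (affine_space n) Z) ?E \<phi>"
    have "pts (induced (affine_space n) Z) = Z"
      using closedin_subset[OF Z] by (auto simp: induced_def)
    with \<phi> have "Z = {}"
      by (auto simp: morphism_def continuous_map_def)
    then show "closedin (zar (induced (affine_space n) Z)) {z \<in> Z. \<phi> z = \<psi> z}"
      by simp
  qed
  ultimately show ?thesis by (simp add: variety_def)
qed

typedef (overloaded) 'k::field var =
  "{A :: (nat \<Rightarrow> 'k alg_closure, 'k alg_closure) fspace. variety A}"
  morphisms space_of Abs_var
  using variety_empty by blast

text \<open>Products over \<open>k\<close>, by their universal property in the category of varieties over \<open>k\<close>.\<close>

definition is_product :: "'k::field var \<Rightarrow> 'k var \<Rightarrow> 'k var \<Rightarrow> bool" where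
  "is_product P A B \<longleftrightarrow> (\<exists>p q. morphism (space_of P) (space_of A) p \<and>
     morphism (space_of P) (space_of B) q \<and>
     (\<forall>(T :: 'k var) a b.
        morphism (space_of T) (space_of A) a \<and> morphism (space_of T) (space_of B) b \<longrightarrow>
        (\<exists>\<phi>. morphism (space_of T) (space_of P) \<phi> \<and>
           (\<forall>t\<in>pts (space_of T). p (\<phi> t) = a t \<and> q (\<phi> t) = b t) \<and>
           (\<forall>\<phi>'. morphism (space_of T) (space_of P) \<phi>' \<and>
              (\<forall>t\<in>pts (space_of T). p (\<phi>' t) = a t \<and> q (\<phi>' t) = b t) \<longrightarrow>
              (\<forall>t\<in>pts (space_of T). \<phi>' t = \<phi> t)))))"

definition ideal_generated :: "'a::{comm_ring, comm_monoid_mult} set \<Rightarrow> 'a set" where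
  "ideal_generated S = \<Inter>{I. S \<subseteq> I \<and> 0 \<in> I \<and> (\<forall>a\<in>I. \<forall>b\<in>I. a + b \<in> I) \<and> (\<forall>r. \<forall>a\<in>I. r * a \<in> I)}"

lemma ideal_generated_incl: "a \<in> S \<Longrightarrow> a \<in> ideal_generated S"
  and ideal_generated_0: "0 \<in> ideal_generated S"
  and ideal_generated_add:
    "a \<in> ideal_generated S \<Longrightarrow> b \<in> ideal_generated S \<Longrightarrow> a + b \<in> ideal_generated S"
  and ideal_generated_mult: "a \<in> ideal_generated S \<Longrightarrow> r * a \<in> ideal_generated S"
  by (auto simp: ideal_generated_def)

lemma ideal_generated_minus:
  assumes "a \<in> ideal_generated S"
  shows "- a \<in> ideal_generated S"
  using ideal_generated_mult[OF assms, of "- 1"] by simp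

lemma ideal_generated_diff:
  "a \<in> ideal_generated S \<Longrightarrow> b \<in> ideal_generated S \<Longrightarrow> a - b \<in> ideal_generated S"
  using ideal_generated_add[OF _ ideal_generated_minus, of a S b] by simp

text \<open>
  The ring is presented as the quotient of the free commutative ring on the symbols \<open>gen A\<close> by the
  relations [A] = [B] for isomorphic A, B; [A] = [C] + [A - C] for closed C in A;
  [A x B] = [A] [B]; and [point] = 1.
\<close>

definition gen :: "'k::field var \<Rightarrow> ('k var \<Rightarrow>\<^sub>0 nat) \<Rightarrow>\<^sub>0 int" where
  "gen A = Poly_Mapping.single (Poly_Mapping.single A 1) 1"

type_synonym 'k free_ring = "('k var \<Rightarrow>\<^sub>0 nat) \<Rightarrow>\<^sub>0 int"

definition K0_relations :: "'k::field free_ring set" where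
  "K0_relations =
     {gen A - gen B | A B. isomorphic (space_of A) (space_of B)} \<union>
     {gen A - (gen Z + gen U) | A Z U. \<exists>C. closedin (zar (space_of A)) C \<and>
        space_of Z = induced (space_of A) C \<and>
        space_of U = induced (space_of A) (pts (space_of A) - C)} \<union>
     {gen P - gen A * gen B | P A B. is_product P A B} \<union>
     {gen A - 1 | A. isomorphic (space_of A) (affine_space 0 :: (_, 'k alg_closure) fspace)}"

definition K0_equiv :: "'k::field free_ring \<Rightarrow> 'k free_ring \<Rightarrow> bool" where
  "K0_equiv a b \<longleftrightarrow> a - b \<in> ideal_generated K0_relations"

lemma equivp_K0_equiv: "equivp (K0_equiv :: 'k::field free_ring \<Rightarrow> _)"
proof (rule equivpI)
  show "reflp (K0_equiv :: 'k free_ring \<Rightarrow> _)"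
    by (simp add: reflp_def K0_equiv_def ideal_generated_0)
  show "symp (K0_equiv :: 'k free_ring \<Rightarrow> _)"
    unfolding symp_def K0_equiv_def by (metis ideal_generated_minus minus_diff_eq)
  show "transp (K0_equiv :: 'k free_ring \<Rightarrow> _)"
    unfolding transp_def K0_equiv_def
  proof (intro allI impI)
    fix a b c :: "'k free_ring"
    assume "a - b \<in> ideal_generated K0_relations" "b - c \<in> ideal_generated K0_relations"
    from ideal_generated_add[OF this] show "a - c \<in> ideal_generated K0_relations" by simp
  qed
qed

quotient_type (overloaded) 'k K0 = "'k::field free_ring" / K0_equiv
  by (rule equivp_K0_equiv)

text \<open>\<^class>\<open>comm_ring_1\<close> is not available without proving the ring non-trivial.\<close>

instantiation K0 :: (field) "{comm_ring, comm_monoid_mult}"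
begin

lift_definition zero_K0 :: "'a K0" is 0 .

lift_definition one_K0 :: "'a K0" is 1 .

lift_definition plus_K0 :: "'a K0 \<Rightarrow> 'a K0 \<Rightarrow> 'a K0" is "(+)"
proof -
  fix a b c d :: "'a free_ring"
  assume "K0_equiv a b" "K0_equiv c d"
  then show "K0_equiv (a + c) (b + d)"
    unfolding K0_equiv_def using ideal_generated_add by (metis add_diff_add)
qed

lift_definition uminus_K0 :: "'a K0 \<Rightarrow> 'a K0" is uminus
proof -
  fix a b :: "'a free_ring"
  assume "K0_equiv a b"
  then show "K0_equiv (- a) (- b)"
    unfolding K0_equiv_def using ideal_generated_minus by (metis minus_diff_minus)
qed

lift_definition minus_K0 :: "'a K0 \<Rightarrow> 'a K0 \<Rightarrow> 'a K0" is "(-)"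
proof -
  fix a b c d :: "'a free_ring"
  assume "K0_equiv a b" "K0_equiv c d"
  then have "(a - b) - (c - d) \<in> ideal_generated K0_relations"
    unfolding K0_equiv_def by (rule ideal_generated_diff)
  then show "K0_equiv (a - c) (b - d)"
    unfolding K0_equiv_def by (simp add: algebra_simps)
qed

lift_definition times_K0 :: "'a K0 \<Rightarrow> 'a K0 \<Rightarrow> 'a K0" is "(*)"
proof -
  fix a b c d :: "'a free_ring"
  assume "K0_equiv a b" "K0_equiv c d"
  then have "c * (a - b) + b * (c - d) \<in> ideal_generated K0_relations"
    unfolding K0_equiv_def by (intro ideal_generated_add ideal_generated_mult)
  then show "K0_equiv (a * c) (b * d)"
    unfolding K0_equiv_def by (simp add: algebra_simps)
qed

instance
  by standard (transfer; simp add: K0_equiv_def algebra_simps ideal_generated_0)+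

end

lift_definition var_class :: "'k::field var \<Rightarrow> 'k K0" is gen .

text \<open>
  The class of a variety whose points may have any type: that of an isomorphic \<open>A :: 'k var\<close>
  (which exists, see above, and whose class does not depend on the choice).
\<close>

definition K0_class :: "('p, 'k::field alg_closure) fspace \<Rightarrow> 'k K0" where
  "K0_class B = var_class (SOME A. isomorphic (space_of A) B)"

definition Gm :: "(nat \<Rightarrow> 'k::field alg_closure, 'k alg_closure) fspace" where
  "Gm = induced (affine_space 1) {v. v 0 \<noteq> 0}"

definition torus_class :: "'k::field K0" where
  "torus_class = K0_class Gm"

section \<open>Projective space\<close>

interpretation fun_vs: vector_space "\<lambda>(c::'k::field) (v::'e \<Rightarrow> 'k) i. c * v i"
  by standard (auto simp: fun_eq_iff algebra_simps)

text \<open>The coordinate space \<open>K\<^sup>E\<close>, for \<open>E\<close> a subset of a type, consists of the functions supported on \<open>E\<close>.\<close>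

definition coord_space :: "'e set \<Rightarrow> ('e \<Rightarrow> 'k::field) set" where
  "coord_space E = {v. \<forall>i. i \<notin> E \<longrightarrow> v i = 0}"

definition lines :: "'e set \<Rightarrow> ('e \<Rightarrow> 'k::field) set set" where
  "lines E = {fun_vs.span {v} | v. v \<in> coord_space E \<and> v \<noteq> 0}"

definition vanishes_on :: "('e, 'k::field) mpoly \<Rightarrow> ('e \<Rightarrow> 'k alg_closure) set \<Rightarrow> bool" where
  "vanishes_on p L \<longleftrightarrow> (\<forall>v\<in>L. mpoly_at p v = 0)"

definition proj_space :: "'e set \<Rightarrow> (('e \<Rightarrow> 'k::field alg_closure) set, 'k alg_closure) fspace" where
  "proj_space E =
     (let T = topology_generated_by
        {{L \<in> lines E. \<not> vanishes_on p L} | p :: ('e, 'k) mpoly. \<exists>d. homogeneous d p}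
      in \<lparr>zar = T,
          reg = (\<lambda>U. {f. \<forall>L\<in>U. \<exists>N (p :: ('e, 'k) mpoly) q d. openin T N \<and> L \<in> N \<and>
            homogeneous d p \<and> homogeneous d q \<and>
            (\<forall>L'\<in>N \<inter> U. \<forall>v\<in>L' - {0}. mpoly_at q v \<noteq> 0 \<and> f L' = mpoly_at p v / mpoly_at q v)})\<rparr>)"

section \<open>Matroids\<close>

record 'e matroid =
  ground :: "'e set"
  indep :: "'e set set"

definition mrank_of :: "'e matroid \<Rightarrow> 'e set \<Rightarrow> nat" where
  "mrank_of M S = Max (card ` {I \<in> indep M. I \<subseteq> S})"

definition mrank :: "'e matroid \<Rightarrow> nat" where
  "mrank M = mrank_of M (ground M)"

definition mclosure :: "'e matroid \<Rightarrow> 'e set \<Rightarrow> 'e set" where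
  "mclosure M S = {x \<in> ground M. mrank_of M (insert x S) = mrank_of M S}"

definition circuit :: "'e matroid \<Rightarrow> 'e set \<Rightarrow> bool" where
  "circuit M C \<longleftrightarrow> C \<subseteq> ground M \<and> C \<notin> indep M \<and> (\<forall>D. D \<subset> C \<longrightarrow> D \<in> indep M)"

definition mbasis :: "'e matroid \<Rightarrow> 'e set \<Rightarrow> bool" where
  "mbasis M B \<longleftrightarrow> B \<in> indep M \<and> (\<forall>I\<in>indep M. B \<subseteq> I \<longrightarrow> I = B)"

definition coloop :: "'e matroid \<Rightarrow> 'e \<Rightarrow> bool" where
  "coloop M x \<longleftrightarrow> x \<in> ground M \<and> (\<forall>B. mbasis M B \<longrightarrow> x \<in> B)"

definition mdual :: "'e matroid \<Rightarrow> 'e matroid" where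
  "mdual M = \<lparr>ground = ground M,
     indep = {I. I \<subseteq> ground M \<and> (\<exists>B. mbasis M B \<and> I \<inter> B = {})}\<rparr>"

definition mdelete :: "'e matroid \<Rightarrow> 'e set \<Rightarrow> 'e matroid" where
  "mdelete M S = \<lparr>ground = ground M - S, indep = {I \<in> indep M. I \<inter> S = {}}\<rparr>"

definition mcontract :: "'e matroid \<Rightarrow> 'e set \<Rightarrow> 'e matroid" where
  "mcontract M S = \<lparr>ground = ground M - S,
     indep = {I. I \<subseteq> ground M - S \<and> mrank_of M (I \<union> S) = card I + mrank_of M S}\<rparr>"

definition parallel :: "'e matroid \<Rightarrow> 'e \<Rightarrow> 'e \<Rightarrow> bool" where
  "parallel M e f \<longleftrightarrow> e \<in> ground M \<and> f \<in> ground M \<and> circuit M {e, f}"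

definition in_series :: "'e matroid \<Rightarrow> 'e \<Rightarrow> 'e \<Rightarrow> bool" where
  "in_series M e f \<longleftrightarrow> parallel (mdual M) e f"

section \<open>Configurations\<close>

definition configuration :: "'e set \<Rightarrow> ('e \<Rightarrow> 'k::field) set \<Rightarrow> bool" where
  "configuration E W \<longleftrightarrow> fun_vs.subspace W \<and> W \<subseteq> coord_space E"

text \<open>
  Independence of \<open>S\<close> is linear independence of the family of the restrictions to \<open>W\<close> of the coordinate
  functions \<open>w \<mapsto> w e\<close>, for \<open>e \<in> S\<close>, in the dual space of \<open>W\<close>.
\<close>

definition config_matroid :: "'e set \<Rightarrow> ('e \<Rightarrow> 'k::field) set \<Rightarrow> 'e matroid" where
  "config_matroid E W = \<lparr>ground = E,
     indep = {S. S \<subseteq> E \<and> (\<forall>a. (\<forall>w\<in>W. (\<Sum>e\<in>S. a e * w e) = 0) \<longrightarrow> (\<forall>e\<in>S. a e = 0))}\<rparr>"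

text \<open>Both operations yield configurations in \<open>coord_space (E - S)\<close>.\<close>

definition config_delete :: "('e \<Rightarrow> 'k::field) set \<Rightarrow> 'e set \<Rightarrow> ('e \<Rightarrow> 'k) set" where
  "config_delete W S = (\<lambda>w e. if e \<in> S then 0 else w e) ` W"

definition config_contract :: "('e \<Rightarrow> 'k::field) set \<Rightarrow> 'e set \<Rightarrow> ('e \<Rightarrow> 'k) set" where
  "config_contract W S = {w \<in> W. \<forall>e\<in>S. w e = 0}"

definition config_form :: "'e set \<Rightarrow> ('e \<Rightarrow> 'k::field) \<Rightarrow> ('e \<Rightarrow> 'k) \<Rightarrow> ('e, 'k) mpoly" where
  "config_form E w w' = (\<Sum>e\<in>E. Poly_Mapping.single 0 (w e * w' e) * mvar e)"

definition is_basis_list :: "('e \<Rightarrow> 'k::field) set \<Rightarrow> ('e \<Rightarrow> 'k) list \<Rightarrow> bool" where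
  "is_basis_list W bs \<longleftrightarrow>
     distinct bs \<and> fun_vs.independent (set bs) \<and> fun_vs.span (set bs) = W"

text \<open>
  The configuration polynomial, for some choice of a basis of \<open>W\<close>; another choice changes
  it by the square of a non-zero constant only.
\<close>

definition config_poly :: "'e set \<Rightarrow> ('e \<Rightarrow> 'k::field) set \<Rightarrow> ('e, 'k) mpoly" where
  "config_poly E W = (let bs = (SOME bs. is_basis_list W bs); n = length bs in
     det (mat n n (\<lambda>(i, j). config_form E (bs ! i) (bs ! j))))"

definition config_hypersurface ::
    "'e set \<Rightarrow> ('e \<Rightarrow> 'k::field) set \<Rightarrow> ('e \<Rightarrow> 'k alg_closure) set set" where
  "config_hypersurface E W = {L \<in> lines E. vanishes_on (config_poly E W) L}"

definition config_complement ::
    "'e set \<Rightarrow> ('e \<Rightarrow> 'k::field) set \<Rightarrow> (('e \<Rightarrow> 'k alg_closure) set, 'k alg_closure) fspace" where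
  "config_complement E W = induced (proj_space E) (lines E - config_hypersurface E W)"

end

theory Submission
  imports Defs
begin

text \<open>
  The proof has an algebraic input and a computation with classes.

  Let \<open>e \<noteq> f\<close> be in series.  Then \<open>W\<close> contains a vector \<open>w = e + c f\<close> with \<open>c \<noteq> 0\<close>, but neither \<open>e\<close> nor \<open>f\<close>
  itself (lemmas \<open>series_vector\<close> and \<open>unit_vector_coloop\<close>).  In a basis of \<open>W\<close> consisting of \<open>w\<close> and a
  basis of \<open>W/e\<close>, whose image is a basis of \<open>W \<setminus> {e, f}\<close>, the determinant of the form becomes
  \<open>\<psi>\<^sub>W = x\<^sub>e G + c\<^sup>2 x\<^sub>f D\<close> with \<open>G = \<psi>\<close> of \<open>W/e\<close> and \<open>D = \<psi>\<close> of \<open>W \<setminus> {e, f}\<close>,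
  and \<open>G = D + x\<^sub>f H\<close>, where \<open>D\<close> and \<open>H\<close> involve neither \<open>x\<^sub>e\<close> nor \<open>x\<^sub>f\<close> (lemma \<open>form_det_series\<close>).

  Call \<open>y\<close> the remaining coordinates.  Since \<open>{e, f}\<close> does not span the matroid, some nonzero \<open>z\<close> in \<open>W\<close> has
  \<open>z\<^sub>e = z\<^sub>f = 0\<close>.  At points with \<open>y = 0\<close> it lies in the radical of the form, so \<open>\<psi>\<^sub>W\<close> and \<open>G\<close> vanish there
  (lemma \<open>config_poly_vanishes\<close>).  Hence all three complements are stratified by the first \<open>y\<^sub>i\<close> that is
  nonzero.  Normalising it to \<open>1\<close> turns the strata into subsets of affine spaces (lemma
  \<open>K0_class_proj_set_strata\<close>), and the three strata with the same \<open>i\<close> are given by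
  \<open>x\<^sub>e G + c\<^sup>2 x\<^sub>f D \<noteq> 0\<close>, by \<open>G \<noteq> 0\<close> and by \<open>D \<noteq> 0\<close> over the same set of \<open>y\<close>.

  For these, the identity holds because a factor \<open>G\<^sub>m\<close> kills a class modulo \<open>T\<close> and a factor \<open>A\<^sup>1\<close> preserves it
  (lemma \<open>series_identity_affine\<close>).  Where \<open>G \<noteq> 0\<close>, the substitution \<open>x\<^sub>e \<mapsto> x\<^sub>e G + c\<^sup>2 x\<^sub>f D\<close> exhibits a factor
  \<open>G\<^sub>m\<close> in the first set.  What remains of it, where \<open>G = 0\<close>, is \<open>A\<^sup>1 \<times> C\<close> with \<open>C = {G = 0, D \<noteq> 0}\<close>, as \<open>x\<^sub>e\<close> is
  free there and \<open>D \<noteq> 0\<close> forces \<open>x\<^sub>f \<noteq> 0\<close>.  The part \<open>D = 0\<close> of the second set, \<open>x\<^sub>f H \<noteq> 0\<close>, has a factor \<open>G\<^sub>m\<close>.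
  Its part \<open>D \<noteq> 0\<close> and \<open>C\<close> together form \<open>A\<^sup>1 \<times> {D \<noteq> 0}\<close>.

  If \<open>e = f\<close> is a coloop, then \<open>W/e = W \<setminus> e\<close> and \<open>\<psi>\<^sub>W = x\<^sub>e \<psi>\<close> with \<open>\<psi>\<close> the polynomial of \<open>W/e\<close>, so that every stratum of
  the complement of \<open>W\<close> has a factor \<open>G\<^sub>m\<close>.

  The geometry that this needs is developed for spaces with functions, where morphisms into subsets of affine
  space amount to families of regular functions.  This gives products with \<open>G\<^sub>m\<close>
  (lemma \<open>aff_class_times_Gm\<close>) and shows that complements of hypersurfaces in projective space are varieties
  (lemma \<open>has_model_proj_set\<close>).
\<close>

section \<open>Polynomial functions on geometric points\<close>

text \<open>
  Apart from homogeneity, a polynomial matters below only through its values at geometric points.  So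
  coefficients can be forgotten in favour of a ring of functions that is closed under substitution.
\<close>

definition polyfuns :: "(('i \<Rightarrow> 'k::field alg_closure) \<Rightarrow> 'k alg_closure) set" where
  "polyfuns = range mpoly_at"

lemma mpoly_at_superset:
  assumes "finite S" "Poly_Mapping.keys p \<subseteq> S"
  shows "mpoly_at p v = (\<Sum>m\<in>S. to_ac (Poly_Mapping.lookup p m) *
     (\<Prod>i\<in>Poly_Mapping.keys m. v i ^ Poly_Mapping.lookup m i))"
  unfolding mpoly_at_def using assms
  by (intro sum.mono_neutral_left) (auto simp: in_keys_iff)

lemma monomial_superset:
  fixes v :: "'i \<Rightarrow> 'c::comm_semiring_1"
  assumes "finite S" "Poly_Mapping.keys m \<subseteq> S"
  shows "(\<Prod>i\<in>Poly_Mapping.keys m. v i ^ Poly_Mapping.lookup m i) = (\<Prod>i\<in>S. v i ^ Poly_Mapping.lookup m i)"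
  using assms by (intro prod.mono_neutral_left) (auto simp: in_keys_iff)

lemma monomial_add:
  fixes v :: "'i \<Rightarrow> 'c::comm_semiring_1"
  shows "(\<Prod>i\<in>Poly_Mapping.keys (m + n). v i ^ Poly_Mapping.lookup (m + n) i) =
     (\<Prod>i\<in>Poly_Mapping.keys m. v i ^ Poly_Mapping.lookup m i) *
     (\<Prod>i\<in>Poly_Mapping.keys n. v i ^ Poly_Mapping.lookup n i)"
proof -
  let ?S = "Poly_Mapping.keys m \<union> Poly_Mapping.keys n"
  have "(\<Prod>i\<in>Poly_Mapping.keys (m + n). v i ^ Poly_Mapping.lookup (m + n) i) =
      (\<Prod>i\<in>?S. v i ^ Poly_Mapping.lookup (m + n) i)"
    by (intro monomial_superset keys_add) auto
  also have "\<dots> = (\<Prod>i\<in>?S. v i ^ Poly_Mapping.lookup m i) * (\<Prod>i\<in>?S. v i ^ Poly_Mapping.lookup n i)"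
    by (simp add: lookup_add power_add prod.distrib)
  also have "\<dots> = (\<Prod>i\<in>Poly_Mapping.keys m. v i ^ Poly_Mapping.lookup m i) *
     (\<Prod>i\<in>Poly_Mapping.keys n. v i ^ Poly_Mapping.lookup n i)"
    by (intro arg_cong2[of _ _ _ _ "(*)"] monomial_superset[symmetric]) auto
  finally show ?thesis .
qed

lemma mpoly_at_0 [simp]: "mpoly_at 0 v = 0"
  by (simp add: mpoly_at_def)

lemma mpoly_at_const [simp]: "mpoly_at (Poly_Mapping.single 0 c) v = to_ac c"
  by (simp add: mpoly_at_def)

lemma mpoly_at_1 [simp]: "mpoly_at 1 v = 1"
  using mpoly_at_const[of 1 v] by simp

lemma mpoly_at_mvar [simp]: "mpoly_at (mvar i) v = v i"
  by (simp add: mpoly_at_def mvar_def)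

lemma mpoly_at_add [simp]: "mpoly_at (p + q) v = mpoly_at p v + mpoly_at q v"
proof -
  let ?S = "Poly_Mapping.keys p \<union> Poly_Mapping.keys q"
  have "mpoly_at r v = (\<Sum>m\<in>?S. to_ac (Poly_Mapping.lookup r m) *
      (\<Prod>i\<in>Poly_Mapping.keys m. v i ^ Poly_Mapping.lookup m i))"
    if "r \<in> {p, q, p + q}" for r
    using that keys_add[of p q] by (intro mpoly_at_superset) auto
  then show ?thesis
    by (simp add: lookup_add ring_distribs sum.distrib)
qed

lemma mpoly_at_single_mult:
  "mpoly_at (Poly_Mapping.single m a * Poly_Mapping.single n b) v =
    mpoly_at (Poly_Mapping.single m a) v * mpoly_at (Poly_Mapping.single n b) v"
  by (cases "a = 0"; cases "b = 0") (simp_all add: mult_single mpoly_at_def monomial_add mult_ac)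

lemma mpoly_at_sum [simp]: "mpoly_at (sum f S) v = (\<Sum>x\<in>S. mpoly_at (f x) v)"
  by (induction S rule: infinite_finite_induct) auto

lemma poly_mapping_sum_singles:
  "p = (\<Sum>m\<in>Poly_Mapping.keys p. Poly_Mapping.single m (Poly_Mapping.lookup p m))"
  by (rule poly_mapping_eqI)
    (auto simp: lookup_sum lookup_single when_def in_keys_iff)

lemma mpoly_at_mult [simp]:
  fixes p q :: "('i, 'k::field) mpoly"
  shows "mpoly_at (p * q) v = mpoly_at p v * mpoly_at q v"
proof -
  define s where "s r = (\<Sum>m\<in>Poly_Mapping.keys r. Poly_Mapping.single m (Poly_Mapping.lookup r m))"
    for r :: "('i, 'k) mpoly"
  have s: "s r = r" for r
    unfolding s_def by (rule poly_mapping_sum_singles[symmetric])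
  have "mpoly_at (s p * s q) v = mpoly_at (s p) v * mpoly_at (s q) v"
    unfolding s_def by (simp add: sum_product mpoly_at_single_mult)
  then show ?thesis by (simp add: s)
qed

interpretation mpoly_at: comm_ring_hom "\<lambda>p :: ('i, 'k::field) mpoly. mpoly_at p v" for v
  by unfold_locales simp_all

lemma polyfuns_const: "(\<lambda>_. to_ac c) \<in> polyfuns"
  unfolding polyfuns_def by (rule image_eqI[of _ _ "Poly_Mapping.single 0 c"]) auto

lemma polyfuns_0: "(\<lambda>_. 0) \<in> polyfuns"
  and polyfuns_1: "(\<lambda>_. 1) \<in> polyfuns"
  using polyfuns_const[of 0] polyfuns_const[of 1] by simp_all

lemma polyfuns_var: "(\<lambda>v. v i) \<in> polyfuns"
  unfolding polyfuns_def by (rule image_eqI[of _ _ "mvar i"]) auto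

lemma polyfuns_add: "p \<in> polyfuns \<Longrightarrow> q \<in> polyfuns \<Longrightarrow> (\<lambda>v. p v + q v) \<in> polyfuns"
  unfolding polyfuns_def by (auto simp flip: mpoly_at_add)

lemma polyfuns_mult: "p \<in> polyfuns \<Longrightarrow> q \<in> polyfuns \<Longrightarrow> (\<lambda>v. p v * q v) \<in> polyfuns"
  unfolding polyfuns_def by (auto simp flip: mpoly_at_mult)

lemma polyfuns_minus: "p \<in> polyfuns \<Longrightarrow> (\<lambda>v. - p v) \<in> polyfuns"
  using polyfuns_mult[OF polyfuns_const[of "- 1"], of p] by simp

lemma polyfuns_diff: "p \<in> polyfuns \<Longrightarrow> q \<in> polyfuns \<Longrightarrow> (\<lambda>v. p v - q v) \<in> polyfuns"
  using polyfuns_add[OF _ polyfuns_minus, of p q] by simp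

lemma polyfuns_if:
  "(b \<Longrightarrow> p \<in> polyfuns) \<Longrightarrow> (\<not> b \<Longrightarrow> q \<in> polyfuns) \<Longrightarrow> (\<lambda>v. if b then p v else q v) \<in> polyfuns"
  by (cases b) simp_all

lemmas polyfuns_intros = polyfuns_const polyfuns_0 polyfuns_1 polyfuns_var polyfuns_add
  polyfuns_mult polyfuns_minus polyfuns_diff

text \<open>
  The one principle behind both the substitution of polynomials into polynomials and the evaluation of
  polynomials at regular functions.
\<close>

lemma polyfuns_subst_in:
  fixes p :: "('i \<Rightarrow> 'k::field alg_closure) \<Rightarrow> 'k alg_closure"
  assumes p: "p \<in> polyfuns"
    and const: "\<And>c. (\<lambda>_. to_ac c) \<in> R"
    and var: "\<And>i. g i \<in> R"
    and add: "\<And>a b. a \<in> R \<Longrightarrow> b \<in> R \<Longrightarrow> (\<lambda>x. a x + b x) \<in> R"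
    and mult: "\<And>a b. a \<in> R \<Longrightarrow> b \<in> R \<Longrightarrow> (\<lambda>x. a x * b x) \<in> R"
  shows "(\<lambda>x. p (\<lambda>i. g i x)) \<in> R"
proof -
  have power: "(\<lambda>x. g i x ^ n) \<in> R" for i n
  proof (induction n)
    case 0
    then show ?case using const[of 1] by simp
  next
    case (Suc n)
    then show ?case using mult[OF var Suc] by simp
  qed
  have prod: "finite S \<Longrightarrow> (\<lambda>x. \<Prod>i\<in>S. g i x ^ n i) \<in> R" for S n
  proof (induction S rule: finite_induct)
    case empty
    then show ?case using const[of 1] by simp
  next
    case (insert i S)
    then show ?case using mult[OF power insert(3)] by simp
  qed
  have sum: "finite S \<Longrightarrow> (\<And>m. h m \<in> R) \<Longrightarrow> (\<lambda>x. \<Sum>m\<in>S. to_ac (c m) * h m x) \<in> R"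
    for S :: "('i \<Rightarrow>\<^sub>0 nat) set" and c h
  proof (induction S rule: finite_induct)
    case empty
    then show ?case using const[of 0] by simp
  next
    case (insert m S)
    then show ?case using add[OF mult[OF const, of "h m"] insert(3)] by simp
  qed
  from p obtain q where "p = mpoly_at q"
    by (auto simp: polyfuns_def)
  then show ?thesis
    unfolding mpoly_at_def
    using sum[of "Poly_Mapping.keys q" "\<lambda>m x. \<Prod>i\<in>Poly_Mapping.keys m. g i x ^ Poly_Mapping.lookup m i"
      "Poly_Mapping.lookup q", OF finite_keys prod[OF finite_keys]]
    by (simp only:)
qed

lemma polyfuns_subst:
  assumes "p \<in> polyfuns" "\<And>i. g i \<in> polyfuns"
  shows "(\<lambda>v. p (\<lambda>i. g i v)) \<in> polyfuns"
  using polyfuns_subst_in[where g = g and R = polyfuns, OF assms(1) polyfuns_const assms(2)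
      polyfuns_add polyfuns_mult] .

lemma homogeneous_monomial_degree_add:
  "(\<Sum>i\<in>Poly_Mapping.keys (m + n). Poly_Mapping.lookup (m + n) i) =
     (\<Sum>i\<in>Poly_Mapping.keys m. Poly_Mapping.lookup m i) + (\<Sum>i\<in>Poly_Mapping.keys n. Poly_Mapping.lookup n i)"
  for m n :: "'i \<Rightarrow>\<^sub>0 nat"
  by (rule setsum_keys_plus_distrib) auto

lemma homogeneous_0: "homogeneous d 0"
  by (simp add: homogeneous_def)

lemma homogeneous_const: "homogeneous 0 (Poly_Mapping.single 0 c)"
  by (simp add: homogeneous_def)

lemma homogeneous_mvar: "homogeneous 1 (mvar i)"
  by (simp add: homogeneous_def mvar_def)

lemma homogeneous_add: "homogeneous d p \<Longrightarrow> homogeneous d q \<Longrightarrow> homogeneous d (p + q)"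
  using keys_add[of p q] unfolding homogeneous_def by blast

lemma homogeneous_sum: "(\<And>x. x \<in> S \<Longrightarrow> homogeneous d (f x)) \<Longrightarrow> homogeneous d (sum f S)"
  by (induction S rule: infinite_finite_induct) (auto intro: homogeneous_0 homogeneous_add)

lemma homogeneous_mult: "homogeneous d p \<Longrightarrow> homogeneous d' q \<Longrightarrow> homogeneous (d + d') (p * q)"
  unfolding homogeneous_def
proof
  fix m
  assume d: "\<forall>m\<in>Poly_Mapping.keys p. (\<Sum>i\<in>Poly_Mapping.keys m. Poly_Mapping.lookup m i) = d"
    "\<forall>m\<in>Poly_Mapping.keys q. (\<Sum>i\<in>Poly_Mapping.keys m. Poly_Mapping.lookup m i) = d'"
    and "m \<in> Poly_Mapping.keys (p * q)"
  then obtain a b where "m = a + b" "a \<in> Poly_Mapping.keys p" "b \<in> Poly_Mapping.keys q"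
    using keys_mult[of p q] by blast
  then show "(\<Sum>i\<in>Poly_Mapping.keys m. Poly_Mapping.lookup m i) = d + d'"
    using d by (simp only: homogeneous_monomial_degree_add)
qed

lemma homogeneous_1: "homogeneous 0 1"
  using homogeneous_const[of 1] by simp

lemma homogeneous_power: "homogeneous d p \<Longrightarrow> homogeneous (n * d) (p ^ n)"
  by (induction n) (simp_all add: homogeneous_1 homogeneous_mult)

lemma homogeneous_prod:
  "(\<And>x. x \<in> S \<Longrightarrow> homogeneous 1 (f x)) \<Longrightarrow> finite S \<Longrightarrow> homogeneous (card S) (prod f S)"
proof (induction S rule: infinite_finite_induct)
  case (insert x S)
  then show ?case using homogeneous_mult[of 1 "f x" "card S" "prod f S"] by simp
qed (simp_all add: homogeneous_1)

lemma homogeneous_scale: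
  assumes "homogeneous d p"
  shows "mpoly_at p (\<lambda>i. c * v i) = c ^ d * mpoly_at p v"
proof -
  have "(\<Prod>i\<in>Poly_Mapping.keys m. (c * v i) ^ Poly_Mapping.lookup m i) =
      c ^ d * (\<Prod>i\<in>Poly_Mapping.keys m. v i ^ Poly_Mapping.lookup m i)"
    if "m \<in> Poly_Mapping.keys p" for m
  proof -
    have "(\<Prod>i\<in>Poly_Mapping.keys m. c ^ Poly_Mapping.lookup m i) =
        c ^ (\<Sum>i\<in>Poly_Mapping.keys m. Poly_Mapping.lookup m i)"
      by (rule power_sum[symmetric])
    then show ?thesis using that assms
      by (simp add: power_mult_distrib prod.distrib homogeneous_def)
  qed
  then show ?thesis
    unfolding mpoly_at_def sum_distrib_left
    by (intro sum.cong refl) (simp add: mult.left_commute)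
qed

section \<open>Spaces with functions\<close>

text \<open>
  All spaces that occur (affine and projective space, their subsets, varieties) are spaces with
  functions in the sense of Kempf: the regular functions form a sheaf of rings containing the
  constants from \<open>k\<close>, and a regular function is invertible exactly on the set where it does not
  vanish, which is open.  These axioms suffice to compute with morphisms into affine spaces, and
  they are inherited by arbitrary subsets, so that finiteness conditions such as
  Noetherianity never enter.
\<close>

definition space_with_functions :: "('p, 'k::field alg_closure) fspace \<Rightarrow> bool" where
  "space_with_functions A \<longleftrightarrow> sheaf_condition A \<and> (\<forall>U. openin (zar A) U \<longrightarrow>
     (\<forall>c. (\<lambda>_. to_ac c) \<in> reg A U) \<and>
     (\<forall>f\<in>reg A U. \<forall>g\<in>reg A U. (\<lambda>x. f x + g x) \<in> reg A U \<and> (\<lambda>x. f x * g x) \<in> reg A U) \<and>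
     (\<forall>f\<in>reg A U. openin (zar A) {x\<in>U. f x \<noteq> 0} \<and>
        (\<lambda>x. inverse (f x)) \<in> reg A {x\<in>U. f x \<noteq> 0}))"

lemma sheafD:
  assumes "sheaf_condition A" "openin (zar A) U"
  shows "f \<in> reg A U \<longleftrightarrow> locally_regular A U f"
  using assms by (simp add: sheaf_condition_def)

lemma reg_localI:
  assumes "sheaf_condition A" "openin (zar A) U"
    and "\<And>x. x \<in> U \<Longrightarrow> \<exists>N g. openin (zar A) N \<and> x \<in> N \<and> g \<in> reg A N \<and> (\<forall>y\<in>N \<inter> U. f y = g y)"
  shows "f \<in> reg A U"
  using assms by (simp add: sheafD locally_regular_def)

lemma reg_restrict:
  assumes "sheaf_condition A" "openin (zar A) U" "openin (zar A) V" "V \<subseteq> U" "f \<in> reg A U"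
    "\<And>x. x \<in> V \<Longrightarrow> f x = g x"
  shows "g \<in> reg A V"
proof (rule reg_localI[OF assms(1,3)])
  fix x assume "x \<in> V"
  then show "\<exists>N h. openin (zar A) N \<and> x \<in> N \<and> h \<in> reg A N \<and> (\<forall>y\<in>N \<inter> V. g y = h y)"
    using assms by (intro exI[of _ U] exI[of _ f]) auto
qed

lemma swf_sheaf: "space_with_functions A \<Longrightarrow> sheaf_condition A"
  by (simp add: space_with_functions_def)

lemma swf_reg:
  assumes "space_with_functions A" "openin (zar A) U"
  shows swf_const: "(\<lambda>_. to_ac c) \<in> reg A U"
    and swf_add: "f \<in> reg A U \<Longrightarrow> g \<in> reg A U \<Longrightarrow> (\<lambda>x. f x + g x) \<in> reg A U"
    and swf_mult: "f \<in> reg A U \<Longrightarrow> g \<in> reg A U \<Longrightarrow> (\<lambda>x. f x * g x) \<in> reg A U"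
    and swf_open: "f \<in> reg A U \<Longrightarrow> openin (zar A) {x\<in>U. f x \<noteq> 0}"
    and swf_inverse: "f \<in> reg A U \<Longrightarrow> (\<lambda>x. inverse (f x)) \<in> reg A {x\<in>U. f x \<noteq> 0}"
  using assms by (simp_all add: space_with_functions_def)

lemma swf_polyfun:
  assumes "space_with_functions A" "openin (zar A) U" "p \<in> polyfuns" "\<And>i. g i \<in> reg A U"
  shows "(\<lambda>x. p (\<lambda>i. g i x)) \<in> reg A U"
  using polyfuns_subst_in[where g = g and R = "reg A U", OF assms(3) swf_const[OF assms(1,2)]
      assms(4) swf_add[OF assms(1,2)] swf_mult[OF assms(1,2)]] .

lemma swf_divide:
  assumes A: "space_with_functions A" "openin (zar A) U" and "f \<in> reg A U" "g \<in> reg A U"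
    and "\<And>x. x \<in> U \<Longrightarrow> g x \<noteq> 0"
  shows "(\<lambda>x. f x / g x) \<in> reg A U"
proof -
  have "{x\<in>U. g x \<noteq> 0} = U"
    using assms(5) by auto
  then show ?thesis
    using swf_mult[OF A assms(3)] swf_inverse[OF A assms(4)] by (simp add: divide_inverse)
qed

text \<open>
  The common source of examples: the regular functions are those that locally lie in a class \<open>F\<close> of
  fractions.  The sheaf condition is then automatic, and the operations only have to be checked for
  fractions on a common domain.
\<close>

lemma space_with_functionsI:
  assumes reg: "\<And>U f. openin (zar A) U \<Longrightarrow>
      f \<in> reg A U \<longleftrightarrow> (\<forall>x\<in>U. \<exists>N. openin (zar A) N \<and> x \<in> N \<and> N \<subseteq> U \<and> f \<in> F N)"
    and restrict: "\<And>N M f g. f \<in> F N \<Longrightarrow> openin (zar A) N \<Longrightarrow> openin (zar A) M \<Longrightarrow> M \<subseteq> N \<Longrightarrow>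
      (\<And>x. x \<in> M \<Longrightarrow> f x = g x) \<Longrightarrow> g \<in> F M"
    and const: "\<And>N c. openin (zar A) N \<Longrightarrow> (\<lambda>_. to_ac c) \<in> F N"
    and add: "\<And>N f g. openin (zar A) N \<Longrightarrow> f \<in> F N \<Longrightarrow> g \<in> F N \<Longrightarrow> (\<lambda>x. f x + g x) \<in> F N"
    and mult: "\<And>N f g. openin (zar A) N \<Longrightarrow> f \<in> F N \<Longrightarrow> g \<in> F N \<Longrightarrow> (\<lambda>x. f x * g x) \<in> F N"
    and inverse: "\<And>N f. openin (zar A) N \<Longrightarrow> f \<in> F N \<Longrightarrow>
      openin (zar A) {x\<in>N. f x \<noteq> 0} \<and> (\<lambda>x. inverse (f x)) \<in> F {x\<in>N. f x \<noteq> 0}"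
  shows "space_with_functions A"
proof -
  have F_reg: "f \<in> reg A N" if "f \<in> F N" "openin (zar A) N" for f N
    using that by (auto simp: reg)
  have sheaf: "sheaf_condition A"
    unfolding sheaf_condition_def
  proof (intro allI impI Set.set_eqI iffI)
    fix U f assume U: "openin (zar A) U"
    show "f \<in> {f. locally_regular A U f}" if "f \<in> reg A U"
      using that U unfolding locally_regular_def by auto
    assume "f \<in> {f. locally_regular A U f}"
    then have loc: "locally_regular A U f" by simp
    show "f \<in> reg A U"
      unfolding reg[OF U]
    proof
      fix x assume x: "x \<in> U"
      with loc obtain N g where N: "openin (zar A) N" "x \<in> N" "g \<in> reg A N" "\<forall>y\<in>N \<inter> U. f y = g y"
        unfolding locally_regular_def by blast
      then obtain M where M: "openin (zar A) M" "x \<in> M" "M \<subseteq> N" "g \<in> F M"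
        unfolding reg[OF N(1)] by blast
      have "f \<in> F (M \<inter> U)"
        by (rule restrict[OF M(4,1)]) (use M N U in auto)
      then show "\<exists>N. openin (zar A) N \<and> x \<in> N \<and> N \<subseteq> U \<and> f \<in> F N"
        using M U x by (intro exI[of _ "M \<inter> U"]) auto
    qed
  qed
  have binary: "(\<lambda>x. h (f x) (g x)) \<in> reg A U"
    if U: "openin (zar A) U" and f: "f \<in> reg A U" and g: "g \<in> reg A U"
      and h: "\<And>N f g. openin (zar A) N \<Longrightarrow> f \<in> F N \<Longrightarrow> g \<in> F N \<Longrightarrow> (\<lambda>x. h (f x) (g x)) \<in> F N"
    for U f g h
    unfolding reg[OF U]
  proof
    fix x assume x: "x \<in> U"
    obtain N where N: "openin (zar A) N" "x \<in> N" "N \<subseteq> U" "f \<in> F N"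
      using f x unfolding reg[OF U] by blast
    obtain M where M: "openin (zar A) M" "x \<in> M" "M \<subseteq> U" "g \<in> F M"
      using g x unfolding reg[OF U] by blast
    have o: "openin (zar A) (N \<inter> M)"
      using N M by auto
    have "f \<in> F (N \<inter> M)" "g \<in> F (N \<inter> M)"
      using restrict[OF N(4,1) o, of f] restrict[OF M(4,1) o, of g] by auto
    then show "\<exists>N. openin (zar A) N \<and> x \<in> N \<and> N \<subseteq> U \<and> (\<lambda>x. h (f x) (g x)) \<in> F N"
      using h[OF o] o N M by (intro exI[of _ "N \<inter> M"]) auto
  qed
  have inv: "openin (zar A) {x\<in>U. f x \<noteq> 0} \<and> (\<lambda>x. inverse (f x)) \<in> reg A {x\<in>U. f x \<noteq> 0}"
    if U: "openin (zar A) U" and f: "f \<in> reg A U" for U f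
  proof -
    have ex: "\<exists>N. openin (zar A) N \<and> x \<in> N \<and> N \<subseteq> {x\<in>U. f x \<noteq> 0} \<and> (\<lambda>x. inverse (f x)) \<in> F N"
      if x: "x \<in> {x\<in>U. f x \<noteq> 0}" for x
    proof -
      obtain N where N: "openin (zar A) N" "x \<in> N" "N \<subseteq> U" "f \<in> F N"
        using f x unfolding reg[OF U] by blast
      from inverse[OF N(1,4)] x N show ?thesis
        by (intro exI[of _ "{x\<in>N. f x \<noteq> 0}"]) auto
    qed
    then have o: "openin (zar A) {x\<in>U. f x \<noteq> 0}"
      by (subst openin_subopen) meson
    with ex show ?thesis
      by (simp add: reg)
  qed
  show ?thesis
    unfolding space_with_functions_def
    using sheaf F_reg const binary[where h = "(+)"] binary[where h = "(*)"] add mult inv by simp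
qed

lemma pts_induced [simp]: "pts (induced A S) = pts A \<inter> S"
  by (simp add: induced_def)

lemma openin_induced: "openin (zar (induced A S)) U \<longleftrightarrow> (\<exists>T. openin (zar A) T \<and> U = T \<inter> S)"
  by (simp add: induced_def openin_subtopology)

lemma reg_induced [simp]: "f \<in> reg (induced A S) U \<longleftrightarrow> locally_regular A U f"
  by (simp add: induced_def)

lemma reg_induced_of_reg:
  assumes "openin (zar A) U" "f \<in> reg A U"
  shows "f \<in> reg (induced A S) (U \<inter> S)"
  using assms by (auto simp: locally_regular_def)

text \<open>
  A function that locally extends to a function that locally extends to a regular function of \<open>A\<close>
  locally extends to a regular function of \<open>A\<close>: shrink the neighbourhood.
\<close>

lemma sheaf_induced:
  assumes A: "sheaf_condition A"
  shows "sheaf_condition (induced A S)"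
  unfolding sheaf_condition_def
proof (intro allI impI Set.set_eqI iffI)
  fix V f assume V: "openin (zar (induced A S)) V"
  show "f \<in> {f. locally_regular (induced A S) V f}" if "f \<in> reg (induced A S) V"
    using that V by (auto simp: locally_regular_def[of "induced A S"])
  assume f: "f \<in> {f. locally_regular (induced A S) V f}"
  have "V \<subseteq> S"
    using openin_subset[OF V] by simp
  show "f \<in> reg (induced A S) V"
    unfolding reg_induced locally_regular_def
  proof
    fix x assume "x \<in> V"
    with f obtain N g where N: "openin (zar (induced A S)) N" "x \<in> N" "locally_regular A N g"
      "\<forall>y\<in>N \<inter> V. f y = g y"
      unfolding mem_Collect_eq reg_induced locally_regular_def[of "induced A S"] by blast
    then obtain M h where M: "openin (zar A) M" "x \<in> M" "h \<in> reg A M" "\<forall>y\<in>M \<inter> N. g y = h y"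
      unfolding locally_regular_def by blast
    from N obtain O' where O: "openin (zar A) O'" "N = O' \<inter> S"
      by (auto simp: openin_induced)
    have "h \<in> reg A (M \<inter> O')"
      by (rule reg_restrict[OF A M(1) _ _ M(3)]) (use M O in auto)
    then show "\<exists>N g. openin (zar A) N \<and> x \<in> N \<and> g \<in> reg A N \<and> (\<forall>y\<in>N \<inter> V. f y = g y)"
      using M N O \<open>V \<subseteq> S\<close> by (intro exI[of _ "M \<inter> O'"] exI[of _ h]) auto
  qed
qed

text \<open>
  The fractions on a subset are the restrictions of regular functions from the surrounding space.
\<close>

lemma space_with_functions_induced:
  assumes A: "space_with_functions A"
  shows "space_with_functions (induced A S)"
proof (rule space_with_functionsI)
  note sh = swf_sheaf[OF A]
  define F where "F M = {f. \<exists>N g. openin (zar A) N \<and> g \<in> reg A N \<and> M = N \<inter> S \<and> (\<forall>x\<in>M. f x = g x)}" for M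
  have FI: "f \<in> F M" if "openin (zar A) N" "g \<in> reg A N" "M = N \<inter> S" "\<And>x. x \<in> M \<Longrightarrow> f x = g x" for f g M N
    unfolding F_def using that by (intro CollectI exI[of _ N] exI[of _ g]) simp
  have FE: thesis if "f \<in> F M"
    "\<And>N g. openin (zar A) N \<Longrightarrow> g \<in> reg A N \<Longrightarrow> M = N \<inter> S \<Longrightarrow> \<forall>x\<in>M. f x = g x \<Longrightarrow> thesis"
    for f M thesis
    using that(1) unfolding F_def mem_Collect_eq by (elim exE conjE) (rule that(2))
  show "f \<in> reg (induced A S) U \<longleftrightarrow>
      (\<forall>x\<in>U. \<exists>N. openin (zar (induced A S)) N \<and> x \<in> N \<and> N \<subseteq> U \<and> f \<in> F N)" (is "?l \<longleftrightarrow> ?r")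
    if "openin (zar (induced A S)) U" for U f
  proof
    from that obtain O' where O: "openin (zar A) O'" "U = O' \<inter> S"
      by (auto simp: openin_induced)
    assume l: ?l
    show ?r
    proof
      fix x assume x: "x \<in> U"
      with l obtain N g where N: "openin (zar A) N" "x \<in> N" "g \<in> reg A N" "\<forall>y\<in>N \<inter> U. f y = g y"
        by (auto simp: locally_regular_def)
      have "g \<in> reg A (N \<inter> O')"
        by (rule reg_restrict[OF sh N(1) _ _ N(3)]) (use N O in auto)
      then have "f \<in> F (N \<inter> O' \<inter> S)"
        by (rule FI[of "N \<inter> O'" g, rotated]) (use N O in auto)
      then show "\<exists>N. openin (zar (induced A S)) N \<and> x \<in> N \<and> N \<subseteq> U \<and> f \<in> F N"
        using N O x by (intro exI[of _ "N \<inter> O' \<inter> S"]) (auto simp: openin_induced)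
    qed
  next
    assume r: ?r
    show ?l
      unfolding reg_induced locally_regular_def
    proof
      fix x assume "x \<in> U"
      with r obtain M where "x \<in> M" "M \<subseteq> U" "f \<in> F M" by blast
      from \<open>f \<in> F M\<close> obtain N g where "openin (zar A) N" "g \<in> reg A N" "M = N \<inter> S"
        "\<forall>x\<in>M. f x = g x"
        by (rule FE)
      note M = \<open>x \<in> M\<close> \<open>M \<subseteq> U\<close> this
      have "U \<subseteq> S"
        using that by (auto simp: openin_induced)
      then show "\<exists>N g. openin (zar A) N \<and> x \<in> N \<and> g \<in> reg A N \<and> (\<forall>y\<in>N \<inter> U. f y = g y)"
        using M by (intro exI[of _ N] exI[of _ g]) auto
    qed
  qed
  show "g \<in> F M" if f: "f \<in> F N" and M: "openin (zar (induced A S)) M" "M \<subseteq> N"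
    and fg: "\<And>x. x \<in> M \<Longrightarrow> f x = g x" for N M f g
  proof -
    from f obtain N' h where N': "openin (zar A) N'" "h \<in> reg A N'" "N = N' \<inter> S" "\<forall>x\<in>N. f x = h x"
      by (rule FE)
    from M obtain O' where O: "openin (zar A) O'" "M = O' \<inter> S"
      by (auto simp: openin_induced)
    have "h \<in> reg A (N' \<inter> O')"
      by (rule reg_restrict[OF sh N'(1) _ _ N'(2)]) (use N' O in auto)
    moreover have "M = N' \<inter> O' \<inter> S"
      using O N' M by auto
    moreover have "g x = h x" if "x \<in> M" for x
      using N'(4) M(2) fg[OF that] that by force
    ultimately show ?thesis
      by (intro FI[of "N' \<inter> O'" h M g] openin_Int N' O)
  qed
  show "(\<lambda>_. to_ac c) \<in> F N" if "openin (zar (induced A S)) N" for N c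
  proof -
    from that obtain O' where "openin (zar A) O'" "N = O' \<inter> S"
      by (auto simp: openin_induced)
    then show ?thesis
      using FI[OF _ swf_const[OF A, of O' c]] by auto
  qed
  have binary: "(\<lambda>x. h (f x) (g x)) \<in> F N"
    if f: "f \<in> F N" and g: "g \<in> F N"
      and h: "\<And>U f g. openin (zar A) U \<Longrightarrow> f \<in> reg A U \<Longrightarrow> g \<in> reg A U \<Longrightarrow> (\<lambda>x. h (f x) (g x)) \<in> reg A U"
    for f g h N
  proof -
    from f obtain N1 f' where N1: "openin (zar A) N1" "f' \<in> reg A N1" "N = N1 \<inter> S" "\<forall>x\<in>N. f x = f' x"
      by (rule FE)
    from g obtain N2 g' where N2: "openin (zar A) N2" "g' \<in> reg A N2" "N = N2 \<inter> S" "\<forall>x\<in>N. g x = g' x"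
      by (rule FE)
    have o: "openin (zar A) (N1 \<inter> N2)"
      using N1 N2 by auto
    have "f' \<in> reg A (N1 \<inter> N2)" "g' \<in> reg A (N1 \<inter> N2)"
      using reg_restrict[OF sh N1(1) o _ N1(2), of f'] reg_restrict[OF sh N2(1) o _ N2(2), of g'] by auto
    from h[OF o this] show ?thesis
      by (rule FI[OF o]) (use N1 N2 in auto)
  qed
  show "(\<lambda>x. f x + g x) \<in> F N" "(\<lambda>x. f x * g x) \<in> F N" if "f \<in> F N" "g \<in> F N" for f g N
    using binary[OF that, of "(+)"] binary[OF that, of "(*)"] swf_add[OF A] swf_mult[OF A] by auto
  show "openin (zar (induced A S)) {x\<in>N. f x \<noteq> 0} \<and> (\<lambda>x. inverse (f x)) \<in> F {x\<in>N. f x \<noteq> 0}"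
    if "f \<in> F N" for f N
  proof -
    from that obtain N' h where N': "openin (zar A) N'" "h \<in> reg A N'" "N = N' \<inter> S" "\<forall>x\<in>N. f x = h x"
      by (rule FE)
    have eq: "{x\<in>N. f x \<noteq> 0} = {x\<in>N'. h x \<noteq> 0} \<inter> S"
      using N' by auto
    have o: "openin (zar A) {x\<in>N'. h x \<noteq> 0}"
      using swf_open[OF A N'(1,2)] .
    show ?thesis
    proof
      show "openin (zar (induced A S)) {x\<in>N. f x \<noteq> 0}"
        unfolding eq using o by (auto simp: openin_induced)
      show "(\<lambda>x. inverse (f x)) \<in> F {x\<in>N. f x \<noteq> 0}"
        by (rule FI[OF o swf_inverse[OF A N'(1,2)] eq]) (use N' in auto)
    qed
  qed
qed

subsection \<open>Morphisms\<close>

lemma morphism_in_pts: "morphism A B \<phi> \<Longrightarrow> x \<in> pts A \<Longrightarrow> \<phi> x \<in> pts B"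
  by (auto simp: morphism_def continuous_map_def)

lemma morphism_open:
  "morphism A B \<phi> \<Longrightarrow> openin (zar B) V \<Longrightarrow> openin (zar A) {x\<in>pts A. \<phi> x \<in> V}"
  by (auto simp: morphism_def continuous_map_def)

lemma morphism_reg:
  "morphism A B \<phi> \<Longrightarrow> openin (zar B) V \<Longrightarrow> f \<in> reg B V \<Longrightarrow>
     (\<lambda>x. f (\<phi> x)) \<in> reg A {x\<in>pts A. \<phi> x \<in> V}"
  by (auto simp: morphism_def comp_def)

lemma morphismI:
  assumes "\<And>x. x \<in> pts A \<Longrightarrow> \<phi> x \<in> pts B"
    and "\<And>V. openin (zar B) V \<Longrightarrow> openin (zar A) {x\<in>pts A. \<phi> x \<in> V}"
    and "\<And>V f. openin (zar B) V \<Longrightarrow> f \<in> reg B V \<Longrightarrow> (\<lambda>x. f (\<phi> x)) \<in> reg A {x\<in>pts A. \<phi> x \<in> V}"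
  shows "morphism A B \<phi>"
  using assms by (auto simp: morphism_def comp_def continuous_map_def)

lemma morphism_compose:
  assumes "morphism A B \<phi>" "morphism B C \<psi>"
  shows "morphism A C (\<lambda>x. \<psi> (\<phi> x))"
proof (rule morphismI)
  show "\<psi> (\<phi> x) \<in> pts C" if "x \<in> pts A" for x
    using that assms morphism_in_pts by metis
  have eq: "{x\<in>pts A. \<phi> x \<in> {y\<in>pts B. \<psi> y \<in> V}} = {x\<in>pts A. \<psi> (\<phi> x) \<in> V}" for V
    using morphism_in_pts[OF assms(1)] by auto
  fix V assume V: "openin (zar C) V"
  show "openin (zar A) {x\<in>pts A. \<psi> (\<phi> x) \<in> V}"
    using morphism_open[OF assms(1) morphism_open[OF assms(2) V]] unfolding eq .
  show "(\<lambda>x. f (\<psi> (\<phi> x))) \<in> reg A {x\<in>pts A. \<psi> (\<phi> x) \<in> V}" if "f \<in> reg C V" for f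
    using morphism_reg[OF assms(1) morphism_open[OF assms(2) V] morphism_reg[OF assms(2) V that]]
    unfolding eq .
qed

lemma morphism_id: "morphism A A (\<lambda>x. x)"
proof (rule morphismI)
  fix V assume "openin (zar A) V"
  then have "{x\<in>pts A. x \<in> V} = V"
    using openin_subset by blast
  then show "openin (zar A) V \<Longrightarrow> openin (zar A) {x\<in>pts A. x \<in> V}"
    "f \<in> reg A V \<Longrightarrow> f \<in> reg A {x\<in>pts A. x \<in> V}" for f
    by simp_all
qed

lemma morphism_restrict:
  assumes \<phi>: "morphism A B \<phi>" and S: "\<And>x. x \<in> pts A \<Longrightarrow> x \<in> S \<Longrightarrow> \<phi> x \<in> S'"
  shows "morphism (induced A S) (induced B S') \<phi>"
proof (rule morphismI)
  show "\<phi> x \<in> pts (induced B S')" if "x \<in> pts (induced A S)" for x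
    using that S morphism_in_pts[OF \<phi>] by auto
  fix V assume V: "openin (zar (induced B S')) V"
  then obtain O' where O: "openin (zar B) O'" "V = O' \<inter> S'"
    by (auto simp: openin_induced)
  show "openin (zar (induced A S)) {x\<in>pts (induced A S). \<phi> x \<in> V}"
    unfolding openin_induced
    using morphism_open[OF \<phi> O(1)] S O
    by (intro exI[of _ "{x\<in>pts A. \<phi> x \<in> O'}"]) auto
  show "(\<lambda>x. f (\<phi> x)) \<in> reg (induced A S) {x\<in>pts (induced A S). \<phi> x \<in> V}"
    if f: "f \<in> reg (induced B S') V" for f
    unfolding reg_induced locally_regular_def
  proof
    fix x assume x: "x \<in> {x\<in>pts (induced A S). \<phi> x \<in> V}"
    with f obtain N g where N: "openin (zar B) N" "\<phi> x \<in> N" "g \<in> reg B N" "\<forall>y\<in>N \<inter> V. f y = g y"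
      unfolding reg_induced locally_regular_def by blast
    show "\<exists>N g. openin (zar A) N \<and> x \<in> N \<and> g \<in> reg A N \<and>
        (\<forall>y\<in>N \<inter> {x\<in>pts (induced A S). \<phi> x \<in> V}. f (\<phi> y) = g y)"
      using morphism_open[OF \<phi> N(1)] morphism_reg[OF \<phi> N(1,3)] N x
      by (intro exI[of _ "{x\<in>pts A. \<phi> x \<in> N}"] exI[of _ "\<lambda>x. g (\<phi> x)"]) auto
  qed
qed

lemma morphism_into_induced:
  assumes sheaf: "sheaf_condition A" and \<phi>: "morphism A B \<phi>" and S: "\<And>x. x \<in> pts A \<Longrightarrow> \<phi> x \<in> S"
  shows "morphism A (induced B S) \<phi>"
proof (rule morphismI)
  show "\<phi> x \<in> pts (induced B S)" if "x \<in> pts A" for x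
    using that S morphism_in_pts[OF \<phi>] by auto
  fix V assume "openin (zar (induced B S)) V"
  then obtain O' where O: "openin (zar B) O'" "V = O' \<inter> S"
    by (auto simp: openin_induced)
  then have "{x\<in>pts A. \<phi> x \<in> V} = {x\<in>pts A. \<phi> x \<in> O'}"
    using S by auto
  with morphism_open[OF \<phi> O(1)] show o: "openin (zar A) {x\<in>pts A. \<phi> x \<in> V}"
    by simp
  show "(\<lambda>x. f (\<phi> x)) \<in> reg A {x\<in>pts A. \<phi> x \<in> V}" if f: "f \<in> reg (induced B S) V" for f
  proof (rule reg_localI[OF sheaf o])
    fix x assume x: "x \<in> {x\<in>pts A. \<phi> x \<in> V}"
    with f obtain N g where N: "openin (zar B) N" "\<phi> x \<in> N" "g \<in> reg B N" "\<forall>y\<in>N \<inter> V. f y = g y"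
      unfolding reg_induced locally_regular_def by blast
    then show "\<exists>N g. openin (zar A) N \<and> x \<in> N \<and> g \<in> reg A N \<and>
        (\<forall>y\<in>N \<inter> {x\<in>pts A. \<phi> x \<in> V}. f (\<phi> y) = g y)"
      using morphism_open[OF \<phi> N(1)] morphism_reg[OF \<phi> N(1,3)] x
      by (intro exI[of _ "{x\<in>pts A. \<phi> x \<in> N}"] exI[of _ "\<lambda>x. g (\<phi> x)"]) auto
  qed
qed

text \<open>
  For a target whose regular functions are local fractions, only fractions have to be pulled back.
\<close>

lemma morphism_fractionsI:
  assumes sheaf: "sheaf_condition A"
    and reg: "\<And>U f. openin (zar B) U \<Longrightarrow>
      f \<in> reg B U \<longleftrightarrow> (\<forall>x\<in>U. \<exists>N. openin (zar B) N \<and> x \<in> N \<and> N \<subseteq> U \<and> f \<in> F N)"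
    and pts: "\<And>x. x \<in> pts A \<Longrightarrow> \<phi> x \<in> pts B"
    and cont: "\<And>V. openin (zar B) V \<Longrightarrow> openin (zar A) {x\<in>pts A. \<phi> x \<in> V}"
    and pull: "\<And>N h x. openin (zar B) N \<Longrightarrow> h \<in> F N \<Longrightarrow> x \<in> pts A \<Longrightarrow> \<phi> x \<in> N \<Longrightarrow>
      \<exists>M g. openin (zar A) M \<and> x \<in> M \<and> g \<in> reg A M \<and> (\<forall>y\<in>M. h (\<phi> y) = g y)"
  shows "morphism A B \<phi>"
proof (rule morphismI[OF pts cont])
  fix V f assume V: "openin (zar B) V" and f: "f \<in> reg B V"
  show "(\<lambda>x. f (\<phi> x)) \<in> reg A {x\<in>pts A. \<phi> x \<in> V}"
  proof (rule reg_localI[OF sheaf cont[OF V]])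
    fix x assume x: "x \<in> {x\<in>pts A. \<phi> x \<in> V}"
    with f obtain N where "openin (zar B) N" "\<phi> x \<in> N" "f \<in> F N"
      unfolding reg[OF V] by blast
    with pull[of N f x] x show "\<exists>M g. openin (zar A) M \<and> x \<in> M \<and> g \<in> reg A M \<and>
        (\<forall>y\<in>M \<inter> {x\<in>pts A. \<phi> x \<in> V}. f (\<phi> y) = g y)"
      by blast
  qed
qed

lemma isomorphicI:
  assumes "morphism A B \<phi>" "morphism B A \<psi>" "\<And>x. x \<in> pts A \<Longrightarrow> \<psi> (\<phi> x) = x"
    "\<And>y. y \<in> pts B \<Longrightarrow> \<phi> (\<psi> y) = y"
  shows "isomorphic A B"
  using assms unfolding isomorphic_def by blast

lemma isomorphicE:
  assumes "isomorphic A B"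
  obtains \<phi> \<psi> where "morphism A B \<phi>" "morphism B A \<psi>" "\<And>x. x \<in> pts A \<Longrightarrow> \<psi> (\<phi> x) = x"
    "\<And>y. y \<in> pts B \<Longrightarrow> \<phi> (\<psi> y) = y"
  using assms unfolding isomorphic_def by blast

lemma isomorphic_refl: "isomorphic A A"
  by (rule isomorphicI[OF morphism_id morphism_id]) auto

lemma isomorphic_sym: "isomorphic A B \<Longrightarrow> isomorphic B A"
  unfolding isomorphic_def by blast

lemma isomorphic_trans:
  assumes "isomorphic A B" "isomorphic B C"
  shows "isomorphic A C"
proof -
  from assms(1) obtain \<phi> \<psi> where 1: "morphism A B \<phi>" "morphism B A \<psi>"
    "\<And>x. x \<in> pts A \<Longrightarrow> \<psi> (\<phi> x) = x" "\<And>y. y \<in> pts B \<Longrightarrow> \<phi> (\<psi> y) = y"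
    by (rule isomorphicE) blast
  from assms(2) obtain \<phi>' \<psi>' where 2: "morphism B C \<phi>'" "morphism C B \<psi>'"
    "\<And>x. x \<in> pts B \<Longrightarrow> \<psi>' (\<phi>' x) = x" "\<And>y. y \<in> pts C \<Longrightarrow> \<phi>' (\<psi>' y) = y"
    by (rule isomorphicE) blast
  show ?thesis
    using 1 2 morphism_in_pts[OF 1(1)] morphism_in_pts[OF 2(2)]
    by (intro isomorphicI[OF morphism_compose[OF 1(1) 2(1)] morphism_compose[OF 2(2) 1(2)]]) auto
qed

lemma isomorphic_restrict:
  assumes "morphism A B \<phi>" "morphism B A \<psi>" "\<And>x. x \<in> pts A \<Longrightarrow> \<psi> (\<phi> x) = x"
    "\<And>y. y \<in> pts B \<Longrightarrow> \<phi> (\<psi> y) = y"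
    and "\<And>x. x \<in> pts A \<Longrightarrow> x \<in> S \<longleftrightarrow> \<phi> x \<in> S'"
  shows "isomorphic (induced A S) (induced B S')"
proof (rule isomorphicI)
  show "morphism (induced A S) (induced B S') \<phi>"
    by (rule morphism_restrict[OF assms(1)]) (use assms(5) in auto)
  show "morphism (induced B S') (induced A S) \<psi>"
    by (rule morphism_restrict[OF assms(2)]) (use assms(4,5) morphism_in_pts[OF assms(2)] in auto)
qed (use assms in auto)

lemma isomorphic_induced_subset:
  assumes "isomorphic A B"
  obtains \<phi> where "\<And>S. isomorphic (induced A S) (induced B (\<phi> ` (S \<inter> pts A)))"
    "\<And>S. openin (zar A) S \<Longrightarrow> openin (zar B) (\<phi> ` S)" "\<phi> ` pts A = pts B"
    "\<And>S. isomorphic (induced A {x\<in>pts A. \<phi> x \<in> S}) (induced B S)"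
    "\<And>S. closedin (zar B) S \<Longrightarrow> closedin (zar A) {x\<in>pts A. \<phi> x \<in> S}"
proof -
  from assms obtain \<phi> \<psi> where 1: "morphism A B \<phi>" "morphism B A \<psi>"
    "\<And>x. x \<in> pts A \<Longrightarrow> \<psi> (\<phi> x) = x" "\<And>y. y \<in> pts B \<Longrightarrow> \<phi> (\<psi> y) = y"
    by (rule isomorphicE) blast
  note in_pts = morphism_in_pts[OF 1(1)] morphism_in_pts[OF 1(2)]
  show thesis
  proof (rule that[of \<phi>])
    show "isomorphic (induced A S) (induced B (\<phi> ` (S \<inter> pts A)))" for S
    proof (rule isomorphic_restrict[OF 1])
      show "x \<in> S \<longleftrightarrow> \<phi> x \<in> \<phi> ` (S \<inter> pts A)" if "x \<in> pts A" for x
        using that by (metis 1(3) Int_iff image_iff)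
    qed
    show "isomorphic (induced A {x\<in>pts A. \<phi> x \<in> S}) (induced B S)" for S
      by (rule isomorphic_restrict[OF 1]) auto
    show "openin (zar B) (\<phi> ` S)" if "openin (zar A) S" for S
    proof -
      have "\<phi> ` S = {y\<in>pts B. \<psi> y \<in> S}"
        using openin_subset[OF that] in_pts 1 by (auto simp: image_iff) (metis subsetD)
      then show ?thesis
        using morphism_open[OF 1(2) that] by simp
    qed
    show "\<phi> ` pts A = pts B"
      using in_pts 1 by force
    show "closedin (zar A) {x\<in>pts A. \<phi> x \<in> S}" if "closedin (zar B) S" for S
      using 1(1) that by (simp add: morphism_def continuous_map_closedin)
  qed
qed

lemma morphism_inclusion: "morphism (induced A S) A (\<lambda>x. x)"
proof (rule morphismI)
  fix V assume V: "openin (zar A) V"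
  then have eq: "{x\<in>pts (induced A S). x \<in> V} = V \<inter> S"
    using openin_subset by fastforce
  show "openin (zar (induced A S)) {x\<in>pts (induced A S). x \<in> V}"
    unfolding eq using V by (auto simp: openin_induced)
  show "f \<in> reg (induced A S) {x\<in>pts (induced A S). x \<in> V}" if "f \<in> reg A V" for f
    unfolding eq by (rule reg_induced_of_reg[OF V that])
qed simp

text \<open>
  Equality may fail: as records the two structures can differ in the values of \<^const>\<open>reg\<close> on sets that are
  not open.
\<close>

lemma isomorphic_induced_induced:
  assumes A: "sheaf_condition A" and TS: "T \<subseteq> S"
  shows "isomorphic (induced (induced A S) T) (induced A T)"
proof (rule isomorphicI)
  show "morphism (induced (induced A S) T) (induced A T) (\<lambda>x. x)"
    by (rule morphism_into_induced[OF sheaf_induced[OF sheaf_induced[OF A]]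
          morphism_compose[OF morphism_inclusion morphism_inclusion]]) simp
  have "morphism (induced A T) (induced A S) (\<lambda>x. x)"
    by (rule morphism_into_induced[OF sheaf_induced[OF A] morphism_inclusion]) (use TS in auto)
  then show "morphism (induced A T) (induced (induced A S) T) (\<lambda>x. x)"
    by (rule morphism_into_induced[OF sheaf_induced[OF A]]) simp
qed simp_all

lemma isomorphic_induced_cong:
  assumes "S \<inter> pts A = T \<inter> pts A"
  shows "isomorphic (induced A S) (induced A T)"
  by (rule isomorphic_restrict[OF morphism_id morphism_id]) (use assms in auto)

text \<open>
  The next two lemmas make every variety a space with functions, as it is locally isomorphic to a closed
  subset of affine space.  Arbitrary varieties occur as test objects in the universal property of
  products.
\<close>

lemma space_with_functions_isomorphic:
  assumes sheaf: "sheaf_condition A" and iso: "isomorphic A B" and B: "space_with_functions B"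
  shows "space_with_functions A"
proof -
  from iso obtain \<phi> \<psi> where 1: "morphism A B \<phi>" "morphism B A \<psi>"
    "\<And>x. x \<in> pts A \<Longrightarrow> \<psi> (\<phi> x) = x" "\<And>y. y \<in> pts B \<Longrightarrow> \<phi> (\<psi> y) = y"
    by (rule isomorphicE) blast
  note in_pts = morphism_in_pts[OF 1(1)] morphism_in_pts[OF 1(2)]
  define pre where "pre U = {y\<in>pts B. \<psi> y \<in> U}" for U
  have pre: "openin (zar B) (pre U)" if "openin (zar A) U" for U
    unfolding pre_def using morphism_open[OF 1(2) that] .
  have pull: "(\<lambda>x. f (\<psi> x)) \<in> reg B (pre U)" if "openin (zar A) U" "f \<in> reg A U" for f U
    unfolding pre_def using morphism_reg[OF 1(2) that] .
  have eq: "{x\<in>pts A. \<phi> x \<in> pre U} = U" if "openin (zar A) U" for U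
    using openin_subset[OF that] in_pts 1 by (auto simp: pre_def)
  have push: "f \<in> reg A U" if U: "openin (zar A) U" and g: "g \<in> reg B (pre U)"
    and "\<And>x. x \<in> U \<Longrightarrow> f x = g (\<phi> x)" for f g U
  proof (rule reg_restrict[OF sheaf U U order_refl])
    show "(\<lambda>x. g (\<phi> x)) \<in> reg A U"
      using morphism_reg[OF 1(1) pre[OF U] g] eq[OF U] by simp
  qed (use that in simp)
  have \<psi>\<phi>: "x \<in> U \<Longrightarrow> \<psi> (\<phi> x) = x" if "openin (zar A) U" for U x
    using openin_subset[OF that] 1(3) by auto
  show ?thesis
    unfolding space_with_functions_def
  proof (intro conjI allI impI ballI sheaf)
    fix U assume U: "openin (zar A) U"
    show "(\<lambda>_. to_ac c) \<in> reg A U" for c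
      by (rule push[OF U swf_const[OF B pre[OF U]]]) simp
    show "(\<lambda>x. f x + g x) \<in> reg A U" "(\<lambda>x. f x * g x) \<in> reg A U"
      if "f \<in> reg A U" "g \<in> reg A U" for f g
      using push[OF U swf_add[OF B pre[OF U] pull[OF U that(1)] pull[OF U that(2)]], of "\<lambda>x. f x + g x"]
        push[OF U swf_mult[OF B pre[OF U] pull[OF U that(1)] pull[OF U that(2)]], of "\<lambda>x. f x * g x"]
      by (simp_all add: \<psi>\<phi>[OF U])
    fix f assume f: "f \<in> reg A U"
    have o: "openin (zar B) {y\<in>pre U. f (\<psi> y) \<noteq> 0}"
      using swf_open[OF B pre[OF U] pull[OF U f]] .
    have "{x\<in>pts A. \<phi> x \<in> {y\<in>pre U. f (\<psi> y) \<noteq> 0}} = {x\<in>U. f x \<noteq> 0}"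
      using eq[OF U] \<psi>\<phi>[OF U] 1(3) by auto
    with morphism_open[OF 1(1) o] show o': "openin (zar A) {x\<in>U. f x \<noteq> 0}"
      by simp
    have "pre {x\<in>U. f x \<noteq> 0} = {y\<in>pre U. f (\<psi> y) \<noteq> 0}"
      by (auto simp: pre_def)
    with swf_inverse[OF B pre[OF U] pull[OF U f]]
    show "(\<lambda>x. inverse (f x)) \<in> reg A {x\<in>U. f x \<noteq> 0}"
      by (intro push[OF o', where g = "\<lambda>y. inverse (f (\<psi> y))"]) (auto simp: \<psi>\<phi>[OF U])
  qed
qed

lemma space_with_functions_local:
  assumes sheaf: "sheaf_condition A"
    and loc: "\<And>x. x \<in> pts A \<Longrightarrow> \<exists>U. openin (zar A) U \<and> x \<in> U \<and> space_with_functions (induced A U)"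
  shows "space_with_functions A"
proof -
  have cov: "\<exists>N. openin (zar A) N \<and> x \<in> N \<and> N \<subseteq> U \<and> space_with_functions (induced A N)"
    if U: "openin (zar A) U" and x: "x \<in> U" for U x
  proof -
    obtain N where N: "openin (zar A) N" "x \<in> N" "space_with_functions (induced A N)"
      using loc[of x] openin_subset[OF U] x by auto
    have s: "sheaf_condition (induced A (N \<inter> U))"
      by (rule sheaf_induced[OF sheaf])
    have "isomorphic (induced A (N \<inter> U)) (induced (induced A N) (N \<inter> U))"
      by (intro isomorphic_sym[OF isomorphic_induced_induced[OF sheaf]]) auto
    from space_with_functions_isomorphic[OF s this space_with_functions_induced[OF N(3)]]
    show ?thesis
      using N U x by (intro exI[of _ "N \<inter> U"]) auto
  qed
  have ind: "f \<in> reg (induced A N) V \<longleftrightarrow> f \<in> reg A V" if "openin (zar A) V" for f N V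
    using that by (simp add: sheafD[OF sheaf])
  have indo: "openin (zar (induced A N)) V \<longleftrightarrow> openin (zar A) V \<and> V \<subseteq> N" if "openin (zar A) N" for N V
    using that by (auto simp: openin_induced)
  have reg_at: "f \<in> reg A U"
    if U: "openin (zar A) U"
      and *: "\<And>N. openin (zar A) N \<Longrightarrow> N \<subseteq> U \<Longrightarrow> space_with_functions (induced A N) \<Longrightarrow> f \<in> reg A N"
    for f U
  proof (rule reg_localI[OF sheaf U])
    fix x assume "x \<in> U"
    from cov[OF U this] * show "\<exists>N g. openin (zar A) N \<and> x \<in> N \<and> g \<in> reg A N \<and> (\<forall>y\<in>N \<inter> U. f y = g y)"
      by blast
  qed
  have res: "f \<in> reg A N" if "f \<in> reg A U" "openin (zar A) U" "openin (zar A) N" "N \<subseteq> U" for f U N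
    using reg_restrict[OF sheaf that(2,3,4,1)] by simp
  show ?thesis
    unfolding space_with_functions_def
  proof (intro conjI allI impI ballI sheaf)
    fix U assume U: "openin (zar A) U"
    show "(\<lambda>_. to_ac c) \<in> reg A U" for c
      by (rule reg_at[OF U]) (metis ind indo order_refl swf_const)
    show "(\<lambda>x. f x + g x) \<in> reg A U" "(\<lambda>x. f x * g x) \<in> reg A U"
      if fg: "f \<in> reg A U" "g \<in> reg A U" for f g
    proof -
      have "(\<lambda>x. f x + g x) \<in> reg A N \<and> (\<lambda>x. f x * g x) \<in> reg A N"
        if N: "openin (zar A) N" "N \<subseteq> U" "space_with_functions (induced A N)" for N
      proof -
        have "f \<in> reg (induced A N) N" "g \<in> reg (induced A N) N" "openin (zar (induced A N)) N"
          using res[OF fg(1) U N(1,2)] res[OF fg(2) U N(1,2)] N ind indo by auto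
        then show ?thesis
          using swf_add[OF N(3)] swf_mult[OF N(3)] ind[OF N(1)] by blast
      qed
      then show "(\<lambda>x. f x + g x) \<in> reg A U" "(\<lambda>x. f x * g x) \<in> reg A U"
        using reg_at[OF U] by blast+
    qed
    fix f assume f: "f \<in> reg A U"
    have N: "openin (zar A) {x\<in>N. f x \<noteq> 0} \<and> (\<lambda>x. inverse (f x)) \<in> reg A {x\<in>N. f x \<noteq> 0}"
      if N: "openin (zar A) N" "N \<subseteq> U" "space_with_functions (induced A N)" for N
    proof -
      have "f \<in> reg (induced A N) N" "openin (zar (induced A N)) N"
        using res[OF f U N(1,2)] N ind indo by auto
      from swf_open[OF N(3) this(2,1)] swf_inverse[OF N(3) this(2,1)]
      show ?thesis
        using indo[OF N(1)] ind by blast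
    qed
    show o: "openin (zar A) {x\<in>U. f x \<noteq> 0}"
    proof (subst openin_subopen, intro ballI)
      fix x assume x: "x \<in> {x\<in>U. f x \<noteq> 0}"
      then obtain M where M: "openin (zar A) M" "x \<in> M" "M \<subseteq> U" "space_with_functions (induced A M)"
        using cov[OF U] by blast
      then show "\<exists>T. openin (zar A) T \<and> x \<in> T \<and> T \<subseteq> {x\<in>U. f x \<noteq> 0}"
        using N[OF M(1,3,4)] x by (intro exI[of _ "{x\<in>M. f x \<noteq> 0}"]) auto
    qed
    show "(\<lambda>x. inverse (f x)) \<in> reg A {x\<in>U. f x \<noteq> 0}"
    proof (rule reg_at[OF o])
      fix M assume M: "openin (zar A) M" "M \<subseteq> {x\<in>U. f x \<noteq> 0}" "space_with_functions (induced A M)"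
      then have "{x\<in>M. f x \<noteq> 0} = M" by auto
      then show "(\<lambda>x. inverse (f x)) \<in> reg A M"
        using N[of M] M by auto
    qed
  qed
qed

section \<open>Affine and projective spaces\<close>

lemma openin_topology_generated_by_basis:
  assumes Int: "\<And>A B. A \<in> S \<Longrightarrow> B \<in> S \<Longrightarrow> A \<inter> B \<in> S"
  shows "openin (topology_generated_by S) U \<longleftrightarrow> (\<forall>x\<in>U. \<exists>B\<in>S. x \<in> B \<and> B \<subseteq> U)" (is "?l \<longleftrightarrow> ?r")
proof
  assume ?l
  then have "generate_topology_on S U"
    by (simp add: openin_topology_generated_by_iff)
  then show ?r
  proof (induction rule: generate_topology_on.induct)
    case (Int a b)
    show ?case
    proof
      fix x assume x: "x \<in> a \<inter> b"
      with Int obtain A B where "A \<in> S" "x \<in> A" "A \<subseteq> a" "B \<in> S" "x \<in> B" "B \<subseteq> b"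
        by blast
      then show "\<exists>B\<in>S. x \<in> B \<and> B \<subseteq> a \<inter> b"
        using assms[of A B] by (intro bexI[of _ "A \<inter> B"]) auto
    qed
  next
    case (UN K)
    then show ?case by (meson UnionE Union_upper order_trans)
  qed auto
next
  assume r: ?r
  have "openin (topology_generated_by S) B" if "B \<in> S" for B
    by (rule topology_generated_by_Basis[OF that])
  with r show ?l
    by (subst openin_subopen) blast
qed

text \<open>
  Affine space with coordinates indexed by an arbitrary set: coordinates that are indexed by the edges
  of a matroid can then be added and removed without renumbering.
\<close>

definition aff :: "'i set \<Rightarrow> ('i \<Rightarrow> 'k::field alg_closure, 'k alg_closure) fspace" where
  "aff J =
     (let T = topology_generated_by
        {{v \<in> coord_space J. mpoly_at p v \<noteq> 0} | p :: ('i, 'k) mpoly. True}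
      in \<lparr>zar = T,
          reg = (\<lambda>U. {f. \<forall>x\<in>U. \<exists>N (p :: ('i, 'k) mpoly) q. openin T N \<and> x \<in> N \<and>
            (\<forall>v\<in>N \<inter> U. mpoly_at q v \<noteq> 0 \<and> f v = mpoly_at p v / mpoly_at q v)})\<rparr>)"

lemma affine_space_eq_aff: "(affine_space n :: (_, 'k::field alg_closure) fspace) = aff {..<n}"
proof -
  have "affine_points n = (coord_space {..<n} :: (nat \<Rightarrow> 'k alg_closure) set)"
    by (auto simp: affine_points_def coord_space_def)
  then show ?thesis
    by (simp add: affine_space_def aff_def)
qed

lemma openin_aff:
  fixes U :: "('i \<Rightarrow> 'k::field alg_closure) set"
  shows "openin (zar (aff J)) U \<longleftrightarrow>
     (\<forall>x\<in>U. \<exists>p\<in>polyfuns. x \<in> coord_space J \<and> p x \<noteq> 0 \<and> {v\<in>coord_space J. p v \<noteq> 0} \<subseteq> U)"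
proof -
  let ?S = "{{v \<in> coord_space J. mpoly_at p v \<noteq> 0} | p :: ('i, 'k) mpoly. True}"
  have zar: "zar (aff J) = topology_generated_by ?S"
    by (simp add: aff_def Let_def)
  have "A \<inter> B \<in> ?S" if "A \<in> ?S" "B \<in> ?S" for A B
  proof -
    from that obtain p q where "A = {v \<in> coord_space J. mpoly_at p v \<noteq> 0}"
      "B = {v \<in> coord_space J. mpoly_at q v \<noteq> 0}" by blast
    then have "A \<inter> B = {v \<in> coord_space J. mpoly_at (p * q) v \<noteq> 0}" by auto
    then show ?thesis by blast
  qed
  from openin_topology_generated_by_basis[of ?S, OF this]
  have "openin (zar (aff J)) U \<longleftrightarrow> (\<forall>x\<in>U. \<exists>B\<in>?S. x \<in> B \<and> B \<subseteq> U)"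
    unfolding zar .
  also have "\<dots> \<longleftrightarrow>
     (\<forall>x\<in>U. \<exists>p\<in>polyfuns. x \<in> coord_space J \<and> p x \<noteq> 0 \<and> {v\<in>coord_space J. p v \<noteq> 0} \<subseteq> U)"
    by (intro ball_cong refl) (auto simp: polyfuns_def)
  finally show ?thesis .
qed

lemma pts_aff [simp]: "pts (aff J) = coord_space J"
proof
  show "coord_space J \<subseteq> pts (aff J)"
  proof -
    have "openin (zar (aff J)) (coord_space J)"
      unfolding openin_aff using polyfuns_1 by (intro ballI bexI[of _ "\<lambda>_. 1"]) auto
    then show ?thesis by (rule openin_subset)
  qed
  show "pts (aff J) \<subseteq> coord_space J"
    using openin_topspace[of "zar (aff J)"] unfolding openin_aff by blast
qed

lemma openin_aff_nonzero: "p \<in> polyfuns \<Longrightarrow> openin (zar (aff J)) {v\<in>coord_space J. p v \<noteq> 0}"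
  unfolding openin_aff by auto

lemma closedin_aff_zero: 
  assumes "P \<subseteq> polyfuns"
  shows "closedin (zar (aff J)) {v\<in>coord_space J. \<forall>p\<in>P. p v = 0}"
proof -
  have "coord_space J - {v\<in>coord_space J. \<forall>p\<in>P. p v = 0} = (\<Union>p\<in>P. {v\<in>coord_space J. p v \<noteq> 0})"
    by auto
  moreover have "openin (zar (aff J)) (\<Union>p\<in>P. {v\<in>coord_space J. p v \<noteq> 0})"
    using assms by (intro openin_Union) (auto intro: openin_aff_nonzero)
  ultimately show ?thesis
    by (auto simp: closedin_def)
qed

definition aff_fractions :: "('i \<Rightarrow> 'k::field alg_closure) set \<Rightarrow> (('i \<Rightarrow> 'k alg_closure) \<Rightarrow> 'k alg_closure) set" where
  "aff_fractions N = {f. \<exists>p\<in>polyfuns. \<exists>q\<in>polyfuns. \<forall>v\<in>N. q v \<noteq> 0 \<and> f v = p v / q v}"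

lemma aff_fractionsI:
  assumes "p \<in> polyfuns" "q \<in> polyfuns" "\<And>v. v \<in> N \<Longrightarrow> q v \<noteq> 0" "\<And>v. v \<in> N \<Longrightarrow> f v = p v / q v"
  shows "f \<in> aff_fractions N"
  unfolding aff_fractions_def using assms by (intro CollectI bexI[of _ p] bexI[of _ q]) auto

lemma aff_fractionsE:
  assumes "f \<in> aff_fractions N"
  obtains p q where "p \<in> polyfuns" "q \<in> polyfuns" "\<And>v. v \<in> N \<Longrightarrow> q v \<noteq> 0" "\<And>v. v \<in> N \<Longrightarrow> f v = p v / q v"
  using assms unfolding aff_fractions_def mem_Collect_eq by (elim bexE) metis

lemma polyfun_in_aff_fractions: "p \<in> polyfuns \<Longrightarrow> (\<And>v. v \<in> N \<Longrightarrow> f v = p v) \<Longrightarrow> f \<in> aff_fractions N"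
  by (rule aff_fractionsI[OF _ polyfuns_1]) auto

lemma aff_fractions_mono:
  assumes "f \<in> aff_fractions N" "M \<subseteq> N" "\<And>x. x \<in> M \<Longrightarrow> f x = g x"
  shows "g \<in> aff_fractions M"
  using assms(1) by (rule aff_fractionsE) (rule aff_fractionsI; use assms(2,3) in force)

lemma reg_aff:
  assumes U: "openin (zar (aff J)) U"
  shows "f \<in> reg (aff J) U \<longleftrightarrow>
     (\<forall>x\<in>U. \<exists>N. openin (zar (aff J)) N \<and> x \<in> N \<and> N \<subseteq> U \<and> f \<in> aff_fractions N)" (is "?l \<longleftrightarrow> ?r")
proof -
  have "?l \<longleftrightarrow> (\<forall>x\<in>U. \<exists>N. openin (zar (aff J)) N \<and> x \<in> N \<and> f \<in> aff_fractions (N \<inter> U))"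
    by (simp add: aff_def Let_def aff_fractions_def polyfuns_def)
  also have "\<dots> \<longleftrightarrow> ?r"
  proof (intro ball_cong refl iffI)
    fix x assume x: "x \<in> U"
    show "\<exists>N. openin (zar (aff J)) N \<and> x \<in> N \<and> N \<subseteq> U \<and> f \<in> aff_fractions N"
      if "\<exists>N. openin (zar (aff J)) N \<and> x \<in> N \<and> f \<in> aff_fractions (N \<inter> U)"
      using that U x by blast
    show "\<exists>N. openin (zar (aff J)) N \<and> x \<in> N \<and> f \<in> aff_fractions (N \<inter> U)"
      if "\<exists>N. openin (zar (aff J)) N \<and> x \<in> N \<and> N \<subseteq> U \<and> f \<in> aff_fractions N"
      using that by (metis inf.absorb_iff1)
  qed
  finally show ?thesis .
qed

lemma space_with_functions_aff: "space_with_functions (aff J)"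
proof (rule space_with_functionsI[OF reg_aff])
  show "g \<in> aff_fractions M" if "f \<in> aff_fractions N" "M \<subseteq> N" "\<And>x. x \<in> M \<Longrightarrow> f x = g x" for f g M N
    using that by (rule aff_fractions_mono)
  show "(\<lambda>_. to_ac c) \<in> aff_fractions N" for N c
    by (rule polyfun_in_aff_fractions[OF polyfuns_const]) simp
  fix N f assume N: "openin (zar (aff J)) N" and "f \<in> aff_fractions N"
  from this(2) obtain p q where pq: "p \<in> polyfuns" "q \<in> polyfuns"
    "\<And>v. v \<in> N \<Longrightarrow> q v \<noteq> 0" "\<And>v. v \<in> N \<Longrightarrow> f v = p v / q v"
    by (rule aff_fractionsE) blast
  show "(\<lambda>x. f x + g x) \<in> aff_fractions N" "(\<lambda>x. f x * g x) \<in> aff_fractions N"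
    if g: "g \<in> aff_fractions N" for g
  proof -
    from g obtain p' q' where pq': "p' \<in> polyfuns" "q' \<in> polyfuns"
      "\<And>v. v \<in> N \<Longrightarrow> q' v \<noteq> 0" "\<And>v. v \<in> N \<Longrightarrow> g v = p' v / q' v"
      by (rule aff_fractionsE) blast
    show "(\<lambda>x. f x + g x) \<in> aff_fractions N"
      by (rule aff_fractionsI[of "\<lambda>v. p v * q' v + p' v * q v" "\<lambda>v. q v * q' v"])
        (use pq pq' in \<open>simp_all add: polyfuns_intros add_frac_eq\<close>)
    show "(\<lambda>x. f x * g x) \<in> aff_fractions N"
      by (rule aff_fractionsI[of "\<lambda>v. p v * p' v" "\<lambda>v. q v * q' v"])
        (use pq pq' in \<open>simp_all add: polyfuns_intros\<close>)
  qed
  show "openin (zar (aff J)) {x\<in>N. f x \<noteq> 0} \<and> (\<lambda>x. inverse (f x)) \<in> aff_fractions {x\<in>N. f x \<noteq> 0}"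
  proof
    have "{x\<in>N. f x \<noteq> 0} = N \<inter> {v\<in>coord_space J. p v \<noteq> 0}"
      using pq(3,4) openin_subset[OF N] by auto
    then show "openin (zar (aff J)) {x\<in>N. f x \<noteq> 0}"
      using N openin_aff_nonzero[OF pq(1)] by auto
    show "(\<lambda>x. inverse (f x)) \<in> aff_fractions {x\<in>N. f x \<noteq> 0}"
      by (rule aff_fractionsI[OF pq(2,1)]) (use pq(3,4) in auto)
  qed
qed

lemma polyfun_reg_aff:
  assumes "openin (zar (aff J)) U" "p \<in> polyfuns"
  shows "p \<in> reg (aff J) U"
  unfolding reg_aff[OF assms(1)] using assms polyfun_in_aff_fractions by blast

lemma polyfun_reg_induced_aff:
  assumes "p \<in> polyfuns" "openin (zar (induced (aff J) S)) U"
  shows "p \<in> reg (induced (aff J) S) U"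
  using assms polyfun_reg_aff reg_induced_of_reg unfolding openin_induced by metis

text \<open>
  Polynomials in regular functions are regular, their non-vanishing loci are open, and their quotients are
  regular there.  So a map with regular coordinates pulls back basic open sets and fractions.
\<close>

lemma morphism_affI:
  assumes A: "space_with_functions A"
    and \<phi>: "\<And>x. x \<in> pts A \<Longrightarrow> \<phi> x \<in> coord_space J \<inter> S"
    and coord: "\<And>j. j \<in> J \<Longrightarrow> (\<lambda>x. \<phi> x j) \<in> reg A (pts A)"
  shows "morphism A (induced (aff J) S) \<phi>"
proof -
  note sheaf = swf_sheaf[OF A]
  have coord': "(\<lambda>x. \<phi> x j) \<in> reg A (pts A)" for j
  proof (cases "j \<in> J")
    case False
    have "(\<lambda>x. 0) \<in> reg A (pts A)"
      using swf_const[OF A openin_topspace, of 0] by simp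
    then show ?thesis
      by (rule reg_restrict[OF sheaf openin_topspace openin_topspace order_refl])
        (use \<phi> False in \<open>auto simp: coord_space_def\<close>)
  qed (rule coord)
  have poly: "(\<lambda>x. p (\<phi> x)) \<in> reg A (pts A)" if "p \<in> polyfuns" for p
    by (rule swf_polyfun[OF A openin_topspace that coord'])
  have cont: "openin (zar A) {x\<in>pts A. \<phi> x \<in> V}" if V: "openin (zar (aff J)) V" for V
  proof (subst openin_subopen, intro ballI)
    fix x assume x: "x \<in> {x\<in>pts A. \<phi> x \<in> V}"
    with V obtain p where p: "p \<in> polyfuns" "p (\<phi> x) \<noteq> 0" "{v\<in>coord_space J. p v \<noteq> 0} \<subseteq> V"
      unfolding openin_aff by blast
    show "\<exists>T. openin (zar A) T \<and> x \<in> T \<and> T \<subseteq> {x\<in>pts A. \<phi> x \<in> V}"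
      using swf_open[OF A openin_topspace poly[OF p(1)]] x p \<phi>
      by (intro exI[of _ "{x\<in>pts A. p (\<phi> x) \<noteq> 0}"]) auto
  qed
  have "morphism A (aff J) \<phi>"
  proof (rule morphism_fractionsI[OF sheaf reg_aff _ cont])
    fix N h x assume N: "openin (zar (aff J)) N" and "h \<in> aff_fractions N" and x: "x \<in> pts A" "\<phi> x \<in> N"
    from this(2) obtain p q where pq: "p \<in> polyfuns" "q \<in> polyfuns"
      "\<And>v. v \<in> N \<Longrightarrow> q v \<noteq> 0" "\<And>v. v \<in> N \<Longrightarrow> h v = p v / q v"
      by (rule aff_fractionsE) blast
    let ?M = "{x\<in>pts A. \<phi> x \<in> N}"
    have res: "(\<lambda>x. p (\<phi> x)) \<in> reg A ?M" if "p \<in> polyfuns" for p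
      by (rule reg_restrict[OF sheaf openin_topspace cont[OF N] _ poly[OF that]]) auto
    have "(\<lambda>x. p (\<phi> x) / q (\<phi> x)) \<in> reg A ?M"
      by (rule swf_divide[OF A cont[OF N] res res]) (use pq in auto)
    then show "\<exists>M g. openin (zar A) M \<and> x \<in> M \<and> g \<in> reg A M \<and> (\<forall>y\<in>M. h (\<phi> y) = g y)"
      using cont[OF N] pq(4) x by (intro exI[of _ ?M] exI[of _ "\<lambda>x. p (\<phi> x) / q (\<phi> x)"]) auto
  qed (use \<phi> in auto)
  then show ?thesis
    by (rule morphism_into_induced[OF sheaf]) (use \<phi> in blast)
qed

lemma morphism_aff_coord:
  assumes "morphism A (induced (aff J) S) \<phi>" "p \<in> polyfuns"
  shows "(\<lambda>x. p (\<phi> x)) \<in> reg A (pts A)"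
proof -
  have "{x\<in>pts A. \<phi> x \<in> pts (induced (aff J) S)} = pts A"
    using morphism_in_pts[OF assms(1)] by auto
  then show ?thesis
    using morphism_reg[OF assms(1) openin_topspace polyfun_reg_induced_aff[OF assms(2) openin_topspace]]
    by simp
qed

text \<open>The form in which morphisms between subsets of affine spaces are checked below.\<close>

lemma morphism_aff_affI:
  assumes \<phi>: "\<And>v. v \<in> coord_space I \<Longrightarrow> v \<in> R \<Longrightarrow> \<phi> v \<in> coord_space J \<inter> S"
    and coord: "\<And>j. j \<in> J \<Longrightarrow> (\<lambda>v. \<phi> v j) \<in> aff_fractions (coord_space I \<inter> R)"
  shows "morphism (induced (aff I) R) (induced (aff J) S) \<phi>"
proof (rule morphism_affI)
  let ?A = "induced (aff I) R"
  show A: "space_with_functions ?A"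
    by (intro space_with_functions_induced space_with_functions_aff)
  show "\<phi> x \<in> coord_space J \<inter> S" if "x \<in> pts ?A" for x
    using \<phi> that by auto
  fix j assume "j \<in> J"
  from coord[OF this] obtain p q where pq: "p \<in> polyfuns" "q \<in> polyfuns"
    "\<And>v. v \<in> coord_space I \<inter> R \<Longrightarrow> q v \<noteq> 0" "\<And>v. v \<in> coord_space I \<inter> R \<Longrightarrow> \<phi> v j = p v / q v"
    by (rule aff_fractionsE) blast
  have "(\<lambda>v. p v / q v) \<in> reg ?A (pts ?A)"
    by (rule swf_divide[OF A openin_topspace]) (use pq polyfun_reg_induced_aff[OF _ openin_topspace] in auto)
  then show "(\<lambda>v. \<phi> v j) \<in> reg ?A (pts ?A)"
    by (rule reg_restrict[OF swf_sheaf[OF A] openin_topspace openin_topspace order_refl]) (use pq in simp)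
qed

subsection \<open>Projective space\<close>

lemma line_eq:
  assumes "L \<in> lines E" "v \<in> L" "v \<noteq> 0"
  shows "L = range (\<lambda>c i. c * v i)" "v \<in> coord_space E"
proof -
  from assms(1) obtain w where w: "w \<in> coord_space E" "w \<noteq> 0" "L = range (\<lambda>c i. c * w i)"
    by (auto simp: lines_def fun_vs.span_singleton)
  with assms obtain c where c: "v = (\<lambda>i. c * w i)"
    by auto
  with assms(3) have "c \<noteq> 0"
    by (auto simp: fun_eq_iff)
  show "L = range (\<lambda>c i. c * v i)"
    unfolding w(3)
  proof (intro equalityI subsetI)
    show "x \<in> range (\<lambda>c i. c * w i)" if "x \<in> range (\<lambda>c i. c * v i)" for x
      using that c by (auto simp: mult.assoc[symmetric])
    show "x \<in> range (\<lambda>c i. c * v i)" if "x \<in> range (\<lambda>c i. c * w i)" for x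
    proof -
      from that obtain d where "x = (\<lambda>i. d * w i)" by auto
      with \<open>c \<noteq> 0\<close> c have "x = (\<lambda>i. (d / c) * v i)" by auto
      then show ?thesis by blast
    qed
  qed
  show "v \<in> coord_space E"
    using w c by (auto simp: coord_space_def)
qed

lemma lines_nonzero: "L \<in> lines E \<Longrightarrow> \<exists>v\<in>L. v \<noteq> 0"
  unfolding lines_def using fun_vs.span_base by blast

lemma span_in_lines: "v \<in> coord_space E \<Longrightarrow> v \<noteq> 0 \<Longrightarrow> fun_vs.span {v} \<in> lines E"
  by (auto simp: lines_def)

lemma line_eq_span: "L \<in> lines E \<Longrightarrow> v \<in> L \<Longrightarrow> v \<noteq> 0 \<Longrightarrow> L = fun_vs.span {v}"
  using line_eq(1) by (simp add: fun_vs.span_singleton)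

lemma vanishes_on_iff:
  assumes p: "homogeneous d p" and L: "L \<in> lines E" and v: "v \<in> L" "v \<noteq> 0"
  shows "vanishes_on p L \<longleftrightarrow> mpoly_at p v = 0"
proof
  assume "mpoly_at p v = 0"
  then have "mpoly_at p (\<lambda>i. c * v i) = 0" for c
    by (simp add: homogeneous_scale[OF p])
  then show "vanishes_on p L"
    unfolding vanishes_on_def line_eq(1)[OF L v] by blast
qed (use v in \<open>auto simp: vanishes_on_def\<close>)

lemma openin_proj:
  fixes U :: "('e \<Rightarrow> 'k::field alg_closure) set set"
  shows "openin (zar (proj_space E)) U \<longleftrightarrow> (\<forall>x\<in>U. \<exists>(p :: ('e, 'k) mpoly) d. homogeneous d p \<and>
     x \<in> lines E \<and> \<not> vanishes_on p x \<and> {L\<in>lines E. \<not> vanishes_on p L} \<subseteq> U)"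
proof -
  let ?S = "{{L \<in> lines E. \<not> vanishes_on p L} | p :: ('e, 'k) mpoly. \<exists>d. homogeneous d p}"
  have zar: "zar (proj_space E) = topology_generated_by ?S"
    by (simp add: proj_space_def Let_def)
  have "A \<inter> B \<in> ?S" if "A \<in> ?S" "B \<in> ?S" for A B
  proof -
    from that obtain p q d d' where pq: "A = {L \<in> lines E. \<not> vanishes_on p L}" "homogeneous d p"
      "B = {L \<in> lines E. \<not> vanishes_on q L}" "homogeneous d' q" by blast
    have hom: "homogeneous (d + d') (p * q)"
      by (rule homogeneous_mult[OF pq(2,4)])
    have "vanishes_on (p * q) L \<longleftrightarrow> vanishes_on p L \<or> vanishes_on q L" if L: "L \<in> lines E" for L
    proof -
      from lines_nonzero[OF L] obtain v where v: "v \<in> L" "v \<noteq> 0" by blast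
      show ?thesis
        using vanishes_on_iff[OF _ L v] pq(2,4) hom by simp
    qed
    with pq have "A \<inter> B = {L \<in> lines E. \<not> vanishes_on (p * q) L}" by auto
    with hom show ?thesis by blast
  qed
  from openin_topology_generated_by_basis[of ?S, OF this]
  have "openin (zar (proj_space E)) U \<longleftrightarrow> (\<forall>x\<in>U. \<exists>B\<in>?S. x \<in> B \<and> B \<subseteq> U)"
    unfolding zar .
  also have "\<dots> \<longleftrightarrow> (\<forall>x\<in>U. \<exists>(p :: ('e, 'k) mpoly) d. homogeneous d p \<and>
     x \<in> lines E \<and> \<not> vanishes_on p x \<and> {L\<in>lines E. \<not> vanishes_on p L} \<subseteq> U)"
    by (intro ball_cong refl) auto
  finally show ?thesis .
qed

lemma pts_proj [simp]: "pts (proj_space E) = lines E"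
proof
  show "lines E \<subseteq> pts (proj_space E)"
  proof -
    have "\<not> vanishes_on 1 L" if "L \<in> lines E" for L
      using lines_nonzero[OF that] by (auto simp: vanishes_on_def)
    then have "openin (zar (proj_space E)) (lines E)"
      unfolding openin_proj using homogeneous_1 by blast
    then show ?thesis by (rule openin_subset)
  qed
  show "pts (proj_space E) \<subseteq> lines E"
    using openin_topspace[of "zar (proj_space E)"] unfolding openin_proj by blast
qed

lemma openin_proj_nonzero:
  "homogeneous d p \<Longrightarrow> openin (zar (proj_space E)) {L\<in>lines E. \<not> vanishes_on p L}"
  unfolding openin_proj by auto

definition proj_fractions :: "('e \<Rightarrow> 'k::field alg_closure) set set \<Rightarrow> (('e \<Rightarrow> 'k alg_closure) set \<Rightarrow> 'k alg_closure) set" where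
  "proj_fractions N = {f. \<exists>(p :: ('e, 'k) mpoly) q d. homogeneous d p \<and> homogeneous d q \<and>
     (\<forall>L\<in>N. \<forall>v\<in>L - {0}. mpoly_at q v \<noteq> 0 \<and> f L = mpoly_at p v / mpoly_at q v)}"

lemma proj_fractionsI:
  assumes "homogeneous d p" "homogeneous d q"
    "\<And>L v. L \<in> N \<Longrightarrow> v \<in> L \<Longrightarrow> v \<noteq> 0 \<Longrightarrow> mpoly_at q v \<noteq> 0"
    "\<And>L v. L \<in> N \<Longrightarrow> v \<in> L \<Longrightarrow> v \<noteq> 0 \<Longrightarrow> f L = mpoly_at p v / mpoly_at q v"
  shows "f \<in> proj_fractions N"
  unfolding proj_fractions_def
proof -
  have "\<forall>L\<in>N. \<forall>v\<in>L - {0}. mpoly_at q v \<noteq> 0 \<and> f L = mpoly_at p v / mpoly_at q v"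
  proof (intro ballI)
    fix L v assume "L \<in> N" "v \<in> L - {0}"
    then show "mpoly_at q v \<noteq> 0 \<and> f L = mpoly_at p v / mpoly_at q v"
      using assms(3,4)[of L v] by simp
  qed
  with assms(1,2) show "f \<in> {f. \<exists>p q d. homogeneous d p \<and> homogeneous d q \<and>
     (\<forall>L\<in>N. \<forall>v\<in>L - {0}. mpoly_at q v \<noteq> 0 \<and> f L = mpoly_at p v / mpoly_at q v)}"
    by (intro CollectI exI[of _ p] exI[of _ q] exI[of _ d] conjI)
qed

lemma proj_fractionsE:
  assumes "f \<in> proj_fractions N"
  obtains p q d where "homogeneous d p" "homogeneous d q"
    "\<And>L v. L \<in> N \<Longrightarrow> v \<in> L \<Longrightarrow> v \<noteq> 0 \<Longrightarrow> mpoly_at q v \<noteq> 0"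
    "\<And>L v. L \<in> N \<Longrightarrow> v \<in> L \<Longrightarrow> v \<noteq> 0 \<Longrightarrow> f L = mpoly_at p v / mpoly_at q v"
  using assms unfolding proj_fractions_def mem_Collect_eq
  by (elim exE conjE) (metis DiffI singletonD)

lemma proj_fractions_mono:
  assumes "f \<in> proj_fractions N" "M \<subseteq> N" "\<And>x. x \<in> M \<Longrightarrow> f x = g x"
  shows "g \<in> proj_fractions M"
proof -
  from assms(1) obtain p q d where pq: "homogeneous d p" "homogeneous d q"
    "\<And>L v. L \<in> N \<Longrightarrow> v \<in> L \<Longrightarrow> v \<noteq> 0 \<Longrightarrow> mpoly_at q v \<noteq> 0"
    "\<And>L v. L \<in> N \<Longrightarrow> v \<in> L \<Longrightarrow> v \<noteq> 0 \<Longrightarrow> f L = mpoly_at p v / mpoly_at q v"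
    by (rule proj_fractionsE) blast
  show ?thesis
  proof (rule proj_fractionsI[OF pq(1,2)])
    fix L v assume "L \<in> M" "v \<in> L" "v \<noteq> 0"
    with assms(2) show "mpoly_at q v \<noteq> 0" "g L = mpoly_at p v / mpoly_at q v"
      using pq(3,4)[of L v] assms(3)[of L] by auto
  qed
qed

lemma reg_proj:
  assumes U: "openin (zar (proj_space E)) U"
  shows "f \<in> reg (proj_space E) U \<longleftrightarrow>
     (\<forall>x\<in>U. \<exists>N. openin (zar (proj_space E)) N \<and> x \<in> N \<and> N \<subseteq> U \<and> f \<in> proj_fractions N)" (is "?l \<longleftrightarrow> ?r")
proof -
  have "?l \<longleftrightarrow> (\<forall>x\<in>U. \<exists>N. openin (zar (proj_space E)) N \<and> x \<in> N \<and> f \<in> proj_fractions (N \<inter> U))"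
    by (simp add: proj_space_def Let_def proj_fractions_def)
  also have "\<dots> \<longleftrightarrow> ?r"
  proof (intro ball_cong refl iffI)
    fix x assume x: "x \<in> U"
    show "\<exists>N. openin (zar (proj_space E)) N \<and> x \<in> N \<and> N \<subseteq> U \<and> f \<in> proj_fractions N"
      if "\<exists>N. openin (zar (proj_space E)) N \<and> x \<in> N \<and> f \<in> proj_fractions (N \<inter> U)"
      using that U x by blast
    show "\<exists>N. openin (zar (proj_space E)) N \<and> x \<in> N \<and> f \<in> proj_fractions (N \<inter> U)"
      if "\<exists>N. openin (zar (proj_space E)) N \<and> x \<in> N \<and> N \<subseteq> U \<and> f \<in> proj_fractions N"
      using that by (metis inf.absorb_iff1)
  qed
  finally show ?thesis .
qed

lemma space_with_functions_proj: "space_with_functions (proj_space E)"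
proof (rule space_with_functionsI[OF reg_proj])
  show "g \<in> proj_fractions M" if "f \<in> proj_fractions N" "M \<subseteq> N" "\<And>x. x \<in> M \<Longrightarrow> f x = g x" for f g M N
    using that by (rule proj_fractions_mono)
  show "(\<lambda>_. to_ac c) \<in> proj_fractions N" for N c
    by (rule proj_fractionsI[OF homogeneous_const[of c] homogeneous_1]) auto
  fix N f assume N: "openin (zar (proj_space E)) N" and "f \<in> proj_fractions N"
  from this(2) obtain p q d where pq: "homogeneous d p" "homogeneous d q"
    "\<And>L v. L \<in> N \<Longrightarrow> v \<in> L \<Longrightarrow> v \<noteq> 0 \<Longrightarrow> mpoly_at q v \<noteq> 0"
    "\<And>L v. L \<in> N \<Longrightarrow> v \<in> L \<Longrightarrow> v \<noteq> 0 \<Longrightarrow> f L = mpoly_at p v / mpoly_at q v"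
    by (rule proj_fractionsE) blast
  show "(\<lambda>x. f x + g x) \<in> proj_fractions N" "(\<lambda>x. f x * g x) \<in> proj_fractions N"
    if g: "g \<in> proj_fractions N" for g
  proof -
    from g obtain p' q' d' where pq': "homogeneous d' p'" "homogeneous d' q'"
      "\<And>L v. L \<in> N \<Longrightarrow> v \<in> L \<Longrightarrow> v \<noteq> 0 \<Longrightarrow> mpoly_at q' v \<noteq> 0"
      "\<And>L v. L \<in> N \<Longrightarrow> v \<in> L \<Longrightarrow> v \<noteq> 0 \<Longrightarrow> g L = mpoly_at p' v / mpoly_at q' v"
      by (rule proj_fractionsE) blast
    have hom: "homogeneous (d + d') (q * q')" "homogeneous (d + d') (p * p')"
      "homogeneous (d + d') (p * q' + p' * q)"
      using homogeneous_mult[OF pq(2) pq'(2)] homogeneous_mult[OF pq(1) pq'(1)]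
        homogeneous_add[OF homogeneous_mult[OF pq(1) pq'(2)]] homogeneous_mult[OF pq'(1) pq(2)]
      by (simp_all add: add.commute)
    show "(\<lambda>x. f x + g x) \<in> proj_fractions N"
    proof (rule proj_fractionsI[OF hom(3,1)])
      fix L v assume v: "L \<in> N" "v \<in> L" "v \<noteq> 0"
      show "mpoly_at (q * q') v \<noteq> 0" "f L + g L = mpoly_at (p * q' + p' * q) v / mpoly_at (q * q') v"
        using pq(3,4)[OF v] pq'(3,4)[OF v] by (simp_all add: add_frac_eq)
    qed
    show "(\<lambda>x. f x * g x) \<in> proj_fractions N"
    proof (rule proj_fractionsI[OF hom(2,1)])
      fix L v assume v: "L \<in> N" "v \<in> L" "v \<noteq> 0"
      show "mpoly_at (q * q') v \<noteq> 0" "f L * g L = mpoly_at (p * p') v / mpoly_at (q * q') v"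
        using pq(3,4)[OF v] pq'(3,4)[OF v] by simp_all
    qed
  qed
  have NL: "N \<subseteq> lines E"
    using openin_subset[OF N] by simp
  have van: "f L \<noteq> 0 \<longleftrightarrow> \<not> vanishes_on p L" if L: "L \<in> N" for L
  proof -
    from lines_nonzero L NL obtain v where v: "v \<in> L" "v \<noteq> 0" by blast
    show ?thesis
      using vanishes_on_iff[OF pq(1) _ v, of E] pq(3,4)[OF L v] L NL by auto
  qed
  show "openin (zar (proj_space E)) {x\<in>N. f x \<noteq> 0} \<and> (\<lambda>x. inverse (f x)) \<in> proj_fractions {x\<in>N. f x \<noteq> 0}"
  proof
    have "{x\<in>N. f x \<noteq> 0} = N \<inter> {L\<in>lines E. \<not> vanishes_on p L}"
      using van NL by auto
    then show "openin (zar (proj_space E)) {x\<in>N. f x \<noteq> 0}"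
      using N openin_proj_nonzero[OF pq(1)] by auto
    show "(\<lambda>x. inverse (f x)) \<in> proj_fractions {x\<in>N. f x \<noteq> 0}"
    proof (rule proj_fractionsI[OF pq(2,1)])
      fix L v assume "L \<in> {x\<in>N. f x \<noteq> 0}" "v \<in> L" "v \<noteq> 0"
      then show "mpoly_at p v \<noteq> 0" "inverse (f L) = mpoly_at q v / mpoly_at p v"
        using pq(3,4)[of L v] by auto
    qed
  qed
qed

text \<open>
  A ratio of homogeneous polynomials of equal degree is evaluated on a line at any of its nonzero vectors;
  fixing one turns such ratios into functions on lines.
\<close>

definition spanning_vector :: "('e \<Rightarrow> 'k::field) set \<Rightarrow> 'e \<Rightarrow> 'k" where
  "spanning_vector L = (SOME v. v \<in> L \<and> v \<noteq> 0)"

lemma spanning_vector: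
  assumes "L \<in> lines E"
  shows "spanning_vector L \<in> L" "spanning_vector L \<noteq> 0" "spanning_vector L \<in> coord_space E"
    "L = fun_vs.span {spanning_vector L}"
proof -
  have "\<exists>v. v \<in> L \<and> v \<noteq> 0"
    using lines_nonzero[OF assms] by blast
  from someI_ex[OF this] have "spanning_vector L \<in> L \<and> spanning_vector L \<noteq> 0"
    unfolding spanning_vector_def .
  then show "spanning_vector L \<in> L" "spanning_vector L \<noteq> 0" "spanning_vector L \<in> coord_space E"
    "L = fun_vs.span {spanning_vector L}"
    using line_eq(2)[OF assms] line_eq_span[OF assms] by blast+
qed

lemma homogeneous_ratio:
  assumes "homogeneous d p" "homogeneous d q" "L \<in> lines E" "v \<in> L" "v \<noteq> 0" "w \<in> L" "w \<noteq> 0"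
  shows "mpoly_at p v / mpoly_at q v = mpoly_at p w / mpoly_at q w"
proof -
  obtain c where c: "v = (\<lambda>i. c * w i)"
    using line_eq(1)[OF assms(3,6,7)] assms(4) by auto
  with assms(5) have "c \<noteq> 0"
    by (auto simp: fun_eq_iff)
  with c assms(1,2) show ?thesis
    by (simp add: homogeneous_scale)
qed

lemma ratio_reg_proj:
  assumes p: "homogeneous d p" and q: "homogeneous d q"
    and U: "openin (zar (induced (proj_space E) S)) U"
    and nz: "\<And>L. L \<in> U \<Longrightarrow> \<not> vanishes_on q L"
  shows "(\<lambda>L. mpoly_at p (spanning_vector L) / mpoly_at q (spanning_vector L)) \<in> reg (induced (proj_space E) S) U"
    (is "?f \<in> _")
proof -
  let ?D = "{L\<in>lines E. \<not> vanishes_on q L}"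
  have D: "openin (zar (proj_space E)) ?D"
    by (rule openin_proj_nonzero[OF q])
  have "?f \<in> proj_fractions ?D"
  proof (rule proj_fractionsI[OF p q])
    fix L v assume "L \<in> ?D" "v \<in> L" "v \<noteq> 0"
    then show "mpoly_at q v \<noteq> 0" "?f L = mpoly_at p v / mpoly_at q v"
      using homogeneous_ratio[OF p q, of L E "spanning_vector L" v] spanning_vector[of L E]
        vanishes_on_iff[OF q, of L E v] by auto
  qed
  then have "?f \<in> reg (proj_space E) ?D"
    unfolding reg_proj[OF D] using D by (intro ballI exI[of _ ?D]) simp
  moreover have "U \<subseteq> ?D"
    using openin_subset[OF U] nz by auto
  ultimately show ?thesis
    unfolding reg_induced locally_regular_def using D by blast
qed

text \<open>
  Expressed in local homogeneous coordinates that are regular functions, a homogeneous fraction becomes a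
  quotient of regular functions.
\<close>

lemma morphism_projI:
  fixes \<phi> :: "'p \<Rightarrow> ('e \<Rightarrow> 'k::field alg_closure) set"
  assumes A: "space_with_functions A"
    and \<phi>: "\<And>x. x \<in> pts A \<Longrightarrow> \<phi> x \<in> Y"
    and loc: "\<And>x. x \<in> pts A \<Longrightarrow> \<exists>N g. openin (zar A) N \<and> x \<in> N \<and> (\<forall>k. g k \<in> reg A N) \<and>
      (\<forall>y\<in>N. (\<lambda>k. g k y) \<in> coord_space E \<and> (\<lambda>k. g k y) \<noteq> 0 \<and> \<phi> y = fun_vs.span {\<lambda>k. g k y})"
  shows "morphism A (induced (proj_space E) Y) \<phi>"
proof -
  note sheaf = swf_sheaf[OF A]
  define coords where "coords g y \<longleftrightarrow> (\<lambda>k. g k y) \<in> coord_space E \<and> (\<lambda>k. g k y) \<noteq> 0 \<and>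
    \<phi> y = fun_vs.span {\<lambda>k. g k y}" for g y
  have loc: "\<exists>N g. openin (zar A) N \<and> x \<in> N \<and> (\<forall>k. g k \<in> reg A N) \<and> (\<forall>y\<in>N. coords g y)"
    if "x \<in> pts A" for x
    using loc[OF that] unfolding coords_def .
  have poly: "(\<lambda>y. mpoly_at p (\<lambda>k. g k y)) \<in> reg A N"
    if "openin (zar A) N" "\<And>k. g k \<in> reg A N" for p :: "('e, 'k) mpoly" and g N
    by (rule swf_polyfun[OF A that(1) _ that(2)]) (auto simp: polyfuns_def)
  have nz: "vanishes_on p (fun_vs.span {v}) \<longleftrightarrow> mpoly_at p v = 0"
    if "homogeneous d p" "v \<in> coord_space E" "v \<noteq> 0" for p :: "('e, 'k) mpoly" and d v
    by (rule vanishes_on_iff[OF that(1) span_in_lines[OF that(2,3)]])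
      (use that fun_vs.span_base in auto)
  have cont: "openin (zar A) {x\<in>pts A. \<phi> x \<in> V}" if V: "openin (zar (proj_space E)) V" for V
  proof (subst openin_subopen, intro ballI)
    fix x assume x: "x \<in> {x\<in>pts A. \<phi> x \<in> V}"
    with V obtain p d where p: "homogeneous d p" "\<not> vanishes_on p (\<phi> x)"
      "{L\<in>lines E. \<not> vanishes_on p L} \<subseteq> V"
      unfolding openin_proj by blast
    from x have "x \<in> pts A" by simp
    from loc[OF this] obtain N g where N: "openin (zar A) N" "x \<in> N" "\<forall>k. g k \<in> reg A N"
      "\<forall>y\<in>N. coords g y"
      by (elim exE conjE)
    note N = N(1,2) N(3)[rule_format] N(4)[rule_format]
    note Nc = N(4)[unfolded coords_def]
    have "openin (zar A) {y\<in>N. mpoly_at p (\<lambda>k. g k y) \<noteq> 0}"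
      by (rule swf_open[OF A N(1) poly[OF N(1,3)]])
    moreover have "y \<in> pts A" "\<phi> y \<in> V" if "y \<in> N" "mpoly_at p (\<lambda>k. g k y) \<noteq> 0" for y
      using that p(3) nz[OF p(1)] Nc[of y] span_in_lines[of "\<lambda>k. g k y" E] openin_subset[OF N(1)]
      by auto
    moreover have "mpoly_at p (\<lambda>k. g k x) \<noteq> 0"
      using p(2) nz[OF p(1)] N(2) Nc[of x] by auto
    ultimately show "\<exists>T. openin (zar A) T \<and> x \<in> T \<and> T \<subseteq> {x\<in>pts A. \<phi> x \<in> V}"
      using N(2) by (intro exI[of _ "{y\<in>N. mpoly_at p (\<lambda>k. g k y) \<noteq> 0}"]) auto
  qed
  have lin: "\<phi> x \<in> lines E" if "x \<in> pts A" for x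
    using loc[OF that] span_in_lines unfolding coords_def by metis
  have "morphism A (proj_space E) \<phi>"
  proof (rule morphism_fractionsI[OF sheaf reg_proj _ cont])
    fix N h x assume N: "openin (zar (proj_space E)) N" and "h \<in> proj_fractions N"
      and x: "x \<in> pts A" "\<phi> x \<in> N"
    from this(2) obtain p q d where pq: "homogeneous d p" "homogeneous d q"
      "\<And>L v. L \<in> N \<Longrightarrow> v \<in> L \<Longrightarrow> v \<noteq> 0 \<Longrightarrow> mpoly_at q v \<noteq> 0"
      "\<And>L v. L \<in> N \<Longrightarrow> v \<in> L \<Longrightarrow> v \<noteq> 0 \<Longrightarrow> h L = mpoly_at p v / mpoly_at q v"
      by (rule proj_fractionsE) blast
    from loc[OF x(1)] obtain M g where M: "openin (zar A) M" "x \<in> M" "\<forall>k. g k \<in> reg A M"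
      "\<forall>y\<in>M. coords g y"
      by (elim exE conjE)
    define O' where "O' = M \<inter> {x\<in>pts A. \<phi> x \<in> N}"
    have o: "openin (zar A) O'"
      unfolding O'_def using M(1) cont[OF N] by auto
    have g: "g k \<in> reg A O'" for k
      by (rule reg_restrict[OF sheaf M(1) o _ M(3)[rule_format]]) (auto simp: O'_def)
    have h: "mpoly_at q (\<lambda>k. g k y) \<noteq> 0 \<and> h (\<phi> y) = mpoly_at p (\<lambda>k. g k y) / mpoly_at q (\<lambda>k. g k y)"
      if "y \<in> O'" for y
    proof -
      have "coords g y" "\<phi> y \<in> N"
        using M(4) that by (simp_all add: O'_def)
      then have "(\<lambda>k. g k y) \<in> \<phi> y" "(\<lambda>k. g k y) \<noteq> 0" "\<phi> y \<in> N"
        using fun_vs.span_base[of "\<lambda>k. g k y" "{\<lambda>k. g k y}"] by (simp_all add: coords_def)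
      then show ?thesis
        using pq(3,4) by blast
    qed
    have "(\<lambda>y. mpoly_at p (\<lambda>k. g k y) / mpoly_at q (\<lambda>k. g k y)) \<in> reg A O'"
      by (rule swf_divide[OF A o poly[OF o g] poly[OF o g]]) (use h in blast)
    then show "\<exists>M g. openin (zar A) M \<and> x \<in> M \<and> g \<in> reg A M \<and> (\<forall>y\<in>M. h (\<phi> y) = g y)"
      using o h M(2) x
      by (intro exI[of _ O'] exI[of _ "\<lambda>y. mpoly_at p (\<lambda>k. g k y) / mpoly_at q (\<lambda>k. g k y)"])
        (auto simp: O'_def)
  next
    show "\<phi> x \<in> pts (proj_space E)" if "x \<in> pts A" for x
      using lin[OF that] by simp
  qed
  then show ?thesis
    by (rule morphism_into_induced[OF sheaf]) (rule \<phi>)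
qed

section \<open>Quasi-affine varieties\<close>

text \<open>
  The building blocks: closed conditions and a single non-vanishing condition.  Allowing only one of the
  latter keeps these sets affine varieties, and the class is still stable under cutting by a polynomial.
\<close>

definition quasi_affine :: "'i set \<Rightarrow> ('i \<Rightarrow> 'k::field alg_closure) set \<Rightarrow> bool" where
  "quasi_affine J S \<longleftrightarrow> (\<exists>P q. P \<subseteq> polyfuns \<and> q \<in> polyfuns \<and>
     S = {v\<in>coord_space J. (\<forall>p\<in>P. p v = 0) \<and> q v \<noteq> 0})"

lemma quasi_affineI:
  "P \<subseteq> polyfuns \<Longrightarrow> q \<in> polyfuns \<Longrightarrow> S = {v\<in>coord_space J. (\<forall>p\<in>P. p v = 0) \<and> q v \<noteq> 0} \<Longrightarrow>
    quasi_affine J S"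
  unfolding quasi_affine_def by blast

lemma quasi_affineE:
  assumes "quasi_affine J S"
  obtains P q where "P \<subseteq> polyfuns" "q \<in> polyfuns"
    "S = {v\<in>coord_space J. (\<forall>p\<in>P. p v = 0) \<and> q v \<noteq> 0}"
  using assms unfolding quasi_affine_def by blast

lemma quasi_affine_subset: "quasi_affine J S \<Longrightarrow> S \<subseteq> coord_space J"
  by (auto elim: quasi_affineE)

lemma quasi_affine_zero:
  assumes "quasi_affine J S" "p \<in> polyfuns"
  shows "quasi_affine J {v\<in>S. p v = 0}"
proof -
  from assms(1) obtain P q where "P \<subseteq> polyfuns" "q \<in> polyfuns"
    "S = {v\<in>coord_space J. (\<forall>p\<in>P. p v = 0) \<and> q v \<noteq> 0}"
    by (rule quasi_affineE)
  with assms(2) show ?thesis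
    by (intro quasi_affineI[of "insert p P" q]) auto
qed

lemma quasi_affine_nonzero:
  assumes "quasi_affine J S" "p \<in> polyfuns"
  shows "quasi_affine J {v\<in>S. p v \<noteq> 0}"
proof -
  from assms(1) obtain P q where "P \<subseteq> polyfuns" "q \<in> polyfuns"
    "S = {v\<in>coord_space J. (\<forall>p\<in>P. p v = 0) \<and> q v \<noteq> 0}"
    by (rule quasi_affineE)
  with assms(2) show ?thesis
    by (intro quasi_affineI[of P "\<lambda>v. q v * p v"]) (auto intro: polyfuns_mult)
qed

definition is_affine :: "('p, 'k::field alg_closure) fspace \<Rightarrow> bool" where
  "is_affine M \<longleftrightarrow> (\<exists>n Z. closedin (zar (affine_space n)) Z \<and>
     isomorphic M (induced (affine_space n :: (_, 'k alg_closure) fspace) Z))"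

lemma is_affine_isomorphic: "isomorphic M Y \<Longrightarrow> is_affine Y \<Longrightarrow> is_affine M"
  unfolding is_affine_def using isomorphic_trans by blast

lemma prevariety_iff:
  "prevariety A \<longleftrightarrow> sheaf_condition A \<and> (\<exists>\<U>. finite \<U> \<and> \<Union>\<U> = pts A \<and>
     (\<forall>U\<in>\<U>. openin (zar A) U \<and> is_affine (induced A U)))"
  by (simp add: prevariety_def is_affine_def)

text \<open>Rabinowitsch: inverting \<open>q\<close> by an additional coordinate embeds such a set as a closed subset.\<close>

lemma quasi_affine_is_affine:
  fixes S :: "('i \<Rightarrow> 'k::field alg_closure) set"
  assumes J: "finite J" and S: "quasi_affine J S"
  shows "is_affine (induced (aff J) S)"
proof -
  from S obtain P q where Pq: "P \<subseteq> polyfuns" "q \<in> polyfuns"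
    "S = {v\<in>coord_space J. (\<forall>p\<in>P. p v = 0) \<and> q v \<noteq> 0}"
    by (rule quasi_affineE)
  obtain h where h: "bij_betw h J {..<card J}"
    using ex_bij_betw_finite_nat[OF J] atLeast0LessThan by metis
  define m where "m = card J"
  define g where "g = the_inv_into J h"
  have hJ: "h j < m" "g (h j) = j" if "j \<in> J" for j
    using h that unfolding g_def m_def
    by (auto simp: bij_betw_def the_inv_into_f_f)
  have gm: "g i \<in> J" "h (g i) = i" if "i < m" for i
    using h that bij_betw_the_inv_into[OF h] unfolding g_def m_def
    by (auto simp: bij_betw_def f_the_inv_into_f dest!: bij_betw_apply)
  define \<phi> :: "('i \<Rightarrow> 'k alg_closure) \<Rightarrow> nat \<Rightarrow> 'k alg_closure" where
    "\<phi> v = (\<lambda>i. if i < m then v (g i) else if i = m then 1 / q v else 0)" for v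
  define \<psi> :: "(nat \<Rightarrow> 'k alg_closure) \<Rightarrow> 'i \<Rightarrow> 'k alg_closure" where
    "\<psi> z = (\<lambda>j. if j \<in> J then z (h j) else 0)" for z
  have \<psi>poly: "(\<lambda>z. p (\<psi> z)) \<in> polyfuns" if "p \<in> polyfuns" for p
    unfolding \<psi>_def
    by (rule polyfuns_subst[OF that, of "\<lambda>j z. if j \<in> J then z (h j) else 0"])
      (intro polyfuns_if polyfuns_var polyfuns_0)
  define Q where "Q = insert (\<lambda>z. z m * q (\<psi> z) - 1) ((\<lambda>p z. p (\<psi> z)) ` P)"
  define Z where "Z = {z\<in>coord_space {..<Suc m}. \<forall>p\<in>Q. p z = 0}"
  have Q: "Q \<subseteq> polyfuns"
    unfolding Q_def using Pq \<psi>poly by (auto intro!: polyfuns_diff polyfuns_mult polyfuns_var polyfuns_1)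
  have \<psi>\<phi>: "\<psi> (\<phi> v) = v" if "v \<in> coord_space J" for v
    using that hJ by (auto simp: \<psi>_def \<phi>_def coord_space_def)
  have \<phi>Z: "\<phi> v \<in> Z" if "v \<in> S" for v
    using that Pq(3) \<psi>\<phi>[of v] by (auto simp: Z_def Q_def) (auto simp: \<phi>_def coord_space_def)
  have \<psi>S: "\<psi> z \<in> S" if "z \<in> Z" for z
    using that unfolding Pq(3) Z_def Q_def by (auto simp: \<psi>_def coord_space_def)
  have \<phi>\<psi>: "\<phi> (\<psi> z) = z" if "z \<in> Z" for z
  proof
    fix i
    from that have z: "z \<in> coord_space {..<Suc m}" "z m * q (\<psi> z) = 1"
      by (auto simp: Z_def Q_def)
    from z(2) have "q (\<psi> z) \<noteq> 0" by auto
    with z(2) have zm: "1 / q (\<psi> z) = z m"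
      by (simp add: divide_eq_eq)
    have "\<psi> z (g i) = z i" if "i < m"
      using gm[OF that] by (simp add: \<psi>_def)
    moreover have "z i = 0" if "i \<noteq> m" "\<not> i < m"
      using z(1) that by (auto simp: coord_space_def)
    ultimately show "\<phi> (\<psi> z) i = z i"
      using zm by (simp add: \<phi>_def)
  qed
  have "isomorphic (induced (aff J) S) (induced (aff {..<Suc m}) Z)"
  proof (rule isomorphicI)
    show "morphism (induced (aff J) S) (induced (aff {..<Suc m}) Z) \<phi>"
    proof (rule morphism_aff_affI)
      show "\<phi> v \<in> coord_space {..<Suc m} \<inter> Z" if "v \<in> S" for v
        using \<phi>Z[OF that] by (auto simp: Z_def)
      show "(\<lambda>v. \<phi> v i) \<in> aff_fractions (coord_space J \<inter> S)" if "i \<in> {..<Suc m}" for i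
      proof (cases "i = m")
        case True
        then show ?thesis
          using Pq by (intro aff_fractionsI[OF polyfuns_1 Pq(2)]) (auto simp: \<phi>_def)
      next
        case False
        with that show ?thesis
          by (intro polyfun_in_aff_fractions[OF polyfuns_var[of "g i"]]) (auto simp: \<phi>_def)
      qed
    qed
    show "morphism (induced (aff {..<Suc m}) Z) (induced (aff J) S) \<psi>"
    proof (rule morphism_aff_affI)
      show "\<psi> z \<in> coord_space J \<inter> S" if "z \<in> Z" for z
        using \<psi>S[OF that] Pq(3) by auto
      show "(\<lambda>z. \<psi> z j) \<in> aff_fractions (coord_space {..<Suc m} \<inter> Z)" if "j \<in> J" for j
        using that by (intro polyfun_in_aff_fractions[OF polyfuns_var[of "h j"]]) (auto simp: \<psi>_def)
    qed
  qed (use \<psi>\<phi> \<phi>\<psi> in auto)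
  moreover have "closedin (zar (aff {..<Suc m})) Z"
    unfolding Z_def by (rule closedin_aff_zero[OF Q])
  ultimately show ?thesis
    unfolding is_affine_def affine_space_eq_aff by blast
qed

text \<open>
  Two morphisms differ where one of the differences of their coordinates, which are regular functions, does
  not vanish; this locus is open.
\<close>

lemma separated_induced_aff:
  fixes S :: "('i \<Rightarrow> 'k::field alg_closure) set"
  shows "separated (induced (aff J) S)"
  unfolding separated_def
proof (intro allI impI, elim conjE)
  fix n and Z :: "(nat \<Rightarrow> 'k alg_closure) set" and \<phi> \<psi> :: "(nat \<Rightarrow> 'k alg_closure) \<Rightarrow> 'i \<Rightarrow> 'k alg_closure"
  let ?Z = "induced (affine_space n :: (_, 'k alg_closure) fspace) Z"
  assume Z: "closedin (zar (affine_space n)) Z"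
    and \<phi>: "morphism ?Z (induced (aff J) S) \<phi>" and \<psi>: "morphism ?Z (induced (aff J) S) \<psi>"
  have swf: "space_with_functions ?Z"
    unfolding affine_space_eq_aff by (intro space_with_functions_induced space_with_functions_aff)
  have pts: "pts ?Z = Z"
    using closedin_subset[OF Z] by (auto simp: induced_def)
  have reg: "(\<lambda>z. \<phi> z j - \<psi> z j) \<in> reg ?Z (pts ?Z)" for j
  proof -
    note ring = swf_add[OF swf openin_topspace] swf_mult[OF swf openin_topspace] swf_const[OF swf openin_topspace]
    show ?thesis
      using ring(1)[OF morphism_aff_coord[OF \<phi> polyfuns_var[of j]]
          ring(2)[OF ring(3)[of "- 1"] morphism_aff_coord[OF \<psi> polyfuns_var[of j]]]]
      by simp
  qed
  have "{z\<in>pts ?Z. \<phi> z \<noteq> \<psi> z} = (\<Union>j. {z\<in>pts ?Z. \<phi> z j - \<psi> z j \<noteq> 0})"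
    by (auto simp: fun_eq_iff)
  also have "openin (zar ?Z) \<dots>"
    by (intro openin_Union) (use swf_open[OF swf openin_topspace reg] in auto)
  finally have "openin (zar ?Z) (pts ?Z - {z\<in>Z. \<phi> z = \<psi> z})"
    using pts by (auto simp: set_diff_eq intro: back_subst[of "openin (zar ?Z)"])
  then show "closedin (zar ?Z) {z\<in>Z. \<phi> z = \<psi> z}"
    using pts by (auto simp: closedin_def)
qed

subsection \<open>Invariance under isomorphisms\<close>

lemma space_with_functions_is_affine:
  assumes "sheaf_condition M" "is_affine M"
  shows "space_with_functions M"
proof -
  from assms(2) obtain n Z where
    "isomorphic M (induced (affine_space n :: (_, 'b alg_closure) fspace) Z)"
    unfolding is_affine_def by (elim exE conjE)
  moreover have "space_with_functions (induced (affine_space n :: (_, 'b alg_closure) fspace) Z)"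
    unfolding affine_space_eq_aff by (intro space_with_functions_induced space_with_functions_aff)
  ultimately show ?thesis
    by (rule space_with_functions_isomorphic[OF assms(1)])
qed

lemma space_with_functions_prevariety:
  assumes "prevariety A"
  shows "space_with_functions A"
proof -
  from assms have sh: "sheaf_condition A"
    and cov: "\<exists>\<U>. finite \<U> \<and> \<Union>\<U> = pts A \<and> (\<forall>U\<in>\<U>. openin (zar A) U \<and> is_affine (induced A U))"
    unfolding prevariety_iff by simp_all
  from cov obtain \<U> where U: "\<Union>\<U> = pts A" "\<forall>U\<in>\<U>. openin (zar A) U \<and> is_affine (induced A U)"
    by (elim exE conjE)
  show ?thesis
  proof (rule space_with_functions_local[OF sh])
    fix x assume "x \<in> pts A"
    with U(1) obtain U where "U \<in> \<U>" "x \<in> U" by blast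
    with U(2) space_with_functions_is_affine[OF sheaf_induced[OF sh]]
    show "\<exists>U. openin (zar A) U \<and> x \<in> U \<and> space_with_functions (induced A U)"
      by blast
  qed
qed

text \<open>
  The sheaf condition for \<open>B\<close> has to be assumed here: an isomorphism does not see the values of the elements
  of \<open>reg B U\<close> outside \<open>U\<close>.
\<close>

lemma prevariety_isomorphic:
  assumes B: "sheaf_condition B" and iso: "isomorphic A B" and A: "prevariety A"
  shows "prevariety B"
proof -
  from A have "\<exists>\<U>. finite \<U> \<and> \<Union>\<U> = pts A \<and> (\<forall>U\<in>\<U>. openin (zar A) U \<and> is_affine (induced A U))"
    unfolding prevariety_iff by simp
  then obtain \<U> where U: "finite \<U>" "\<Union>\<U> = pts A" "\<forall>U\<in>\<U>. openin (zar A) U \<and> is_affine (induced A U)"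
    by (elim exE conjE)
  from iso obtain \<phi> where \<phi>: "\<And>S. isomorphic (induced A S) (induced B (\<phi> ` (S \<inter> pts A)))"
    "\<And>S. openin (zar A) S \<Longrightarrow> openin (zar B) (\<phi> ` S)" "\<phi> ` pts A = pts B"
    by (rule isomorphic_induced_subset) blast
  show ?thesis
    unfolding prevariety_iff
  proof (intro conjI B exI[of _ "(`) \<phi> ` \<U>"] ballI)
    show "finite ((`) \<phi> ` \<U>)"
      using U(1) by simp
    show "\<Union> ((`) \<phi> ` \<U>) = pts B"
      by (simp only: image_Union[symmetric] U(2) \<phi>(3))
    fix V assume "V \<in> (`) \<phi> ` \<U>"
    then obtain U' where U': "U' \<in> \<U>" "V = \<phi> ` U'" by blast
    then have "U' \<inter> pts A = U'"
      unfolding U(2)[symmetric] by blast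
    with U' \<phi>(1)[of U'] have iso': "isomorphic (induced A U') (induced B V)"
      by simp
    have "openin (zar A) U'" "is_affine (induced A U')"
      using U(3) U'(1) by simp_all
    then show "openin (zar B) V" "is_affine (induced B V)"
      using \<phi>(2) U'(2) is_affine_isomorphic[OF isomorphic_sym[OF iso']] by simp_all
  qed
qed

lemma separated_isomorphic:
  fixes A :: "('p, 'k::field alg_closure) fspace" and B :: "('q, 'k alg_closure) fspace"
  assumes iso: "isomorphic A B" and A: "separated A"
  shows "separated B"
  unfolding separated_def
proof (intro allI impI, elim conjE)
  from iso obtain \<alpha> \<beta> where 1: "morphism A B \<alpha>" "morphism B A \<beta>"
    "\<And>x. x \<in> pts A \<Longrightarrow> \<beta> (\<alpha> x) = x" "\<And>y. y \<in> pts B \<Longrightarrow> \<alpha> (\<beta> y) = y"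
    by (rule isomorphicE) blast
  fix n and Z :: "(nat \<Rightarrow> 'k alg_closure) set" and \<phi> \<psi> :: "(nat \<Rightarrow> 'k alg_closure) \<Rightarrow> 'q"
  let ?Z = "induced (affine_space n :: (_, 'k alg_closure) fspace) Z"
  assume Z: "closedin (zar (affine_space n)) Z" and \<phi>: "morphism ?Z B \<phi>" and \<psi>: "morphism ?Z B \<psi>"
  have "closedin (zar ?Z) {z\<in>Z. \<beta> (\<phi> z) = \<beta> (\<psi> z)}"
    using A Z morphism_compose[OF \<phi> 1(2)] morphism_compose[OF \<psi> 1(2)] unfolding separated_def by blast
  moreover have "pts ?Z = Z"
    using closedin_subset[OF Z] by (auto simp: induced_def)
  then have "\<phi> z = \<psi> z \<longleftrightarrow> \<beta> (\<phi> z) = \<beta> (\<psi> z)" if "z \<in> Z" for z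
    using 1(4) morphism_in_pts[OF \<phi>, of z] morphism_in_pts[OF \<psi>, of z] that by metis
  then have "{z\<in>Z. \<phi> z = \<psi> z} = {z\<in>Z. \<beta> (\<phi> z) = \<beta> (\<psi> z)}"
    by auto
  ultimately show "closedin (zar ?Z) {z\<in>Z. \<phi> z = \<psi> z}"
    by simp
qed

lemma variety_isomorphic:
  assumes "sheaf_condition B" "isomorphic A B" "variety A"
  shows "variety B"
  using assms prevariety_isomorphic separated_isomorphic unfolding variety_def by blast

section \<open>Classes in the Grothendieck ring\<close>

text \<open>
  \<^const>\<open>K0_class\<close> picks an isomorphic variety in the type of generators; it is meaningful
  for spaces that have one.
\<close>

definition has_model :: "('p, 'k::field alg_closure) fspace \<Rightarrow> bool" where
  "has_model M \<longleftrightarrow> (\<exists>A :: 'k var. isomorphic (space_of A) M)"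

lemma variety_space_of: "variety (space_of A)"
  using space_of[of A] by simp

lemma has_model_isomorphic: "has_model M \<Longrightarrow> isomorphic M Y \<Longrightarrow> has_model Y"
  unfolding has_model_def using isomorphic_trans by blast

lemma var_class_cong:
  assumes "isomorphic (space_of A) (space_of B)"
  shows "var_class A = var_class B"
proof -
  have "gen A - gen B \<in> K0_relations"
    unfolding K0_relations_def using assms by blast
  then show ?thesis
    by transfer (simp add: K0_equiv_def ideal_generated_incl)
qed

lemma K0_class_eq:
  assumes "isomorphic (space_of A) M"
  shows "K0_class M = var_class A"
proof -
  have "isomorphic (space_of (SOME A. isomorphic (space_of A) M)) M"
    by (rule someI[of "\<lambda>A. isomorphic (space_of A) M", OF assms])
  then have "isomorphic (space_of (SOME A. isomorphic (space_of A) M)) (space_of A)"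
    using isomorphic_trans isomorphic_sym assms by blast
  then show ?thesis
    unfolding K0_class_def by (rule var_class_cong)
qed

lemma K0_class_cong:
  assumes "has_model M" "isomorphic M Y"
  shows "K0_class M = K0_class Y"
proof -
  from assms(1) obtain A where A: "isomorphic (space_of A) M"
    unfolding has_model_def by blast
  from K0_class_eq[OF A] K0_class_eq[OF isomorphic_trans[OF A assms(2)]] show ?thesis
    by simp
qed

text \<open>
  Numbering the coordinates moves the points into the type that the generators use.  Separatedness is
  inherited from affine space, so being a prevariety is all that has to be known.
\<close>

lemma has_modelI:
  fixes M :: "('p, 'k::field alg_closure) fspace" and S :: "('i \<Rightarrow> 'k alg_closure) set"
  assumes M: "prevariety M" and iso: "isomorphic M (induced (aff J) S)" and J: "finite J"
  shows "has_model M"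
proof -
  obtain h where h: "bij_betw h J {..<card J}"
    using ex_bij_betw_finite_nat[OF J] atLeast0LessThan by metis
  define m where "m = card J"
  define g where "g = the_inv_into J h"
  have hJ: "h j < m" "g (h j) = j" if "j \<in> J" for j
    using h that unfolding g_def m_def
    by (auto simp: bij_betw_def the_inv_into_f_f)
  have gm: "g i \<in> J" "h (g i) = i" if "i < m" for i
    using h that bij_betw_the_inv_into[OF h] unfolding g_def m_def
    by (auto simp: bij_betw_def f_the_inv_into_f dest!: bij_betw_apply)
  define \<phi> :: "('i \<Rightarrow> 'k alg_closure) \<Rightarrow> nat \<Rightarrow> 'k alg_closure" where
    "\<phi> v = (\<lambda>i. if i < m then v (g i) else 0)" for v
  define \<psi> :: "(nat \<Rightarrow> 'k alg_closure) \<Rightarrow> 'i \<Rightarrow> 'k alg_closure" where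
    "\<psi> z = (\<lambda>j. if j \<in> J then z (h j) else 0)" for z
  define S' where "S' = {z\<in>coord_space {..<m}. \<psi> z \<in> S}"
  have \<psi>\<phi>: "\<psi> (\<phi> v) = v" if "v \<in> coord_space J" for v
    using that hJ by (auto simp: \<psi>_def \<phi>_def coord_space_def)
  have \<phi>\<psi>: "\<phi> (\<psi> z) = z" if "z \<in> coord_space {..<m}" for z
    using that gm by (auto simp: \<psi>_def \<phi>_def coord_space_def)
  let ?B = "induced (affine_space m :: (_, 'k alg_closure) fspace) S'"
  have "isomorphic (induced (aff J) S) (induced (aff {..<m}) S')"
  proof (rule isomorphicI)
    show "morphism (induced (aff J) S) (induced (aff {..<m}) S') \<phi>"
    proof (rule morphism_aff_affI)
      show "\<phi> v \<in> coord_space {..<m} \<inter> S'" if "v \<in> coord_space J" "v \<in> S" for v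
        using that \<psi>\<phi>[of v] by (auto simp: S'_def) (auto simp: \<phi>_def coord_space_def)
      show "(\<lambda>v. \<phi> v i) \<in> aff_fractions (coord_space J \<inter> S)" if "i \<in> {..<m}" for i
        using that by (intro polyfun_in_aff_fractions[OF polyfuns_var[of "g i"]]) (auto simp: \<phi>_def)
    qed
    show "morphism (induced (aff {..<m}) S') (induced (aff J) S) \<psi>"
    proof (rule morphism_aff_affI)
      show "\<psi> z \<in> coord_space J \<inter> S" if "z \<in> S'" for z
        using that by (auto simp: S'_def) (auto simp: \<psi>_def coord_space_def)
      show "(\<lambda>z. \<psi> z j) \<in> aff_fractions (coord_space {..<m} \<inter> S')" if "j \<in> J" for j
        using that by (intro polyfun_in_aff_fractions[OF polyfuns_var[of "h j"]]) (auto simp: \<psi>_def)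
    qed
  qed (use \<psi>\<phi> \<phi>\<psi> in \<open>auto simp: S'_def\<close>)
  with iso have iso': "isomorphic M ?B"
    unfolding affine_space_eq_aff using isomorphic_trans by blast
  have "sheaf_condition ?B" and sep: "separated ?B"
    unfolding affine_space_eq_aff
    by (intro swf_sheaf space_with_functions_induced space_with_functions_aff) (rule separated_induced_aff)
  then have "prevariety ?B"
    using prevariety_isomorphic[OF _ iso' M] by blast
  with sep have "space_of (Abs_var ?B) = ?B"
    by (intro Abs_var_inverse) (simp add: variety_def)
  then show ?thesis
    unfolding has_model_def using isomorphic_sym[OF iso'] by metis
qed

lemma has_model_quasi_affine:
  assumes "finite J" "quasi_affine J S"
  shows "has_model (induced (aff J) S)"
proof (rule has_modelI[OF _ isomorphic_refl assms(1)])
  let ?X = "induced (aff J) S"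
  have sh: "sheaf_condition (aff J)"
    by (intro swf_sheaf space_with_functions_aff)
  have S: "pts ?X = S"
    using quasi_affine_subset[OF assms(2)] by auto
  have "is_affine (induced ?X S)"
    by (rule is_affine_isomorphic[OF isomorphic_induced_induced[OF sh order_refl]
          quasi_affine_is_affine[OF assms]])
  then show "prevariety ?X"
    unfolding prevariety_iff using sheaf_induced[OF sh] S openin_topspace[of "zar ?X"]
    by (intro conjI exI[of _ "{S}"]) auto
qed

text \<open>
  The scissor relation is imposed on generators only.  An isomorphism with a model \<open>A\<close> carries the
  decomposition to \<open>A\<close>, where both parts are varieties because they are isomorphic to varieties.
\<close>

lemma K0_class_split:
  fixes M :: "('p, 'k::field alg_closure) fspace"
  assumes M: "has_model M" and C: "closedin (zar M) C"
    and mC: "has_model (induced M C)" and mU: "has_model (induced M (pts M - C))"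
  shows "K0_class M = K0_class (induced M C) + K0_class (induced M (pts M - C))"
proof -
  from M obtain A :: "'k var" where A: "isomorphic (space_of A) M"
    unfolding has_model_def by blast
  from A obtain \<alpha> where \<alpha>: "\<And>S. isomorphic (induced (space_of A) {x\<in>pts (space_of A). \<alpha> x \<in> S}) (induced M S)"
    "\<And>S. closedin (zar M) S \<Longrightarrow> closedin (zar (space_of A)) {x\<in>pts (space_of A). \<alpha> x \<in> S}"
    "\<alpha> ` pts (space_of A) = pts M"
    by (rule isomorphic_induced_subset) blast
  have sh: "sheaf_condition (space_of A)"
    using variety_space_of[of A] by (simp add: variety_def prevariety_def)
  have model: "\<exists>Z. space_of Z = induced (space_of A) {x\<in>pts (space_of A). \<alpha> x \<in> S} \<and>
      K0_class (induced M S) = var_class Z"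
    if "has_model (induced M S)" for S
  proof -
    let ?Y = "induced (space_of A) {x\<in>pts (space_of A). \<alpha> x \<in> S}"
    from that obtain B :: "'k var" where "isomorphic (space_of B) (induced M S)"
      unfolding has_model_def by blast
    then have "isomorphic (space_of B) ?Y"
      using isomorphic_trans isomorphic_sym[OF \<alpha>(1)] by blast
    then have "variety ?Y"
      by (rule variety_isomorphic[OF sheaf_induced[OF sh] _ variety_space_of])
    then have "space_of (Abs_var ?Y) = ?Y"
      by (intro Abs_var_inverse) simp
    moreover from this have "K0_class (induced M S) = var_class (Abs_var ?Y)"
      by (intro K0_class_eq) (simp only: \<alpha>(1))
    ultimately show ?thesis
      by (intro exI[of _ "Abs_var ?Y"] conjI)
  qed
  obtain Z where Z: "space_of Z = induced (space_of A) {x\<in>pts (space_of A). \<alpha> x \<in> C}"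
    "K0_class (induced M C) = var_class Z"
    using model[OF mC] by blast
  obtain U where U: "space_of U = induced (space_of A) {x\<in>pts (space_of A). \<alpha> x \<in> pts M - C}"
    "K0_class (induced M (pts M - C)) = var_class U"
    using model[OF mU] by blast
  have eq: "{x\<in>pts (space_of A). \<alpha> x \<in> pts M - C} =
      pts (space_of A) - {x\<in>pts (space_of A). \<alpha> x \<in> C}"
    using \<alpha>(3) by auto
  have "gen A - (gen Z + gen U) \<in> K0_relations"
    unfolding K0_relations_def using \<alpha>(2)[OF C] Z(1) U(1)[unfolded eq] by blast
  then have "var_class A = var_class Z + var_class U"
    by transfer (simp add: K0_equiv_def ideal_generated_incl)
  with K0_class_eq[OF A] Z(2) U(2) show ?thesis by simp
qed

lemma var_class_product: "is_product P A B \<Longrightarrow> var_class P = var_class A * var_class B"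
proof -
  assume "is_product P A B"
  then have "gen P - gen A * gen B \<in> K0_relations"
    unfolding K0_relations_def by blast
  then show ?thesis
    by transfer (simp add: K0_equiv_def ideal_generated_incl)
qed

subsection \<open>Classes of quasi-affine sets\<close>

definition aff_class :: "'i set \<Rightarrow> ('i \<Rightarrow> 'k::field alg_closure) set \<Rightarrow> 'k K0" where
  "aff_class J S = K0_class (induced (aff J) S)"

lemma aff_class_cong:
  assumes "finite I" "quasi_affine I R" "isomorphic (induced (aff I) R) (induced (aff J) S)"
  shows "aff_class I R = aff_class J S"
  unfolding aff_class_def by (rule K0_class_cong[OF has_model_quasi_affine[OF assms(1,2)] assms(3)])

lemma aff_class_split:
  assumes J: "finite J" and S: "quasi_affine J S" and p: "p \<in> polyfuns"
  shows "aff_class J S = aff_class J {v\<in>S. p v = 0} + aff_class J {v\<in>S. p v \<noteq> 0}"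
proof -
  let ?X = "induced (aff J) S"
  have swf: "sheaf_condition (aff J)"
    by (intro swf_sheaf space_with_functions_aff)
  have pts: "pts ?X = S"
    using quasi_affine_subset[OF S] by auto
  have U: "pts ?X - {v\<in>S. p v = 0} = {v\<in>S. p v \<noteq> 0}"
    using pts by auto
  have mC: "has_model (induced (aff J) {v\<in>S. p v = 0})"
    and mU: "has_model (induced (aff J) {v\<in>S. p v \<noteq> 0})"
    by (intro has_model_quasi_affine[OF J] quasi_affine_zero quasi_affine_nonzero S p)+
  have iso: "isomorphic (induced (aff J) {v\<in>S. p v = 0}) (induced ?X {v\<in>S. p v = 0})"
    "isomorphic (induced (aff J) {v\<in>S. p v \<noteq> 0}) (induced ?X {v\<in>S. p v \<noteq> 0})"
    by (intro isomorphic_sym[OF isomorphic_induced_induced[OF swf]]; blast)+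
  have "closedin (zar ?X) {v\<in>S. p v = 0}"
  proof -
    have "openin (zar ?X) {v\<in>S. p v \<noteq> 0}"
      unfolding openin_induced using openin_aff_nonzero[OF p, of J] quasi_affine_subset[OF S] by blast
    then show ?thesis
      unfolding closedin_def using U pts by auto
  qed
  from K0_class_split[OF has_model_quasi_affine[OF J S] this has_model_isomorphic[OF mC iso(1)]]
  show ?thesis
    using has_model_isomorphic[OF mU iso(2)] U K0_class_cong[OF mC iso(1)] K0_class_cong[OF mU iso(2)]
    by (simp add: aff_class_def)
qed

lemma quasi_affine_cylinder:
  assumes "quasi_affine J S" "t \<notin> J"
  shows "quasi_affine (insert t J) {v\<in>coord_space (insert t J). v(t := 0) \<in> S}"
proof -
  from assms(1) obtain P q where Pq: "P \<subseteq> polyfuns" "q \<in> polyfuns"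
    "S = {v\<in>coord_space J. (\<forall>p\<in>P. p v = 0) \<and> q v \<noteq> 0}"
    by (rule quasi_affineE)
  have sub: "(\<lambda>v. p (v(t := 0))) \<in> polyfuns" if "p \<in> polyfuns" for p
  proof -
    have "(\<lambda>v. p (\<lambda>i. if i = t then 0 else v i)) \<in> polyfuns"
      by (rule polyfuns_subst[OF that, of "\<lambda>i v. if i = t then 0 else v i"])
        (intro polyfuns_if polyfuns_var polyfuns_0)
    then show ?thesis by (simp add: fun_upd_def)
  qed
  have "v(t := 0) \<in> coord_space J" if "v \<in> coord_space (insert t J)" for v :: "'a \<Rightarrow> 'b alg_closure"
    using that by (auto simp: coord_space_def)
  with Pq show ?thesis
    by (intro quasi_affineI[of "(\<lambda>p v. p (v(t := 0))) ` P" "\<lambda>v. q (v(t := 0))"]) (auto intro: sub)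
qed

lemma quasi_affine_Gm: "quasi_affine {..<1::nat} {v\<in>coord_space {..<1::nat}. v 0 \<noteq> 0}"
  by (rule quasi_affineI[of "{}" "\<lambda>v. v 0"]) (auto intro: polyfuns_var)

lemma torus_class_eq: "torus_class = aff_class {..<1::nat} {v\<in>coord_space {..<1::nat}. v 0 \<noteq> 0}"
proof -
  have "isomorphic (induced (aff {..<1::nat}) {v\<in>coord_space {..<1::nat}. v 0 \<noteq> 0}) (Gm :: (_, 'a alg_closure) fspace)"
    unfolding Gm_def affine_space_eq_aff
    by (rule isomorphic_induced_cong) auto
  from K0_class_cong[OF has_model_quasi_affine[OF _ quasi_affine_Gm] this]
  show ?thesis by (simp add: torus_class_def aff_class_def)
qed

text \<open>
  The universal property of the product with \<open>G\<^sub>m\<close> holds because a morphism into a subset of affine space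
  is the same as a family of regular functions.
\<close>

lemma aff_class_times_Gm:
  fixes S :: "('i \<Rightarrow> 'k::field alg_closure) set"
  assumes J: "finite J" and S: "quasi_affine J S" and t: "t \<notin> J"
  shows "aff_class (insert t J) {v\<in>coord_space (insert t J). v t \<noteq> 0 \<and> v(t := 0) \<in> S} =
    torus_class * aff_class J S"
proof -
  define S' where "S' = {v\<in>coord_space (insert t J). v t \<noteq> 0 \<and> v(t := 0) \<in> S}"
  define G :: "(nat \<Rightarrow> 'k alg_closure) set" where "G = {v\<in>coord_space {..<1::nat}. v 0 \<noteq> 0}"
  let ?X = "induced (aff (insert t J)) S'" and ?Y = "induced (aff J) S" and ?G = "induced (aff {..<1::nat}) G"
  have "S' = {v\<in>{v\<in>coord_space (insert t J). v(t := 0) \<in> S}. v t \<noteq> 0}"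
    by (auto simp: S'_def)
  then have qa: "quasi_affine (insert t J) S'"
    using quasi_affine_nonzero[OF quasi_affine_cylinder[OF S t] polyfuns_var[of t]] by simp
  have SJ: "S \<subseteq> coord_space J"
    using quasi_affine_subset[OF S] .
  have ptsX: "pts ?X = S'" and ptsY: "pts ?Y = S" and ptsG: "pts ?G = G"
    using SJ by (auto simp: S'_def G_def)
  obtain P :: "'k var" where P: "isomorphic (space_of P) ?X"
    using has_model_quasi_affine[OF _ qa] J unfolding has_model_def by auto
  obtain A :: "'k var" where A: "isomorphic (space_of A) ?Y"
    using has_model_quasi_affine[OF J S] unfolding has_model_def by auto
  obtain B :: "'k var" where B: "isomorphic (space_of B) ?G"
    using has_model_quasi_affine[OF _ quasi_affine_Gm] unfolding has_model_def G_def by auto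
  from P obtain \<alpha> \<alpha>' where \<alpha>: "morphism (space_of P) ?X \<alpha>" "morphism ?X (space_of P) \<alpha>'"
    "\<And>x. x \<in> pts (space_of P) \<Longrightarrow> \<alpha>' (\<alpha> x) = x" "\<And>x. x \<in> pts ?X \<Longrightarrow> \<alpha> (\<alpha>' x) = x"
    by (rule isomorphicE) blast
  from A obtain \<beta> \<beta>' where \<beta>: "morphism (space_of A) ?Y \<beta>" "morphism ?Y (space_of A) \<beta>'"
    "\<And>x. x \<in> pts (space_of A) \<Longrightarrow> \<beta>' (\<beta> x) = x" "\<And>x. x \<in> pts ?Y \<Longrightarrow> \<beta> (\<beta>' x) = x"
    by (rule isomorphicE) blast
  from B obtain \<gamma> \<gamma>' where \<gamma>: "morphism (space_of B) ?G \<gamma>" "morphism ?G (space_of B) \<gamma>'"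
    "\<And>x. x \<in> pts (space_of B) \<Longrightarrow> \<gamma>' (\<gamma> x) = x" "\<And>x. x \<in> pts ?G \<Longrightarrow> \<gamma> (\<gamma>' x) = x"
    by (rule isomorphicE) blast
  define p where "p v = v(t := 0)" for v :: "'i \<Rightarrow> 'k alg_closure"
  define q where "q v = (\<lambda>i :: nat. if i = 0 then v t else 0)" for v :: "'i \<Rightarrow> 'k alg_closure"
  have p: "morphism ?X ?Y p"
  proof (rule morphism_aff_affI)
    show "p v \<in> coord_space J \<inter> S" if "v \<in> S'" for v
      using that SJ by (auto simp: p_def S'_def)
    show "(\<lambda>v. p v j) \<in> aff_fractions (coord_space (insert t J) \<inter> S')" if "j \<in> J" for j
      using that t by (intro polyfun_in_aff_fractions[OF polyfuns_var[of j]]) (auto simp: p_def)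
  qed
  have q: "morphism ?X ?G q"
  proof (rule morphism_aff_affI)
    show "q v \<in> coord_space {..<1::nat} \<inter> G" if "v \<in> S'" for v
      using that by (auto simp: q_def S'_def G_def coord_space_def)
    show "(\<lambda>v. q v j) \<in> aff_fractions (coord_space (insert t J) \<inter> S')" if "j \<in> {..<1::nat}" for j
      using that by (intro polyfun_in_aff_fractions[OF polyfuns_var[of t]]) (auto simp: q_def)
  qed
  \<comment> \<open>A pair of morphisms \<open>a\<close>, \<open>b\<close> from \<open>T\<close> is the family of the coordinates of \<open>a\<close> together with the
    invertible function \<open>b\<close>; as the value of coordinate \<open>t\<close>, it defines the morphism to the product.\<close>
  have "is_product P A B"
    unfolding is_product_def
  proof (rule exI[of _ "\<lambda>x. \<beta>' (p (\<alpha> x))"], rule exI[of _ "\<lambda>x. \<gamma>' (q (\<alpha> x))"], intro conjI allI impI)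
    show "morphism (space_of P) (space_of A) (\<lambda>x. \<beta>' (p (\<alpha> x)))"
      by (rule morphism_compose[OF morphism_compose[OF \<alpha>(1) p] \<beta>(2)])
    show "morphism (space_of P) (space_of B) (\<lambda>x. \<gamma>' (q (\<alpha> x)))"
      by (rule morphism_compose[OF morphism_compose[OF \<alpha>(1) q] \<gamma>(2)])
    fix T :: "'k var" and a b
    assume "morphism (space_of T) (space_of A) a \<and> morphism (space_of T) (space_of B) b"
    then have a: "morphism (space_of T) (space_of A) a" and b: "morphism (space_of T) (space_of B) b"
      by auto
    have \<beta>a: "morphism (space_of T) ?Y (\<lambda>x. \<beta> (a x))" and \<gamma>b: "morphism (space_of T) ?G (\<lambda>x. \<gamma> (b x))"
      using morphism_compose[OF a \<beta>(1)] morphism_compose[OF b \<gamma>(1)] .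
    define \<phi> where "\<phi> x = (\<beta> (a x))(t := \<gamma> (b x) 0)" for x
    have in_S: "\<beta> (a x) \<in> S" and in_G: "\<gamma> (b x) \<in> G" if "x \<in> pts (space_of T)" for x
      using morphism_in_pts[OF \<beta>a that] morphism_in_pts[OF \<gamma>b that] ptsY ptsG by auto
    have t0: "v t = 0" if "v \<in> S" for v
      using that SJ t by (auto simp: coord_space_def)
    have \<phi>S: "\<phi> x \<in> S'" if "x \<in> pts (space_of T)" for x
    proof -
      have "(\<phi> x)(t := 0) = \<beta> (a x)"
        using t0[OF in_S[OF that]] by (auto simp: \<phi>_def)
      moreover have "\<phi> x \<in> coord_space (insert t J)"
        using in_S[OF that] SJ by (auto simp: \<phi>_def coord_space_def)
      moreover have "\<phi> x t \<noteq> 0"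
        using in_G[OF that] by (simp add: \<phi>_def G_def)
      ultimately show ?thesis
        using in_S[OF that] by (simp add: S'_def)
    qed
    have p\<phi>: "p (\<phi> x) = \<beta> (a x)" and q\<phi>: "q (\<phi> x) = \<gamma> (b x)" if "x \<in> pts (space_of T)" for x
      using t0[OF in_S[OF that]] in_G[OF that] by (auto simp: p_def q_def \<phi>_def G_def coord_space_def)
    have \<phi>: "morphism (space_of T) ?X \<phi>"
    proof (rule morphism_affI)
      show "space_with_functions (space_of T)"
        using variety_space_of[of T] by (intro space_with_functions_prevariety) (simp add: variety_def)
      show "\<phi> x \<in> coord_space (insert t J) \<inter> S'" if "x \<in> pts (space_of T)" for x
        using \<phi>S[OF that] by (auto simp: S'_def)
      show "(\<lambda>x. \<phi> x j) \<in> reg (space_of T) (pts (space_of T))" for j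
        using morphism_aff_coord[OF \<beta>a polyfuns_var[of j]] morphism_aff_coord[OF \<gamma>b polyfuns_var[of 0]]
        by (cases "j = t") (auto simp: \<phi>_def)
    qed
    show "\<exists>\<phi>. morphism (space_of T) (space_of P) \<phi> \<and>
        (\<forall>x\<in>pts (space_of T). \<beta>' (p (\<alpha> (\<phi> x))) = a x \<and> \<gamma>' (q (\<alpha> (\<phi> x))) = b x) \<and>
        (\<forall>\<phi>'. morphism (space_of T) (space_of P) \<phi>' \<and>
          (\<forall>x\<in>pts (space_of T). \<beta>' (p (\<alpha> (\<phi>' x))) = a x \<and> \<gamma>' (q (\<alpha> (\<phi>' x))) = b x) \<longrightarrow>
          (\<forall>x\<in>pts (space_of T). \<phi>' x = \<phi> x))"
    proof (intro exI[of _ "\<lambda>x. \<alpha>' (\<phi> x)"] conjI ballI allI impI)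
      show "morphism (space_of T) (space_of P) (\<lambda>x. \<alpha>' (\<phi> x))"
        by (rule morphism_compose[OF \<phi> \<alpha>(2)])
      fix x assume x: "x \<in> pts (space_of T)"
      have "\<alpha> (\<alpha>' (\<phi> x)) = \<phi> x"
        using \<alpha>(4) morphism_in_pts[OF \<phi> x] by blast
      then show "\<beta>' (p (\<alpha> (\<alpha>' (\<phi> x)))) = a x" "\<gamma>' (q (\<alpha> (\<alpha>' (\<phi> x)))) = b x"
        using p\<phi>[OF x] q\<phi>[OF x] \<beta>(3)[OF morphism_in_pts[OF a x]] \<gamma>(3)[OF morphism_in_pts[OF b x]]
        by simp_all
    next
      fix \<phi>' x assume \<phi>': "morphism (space_of T) (space_of P) \<phi>' \<and>
          (\<forall>x\<in>pts (space_of T). \<beta>' (p (\<alpha> (\<phi>' x))) = a x \<and> \<gamma>' (q (\<alpha> (\<phi>' x))) = b x)"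
        and x: "x \<in> pts (space_of T)"
      define y where "y = \<alpha> (\<phi>' x)"
      have \<phi>'x: "\<phi>' x \<in> pts (space_of P)"
        using morphism_in_pts[of "space_of T" "space_of P" \<phi>'] \<phi>' x by blast
      then have y: "y \<in> pts ?X"
        unfolding y_def by (rule morphism_in_pts[OF \<alpha>(1)])
      have "\<beta> (\<beta>' (p y)) = p y" "\<gamma> (\<gamma>' (q y)) = q y"
        using \<beta>(4)[OF morphism_in_pts[OF p y]] \<gamma>(4)[OF morphism_in_pts[OF q y]] .
      with \<phi>' x have pq: "p y = \<beta> (a x)" "q y = \<gamma> (b x)"
        unfolding y_def by auto
      have "y = \<phi> x"
      proof
        fix i
        show "y i = \<phi> x i"
          using fun_cong[OF pq(1), of i] fun_cong[OF pq(2), of 0]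
          by (auto simp: \<phi>_def p_def q_def split: if_splits)
      qed
      then show "\<phi>' x = \<alpha>' (\<phi> x)"
        using \<alpha>(3)[OF \<phi>'x] y_def by simp
    qed
  qed
  from var_class_product[OF this] K0_class_eq[OF P] K0_class_eq[OF A] K0_class_eq[OF B]
  show ?thesis
    unfolding torus_class_eq aff_class_def S'_def G_def by (simp add: mult.commute)
qed

lemma aff_class_zero_section:
  assumes J: "finite J" and S: "quasi_affine J S" and t: "t \<notin> J"
  shows "aff_class (insert t J) S = aff_class J S"
proof -
  have SJ: "S \<subseteq> coord_space J"
    using quasi_affine_subset[OF S] .
  have "isomorphic (induced (aff J) S) (induced (aff (insert t J)) S)"
  proof (rule isomorphicI)
    show "morphism (induced (aff J) S) (induced (aff (insert t J)) S) (\<lambda>v. v)"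
      by (rule morphism_aff_affI)
        (auto simp: coord_space_def intro: polyfun_in_aff_fractions[OF polyfuns_var])
    show "morphism (induced (aff (insert t J)) S) (induced (aff J) S) (\<lambda>v. v)"
      by (rule morphism_aff_affI)
        (use SJ in \<open>auto intro: polyfun_in_aff_fractions[OF polyfuns_var]\<close>)
  qed auto
  from aff_class_cong[OF J S this] show ?thesis by simp
qed

text \<open>
  The affine line is \<open>G\<^sub>m\<close> and a point, so a cylinder is the product with \<open>G\<^sub>m\<close> and the zero section.
\<close>

lemma aff_class_cylinder:
  assumes J: "finite J" and S: "quasi_affine J S" and t: "t \<notin> J"
  shows "aff_class (insert t J) {v\<in>coord_space (insert t J). v(t := 0) \<in> S} =
    torus_class * aff_class J S + aff_class J S"
proof -
  let ?C = "{v\<in>coord_space (insert t J). v(t := 0) \<in> S}"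
  have SJ: "S \<subseteq> coord_space J"
    using quasi_affine_subset[OF S] .
  have "{v\<in>?C. v t = 0} = S"
  proof (intro equalityI subsetI)
    show "v \<in> S" if "v \<in> {v\<in>?C. v t = 0}" for v
      using that by (metis (mono_tags, lifting) fun_upd_triv mem_Collect_eq)
    show "v \<in> {v\<in>?C. v t = 0}" if "v \<in> S" for v
    proof -
      have "v t = 0"
        using that SJ t by (auto simp: coord_space_def)
      then have "v(t := 0) = v" by auto
      with that SJ \<open>v t = 0\<close> show ?thesis by (auto simp: coord_space_def)
    qed
  qed
  moreover have "{v\<in>?C. v t \<noteq> 0} = {v\<in>coord_space (insert t J). v t \<noteq> 0 \<and> v(t := 0) \<in> S}"
    by auto
  ultimately show ?thesis
    using aff_class_split[OF _ quasi_affine_cylinder[OF S t] polyfuns_var[of t]] J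
      aff_class_zero_section[OF assms] aff_class_times_Gm[OF assms]
    by (simp add: add.commute)
qed

section \<open>Stratification of projective sets\<close>

definition proj_set :: "'e set \<Rightarrow> ('e, 'k::field) mpoly set \<Rightarrow> ('e, 'k) mpoly \<Rightarrow> ('e \<Rightarrow> 'k alg_closure) set set" where
  "proj_set E P q = {L\<in>lines E. (\<forall>p\<in>P. vanishes_on p L) \<and> \<not> vanishes_on q L}"

lemma vanishes_on_mvar:
  assumes "L \<in> lines E" "v \<in> L" "v \<noteq> 0"
  shows "vanishes_on (mvar i) L \<longleftrightarrow> v i = 0"
  using vanishes_on_iff[OF homogeneous_mvar assms] by simp

lemma nonzero_coordinate: "v \<noteq> 0 \<Longrightarrow> \<exists>i. v i \<noteq> 0"
  by (auto simp: fun_eq_iff)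

text \<open>The standard chart: a line on which \<open>x\<^sub>i\<close> does not vanish contains a unique vector with \<open>x\<^sub>i = 1\<close>.\<close>

lemma proj_chart:
  fixes Y :: "('e \<Rightarrow> 'k::field alg_closure) set set"
  assumes i: "i \<in> E" and Y: "Y \<subseteq> lines E" and nz: "\<And>L. L \<in> Y \<Longrightarrow> \<not> vanishes_on (mvar i :: ('e, 'k) mpoly) L"
  shows "isomorphic (induced (proj_space E) Y)
    (induced (aff E) {v\<in>coord_space E. v i = 1 \<and> fun_vs.span {v} \<in> Y})"
proof -
  let ?Y = "induced (proj_space E) Y"
  define S where "S = {v\<in>coord_space E. v i = 1 \<and> fun_vs.span {v} \<in> Y}"
  define \<phi> where "\<phi> L = (\<lambda>k. spanning_vector L k / spanning_vector L i)" for L :: "('e \<Rightarrow> 'k alg_closure) set"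
  have ptsY: "pts ?Y = Y"
    using Y by auto
  have sv: "spanning_vector L i \<noteq> 0" if "L \<in> Y" for L
    using nz[OF that] vanishes_on_mvar[of L E "spanning_vector L" i] spanning_vector(1,2)[of L E] that Y
    by blast
  have \<phi>: "\<phi> L \<in> coord_space E" "\<phi> L i = 1" "fun_vs.span {\<phi> L} = L" if L: "L \<in> Y" for L
  proof -
    have LE: "L \<in> lines E" using L Y by blast
    show "\<phi> L \<in> coord_space E" "\<phi> L i = 1"
      using spanning_vector(3)[OF LE] sv[OF L] by (auto simp: \<phi>_def coord_space_def)
    have "(\<lambda>k. (1 / spanning_vector L i) * spanning_vector L k) \<in> L"
      using line_eq(1)[OF LE spanning_vector(1,2)[OF LE]] by blast
    then have "\<phi> L \<in> L"
      by (simp add: \<phi>_def)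
    moreover have "\<phi> L \<noteq> 0"
      using \<open>\<phi> L i = 1\<close> by auto
    ultimately show "fun_vs.span {\<phi> L} = L"
      using line_eq_span[OF LE] by simp
  qed
  have \<psi>\<phi>: "\<phi> (fun_vs.span {v}) = v" if v: "v \<in> S" for v
  proof -
    define L where "L = fun_vs.span {v}"
    have L: "L \<in> lines E" "L \<in> Y" "v \<in> L" "v \<noteq> 0" "v i = 1"
      using v Y fun_vs.span_base[of v "{v}"] by (auto simp: S_def L_def)
    obtain c where "spanning_vector L = (\<lambda>k. c * v k)"
      using line_eq(1)[OF L(1,3,4)] spanning_vector(1)[OF L(1)] by blast
    with sv[OF L(2)] L(5) show ?thesis
      unfolding L_def[symmetric] by (simp add: \<phi>_def)
  qed
  have "isomorphic ?Y (induced (aff E) S)"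
  proof (rule isomorphicI)
    show "morphism ?Y (induced (aff E) S) \<phi>"
    proof (rule morphism_affI)
      show "space_with_functions ?Y"
        by (intro space_with_functions_induced space_with_functions_proj)
      show "\<phi> L \<in> coord_space E \<inter> S" if "L \<in> pts ?Y" for L
        using \<phi>[of L] that ptsY by (simp add: S_def)
      show "(\<lambda>L. \<phi> L k) \<in> reg ?Y (pts ?Y)" for k
        using ratio_reg_proj[OF homogeneous_mvar[of k] homogeneous_mvar[of i] openin_topspace, of E Y] nz
        unfolding \<phi>_def ptsY by simp
    qed
    show "morphism (induced (aff E) S) ?Y (\<lambda>v. fun_vs.span {v})"
    proof (rule morphism_projI)
      show "space_with_functions (induced (aff E) S)"
        by (intro space_with_functions_induced space_with_functions_aff)
      show "fun_vs.span {v} \<in> Y" if "v \<in> pts (induced (aff E) S)" for v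
        using that by (simp add: S_def)
      show "\<exists>N g. openin (zar (induced (aff E) S)) N \<and> v \<in> N \<and> (\<forall>k. g k \<in> reg (induced (aff E) S) N) \<and>
          (\<forall>y\<in>N. (\<lambda>k. g k y) \<in> coord_space E \<and> (\<lambda>k. g k y) \<noteq> 0 \<and> fun_vs.span {y} = fun_vs.span {\<lambda>k. g k y})"
        if v: "v \<in> pts (induced (aff E) S)" for v
      proof (intro exI[of _ "pts (induced (aff E) S)"] exI[of _ "\<lambda>k y. y k"] conjI allI ballI openin_topspace v)
        show "(\<lambda>y. y k) \<in> reg (induced (aff E) S) (pts (induced (aff E) S))" for k
          by (rule polyfun_reg_induced_aff[OF polyfuns_var openin_topspace])
        fix y assume "y \<in> pts (induced (aff E) S)"
        then show "y \<in> coord_space E" "y \<noteq> 0"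
          by (auto simp: S_def)
      qed (rule refl)
    qed
  next
    show "fun_vs.span {\<phi> L} = L" if "L \<in> pts ?Y" for L
      using \<phi>(3) that ptsY by simp
    show "\<phi> (fun_vs.span {v}) = v" if "v \<in> pts (induced (aff E) S)" for v
      using \<psi>\<phi> that by simp
  qed
  then show ?thesis unfolding S_def .
qed

lemma proj_set_chart:
  fixes q :: "('e, 'k::field) mpoly"
  assumes i: "i \<in> E" and q: "homogeneous d q" and P: "\<And>p. p \<in> P \<Longrightarrow> \<exists>d. homogeneous d p"
  shows "isomorphic (induced (proj_space E) {L\<in>proj_set E P q. \<not> vanishes_on (mvar i :: ('e, 'k) mpoly) L})
    (induced (aff E) {v\<in>coord_space E. v i = 1 \<and> (\<forall>p\<in>P. mpoly_at p v = 0) \<and> mpoly_at q v \<noteq> 0})"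
proof -
  let ?Y = "{L\<in>proj_set E P q. \<not> vanishes_on (mvar i :: ('e, 'k) mpoly) L}"
  have "fun_vs.span {v} \<in> ?Y \<longleftrightarrow> (\<forall>p\<in>P. mpoly_at p v = 0) \<and> mpoly_at q v \<noteq> 0"
    if v: "v \<in> coord_space E" "v i = 1" for v
  proof -
    have "v \<noteq> 0" using v by auto
    then have L: "fun_vs.span {v} \<in> lines E" "v \<in> fun_vs.span {v}"
      using v span_in_lines fun_vs.span_base by auto
    have "vanishes_on p (fun_vs.span {v}) \<longleftrightarrow> mpoly_at p v = 0" if "\<exists>d. homogeneous d p" for p :: "('e, 'k) mpoly"
      using that vanishes_on_iff[OF _ L \<open>v \<noteq> 0\<close>] by blast
    then show ?thesis
      using v P q L vanishes_on_mvar[OF L \<open>v \<noteq> 0\<close>] by (auto simp: proj_set_def)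
  qed
  then have eq: "{v\<in>coord_space E. v i = 1 \<and> fun_vs.span {v} \<in> ?Y} =
      {v\<in>coord_space E. v i = 1 \<and> (\<forall>p\<in>P. mpoly_at p v = 0) \<and> mpoly_at q v \<noteq> 0}"
    by blast
  have "isomorphic (induced (proj_space E) ?Y)
      (induced (aff E) {v\<in>coord_space E. v i = 1 \<and> fun_vs.span {v} \<in> ?Y})"
    by (rule proj_chart[OF i]) (auto simp: proj_set_def)
  then show ?thesis unfolding eq .
qed

lemma quasi_affine_chart:
  fixes q :: "('e, 'k::field) mpoly"
  shows "quasi_affine E {v\<in>coord_space E. v i = 1 \<and> (\<forall>p\<in>P. mpoly_at p v = 0) \<and> mpoly_at q v \<noteq> 0}"
proof (rule quasi_affineI[of "insert (\<lambda>v. v i - 1) (mpoly_at ` P)" "mpoly_at q"])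
  show "insert (\<lambda>v. v i - 1) (mpoly_at ` P) \<subseteq> polyfuns"
    using polyfuns_diff[OF polyfuns_var[of i] polyfuns_1] by (auto simp: polyfuns_def)
qed (auto simp: polyfuns_def)

text \<open>
  The complement of a hypersurface \<open>q = 0\<close> of degree \<open>d\<close> embeds into affine space by the functions
  \<open>x\<^sub>k x\<^sub>i\<^bsup>d-1\<^esup> / q\<close>: where \<open>x\<^sub>i \<noteq> 0\<close>, the functions with fixed \<open>i\<close> are homogeneous coordinates of the point.
  An embedding as a mere subset is enough, since every subset of affine space is separated.
\<close>

lemma proj_set_embeds:
  fixes q :: "('e, 'k::field) mpoly"
  assumes q: "homogeneous d q" and d: "d > 0"
  shows "\<exists>S. isomorphic (induced (proj_space E) (proj_set E P q)) (induced (aff (E \<times> E)) S)"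
proof -
  define Y where "Y = proj_set E P q"
  let ?Y = "induced (proj_space E) Y"
  define g where "g L = (\<lambda>(i, k). if i \<in> E \<and> k \<in> E then
      mpoly_at (mvar k * mvar i ^ (d - 1)) (spanning_vector L) / mpoly_at q (spanning_vector L) else 0)"
    for L :: "('e \<Rightarrow> 'k alg_closure) set"
  have ptsY: "pts ?Y = Y"
    by (auto simp: Y_def proj_set_def)
  have YE: "L \<in> lines E" if "L \<in> Y" for L
    using that by (simp add: Y_def proj_set_def)
  have q0: "mpoly_at q (spanning_vector L) \<noteq> 0" if "L \<in> Y" for L
    using vanishes_on_iff[OF q YE[OF that] spanning_vector(1,2)[OF YE[OF that]]] that
    by (simp add: Y_def proj_set_def)
  have hom: "homogeneous d (mvar k * mvar i ^ (d - 1) :: ('e, 'k) mpoly)" for i k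
    using homogeneous_mult[OF homogeneous_mvar[of k] homogeneous_power[OF homogeneous_mvar[of i], of "d - 1"]] d
    by simp
  have g_row: "L = fun_vs.span {\<lambda>k. g L (i, k)}" "(\<lambda>k. g L (i, k)) \<in> coord_space E" "(\<lambda>k. g L (i, k)) \<noteq> 0"
    if L: "L \<in> Y" and i: "i \<in> E" "g L (i, i) \<noteq> 0" for L i
  proof -
    let ?v = "spanning_vector L"
    have "?v k = 0" if "k \<notin> E" for k
      using spanning_vector(3)[OF YE[OF L]] that by (simp add: coord_space_def)
    then have row: "(\<lambda>k. g L (i, k)) = (\<lambda>k. (?v i ^ (d - 1) / mpoly_at q ?v) * ?v k)"
      using i by (auto simp: g_def mpoly_at.hom_power fun_eq_iff)
    then show 1: "(\<lambda>k. g L (i, k)) \<in> coord_space E"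
      using \<open>\<And>k. k \<notin> E \<Longrightarrow> ?v k = 0\<close> by (simp add: coord_space_def)
    show 2: "(\<lambda>k. g L (i, k)) \<noteq> 0"
      using i(2) by (auto simp: fun_eq_iff)
    have "(\<lambda>k. g L (i, k)) \<in> L"
      unfolding row using line_eq(1)[OF YE[OF L] spanning_vector(1,2)[OF YE[OF L]]] by blast
    then show "L = fun_vs.span {\<lambda>k. g L (i, k)}"
      using line_eq_span[OF YE[OF L]] 2 by blast
  qed
  have g_diag: "\<exists>i\<in>E. g L (i, i) \<noteq> 0" if L: "L \<in> Y" for L
  proof -
    obtain i where i: "spanning_vector L i \<noteq> 0"
      using nonzero_coordinate[OF spanning_vector(2)[OF YE[OF L]]] by blast
    then have "i \<in> E"
      using spanning_vector(3)[OF YE[OF L]] by (auto simp: coord_space_def)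
    with i q0[OF L] show ?thesis
      by (intro bexI[of _ i]) (auto simp: g_def mpoly_at.hom_power)
  qed
  have inj: "inj_on g Y"
    by (rule inj_onI) (metis g_diag g_row(1))
  define h where "h = the_inv_into Y g"
  have hg: "h (g L) = L" if "L \<in> Y" for L
    unfolding h_def by (rule the_inv_into_f_f[OF inj that])
  have "isomorphic ?Y (induced (aff (E \<times> E)) (g ` Y))"
  proof (rule isomorphicI)
    show "morphism ?Y (induced (aff (E \<times> E)) (g ` Y)) g"
    proof (rule morphism_affI)
      show swf: "space_with_functions ?Y"
        by (intro space_with_functions_induced space_with_functions_proj)
      show "g L \<in> coord_space (E \<times> E) \<inter> g ` Y" if "L \<in> pts ?Y" for L
        using that ptsY by (auto simp: g_def coord_space_def)
      fix ik assume "ik \<in> E \<times> E"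
      then obtain i k where ik: "ik = (i, k)" "i \<in> E" "k \<in> E" by blast
      show "(\<lambda>L. g L ik) \<in> reg ?Y (pts ?Y)"
        using ratio_reg_proj[OF hom[of k i] q openin_topspace, of E Y] ik
        by (simp add: ptsY g_def Y_def proj_set_def del: reg_induced mpoly_at_mult)
    qed
    show "morphism (induced (aff (E \<times> E)) (g ` Y)) ?Y h"
    proof (rule morphism_projI)
      let ?S = "induced (aff (E \<times> E)) (g ` Y)"
      show "space_with_functions ?S"
        by (intro space_with_functions_induced space_with_functions_aff)
      show "h z \<in> Y" if "z \<in> pts ?S" for z
        using that hg by auto
      fix z assume z: "z \<in> pts ?S"
      then obtain L where L: "L \<in> Y" "z = g L" by auto
      obtain i where i: "i \<in> E" "z (i, i) \<noteq> 0"
        using g_diag[OF L(1)] L(2) by blast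
      let ?N = "{z\<in>coord_space (E \<times> E). z (i, i) \<noteq> 0} \<inter> g ` Y"
      have N: "openin (zar ?S) ?N"
        unfolding openin_induced by (rule exI, rule conjI[OF openin_aff_nonzero[OF polyfuns_var] refl])
      show "\<exists>N r. openin (zar ?S) N \<and> z \<in> N \<and> (\<forall>k. r k \<in> reg ?S N) \<and>
          (\<forall>y\<in>N. (\<lambda>k. r k y) \<in> coord_space E \<and> (\<lambda>k. r k y) \<noteq> 0 \<and> h y = fun_vs.span {\<lambda>k. r k y})"
      proof (intro exI[of _ ?N] exI[of _ "\<lambda>k y. y (i, k)"] conjI allI ballI N)
        show "z \<in> ?N"
          using z i by auto
        show "(\<lambda>y. y (i, k)) \<in> reg ?S ?N" for k
          by (rule polyfun_reg_induced_aff[OF polyfuns_var N])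
        fix y assume "y \<in> ?N"
        then obtain L' where L': "L' \<in> Y" "y = g L'" "g L' (i, i) \<noteq> 0" by auto
        with g_row[OF L'(1) i(1) L'(3)] hg[OF L'(1)]
        show "(\<lambda>k. y (i, k)) \<in> coord_space E" "(\<lambda>k. y (i, k)) \<noteq> 0" "h y = fun_vs.span {\<lambda>k. y (i, k)}"
          by simp_all
      qed
    qed
  qed (use hg ptsY in auto)
  then show ?thesis unfolding Y_def by blast
qed

text \<open>
  The standard charts provide the affine cover; the embedding provides the rest.
\<close>

lemma has_model_proj_set:
  fixes q :: "('e, 'k::field) mpoly"
  assumes E: "finite E" and q: "homogeneous d q" and d: "d > 0"
    and P: "\<And>p. p \<in> P \<Longrightarrow> \<exists>d. homogeneous d p"
  shows "has_model (induced (proj_space E) (proj_set E P q))"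
proof -
  define Y where "Y = proj_set E P q"
  let ?Y = "induced (proj_space E) Y"
  define C where "C i = {L\<in>Y. \<not> vanishes_on (mvar i :: ('e, 'k) mpoly) L}" for i
  have YE: "Y \<subseteq> lines E"
    by (auto simp: Y_def proj_set_def)
  have ptsY: "pts ?Y = Y"
    using YE by auto
  have sh: "sheaf_condition (proj_space E :: (_, 'k alg_closure) fspace)"
    by (intro swf_sheaf space_with_functions_proj)
  have "prevariety ?Y"
    unfolding prevariety_iff
  proof (intro conjI exI[of _ "C ` E"] ballI)
    show "sheaf_condition ?Y"
      by (rule sheaf_induced[OF sh])
    show "finite (C ` E)"
      using E by simp
    show "\<Union> (C ` E) = pts ?Y"
      unfolding ptsY
    proof (intro equalityI subsetI)
      fix L assume L: "L \<in> Y"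
      then have LE: "L \<in> lines E" using YE by blast
      obtain i where i: "spanning_vector L i \<noteq> 0"
        using nonzero_coordinate[OF spanning_vector(2)[OF LE]] by blast
      then have "i \<in> E"
        using spanning_vector(3)[OF LE] by (auto simp: coord_space_def)
      with i L vanishes_on_mvar[OF LE spanning_vector(1,2)[OF LE]] show "L \<in> \<Union> (C ` E)"
        by (auto simp: C_def)
    qed (auto simp: C_def)
    fix U assume "U \<in> C ` E"
    then obtain i where i: "i \<in> E" "U = C i" by blast
    show "openin (zar ?Y) U"
      unfolding openin_induced i(2) C_def
      using openin_proj_nonzero[OF homogeneous_mvar[of i]] YE by blast
    have "is_affine (induced (proj_space E) (C i))"
      unfolding C_def Y_def
      by (rule is_affine_isomorphic[OF proj_set_chart[OF i(1) q P] quasi_affine_is_affine[OF E quasi_affine_chart]])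
    moreover have "C i \<subseteq> Y"
      by (auto simp: C_def)
    ultimately show "is_affine (induced ?Y U)"
      using is_affine_isomorphic[OF isomorphic_induced_induced[OF sh]] i(2) by blast
  qed
  moreover obtain S where "isomorphic ?Y (induced (aff (E \<times> E)) S)"
    using proj_set_embeds[OF q d] unfolding Y_def by blast
  ultimately have "has_model ?Y"
    using E by (intro has_modelI[of ?Y "E \<times> E" S]) auto
  then show ?thesis unfolding Y_def .
qed

lemma K0_class_proj_set_split:
  fixes q :: "('e, 'k::field) mpoly"
  assumes E: "finite E" and q: "homogeneous d q" and d: "d > 0"
    and P: "\<And>p. p \<in> P \<Longrightarrow> \<exists>d. homogeneous d p" and i: "i \<in> E"
  shows "K0_class (induced (proj_space E) (proj_set E P q)) =
    aff_class E {v\<in>coord_space E. v i = 1 \<and> (\<forall>p\<in>P. mpoly_at p v = 0) \<and> mpoly_at q v \<noteq> 0} +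
    K0_class (induced (proj_space E) (proj_set E (insert (mvar i) P) q))"
proof -
  define Y where "Y = proj_set E P q"
  let ?P = "proj_space E :: (_, 'k alg_closure) fspace"
  let ?Y = "induced ?P Y"
  define C where "C = proj_set E (insert (mvar i) P) q"
  define U where "U = {L\<in>Y. \<not> vanishes_on (mvar i :: ('e, 'k) mpoly) L}"
  have YE: "Y \<subseteq> lines E" and CY: "C \<subseteq> Y" and UY: "U \<subseteq> Y"
    by (auto simp: Y_def C_def U_def proj_set_def)
  have ptsY: "pts ?Y = Y"
    using YE by auto
  have diff: "pts ?Y - C = U" and CU: "C = Y - U"
    using YE unfolding ptsY by (auto simp: Y_def C_def U_def proj_set_def)
  have sh: "sheaf_condition ?P"
    by (intro swf_sheaf space_with_functions_proj)
  have chart: "isomorphic (induced ?P U)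
      (induced (aff E) {v\<in>coord_space E. v i = 1 \<and> (\<forall>p\<in>P. mpoly_at p v = 0) \<and> mpoly_at q v \<noteq> 0})"
    unfolding U_def Y_def by (rule proj_set_chart[OF i q P])
  have mU: "has_model (induced ?P U)"
    by (rule has_model_isomorphic[OF has_model_quasi_affine[OF E quasi_affine_chart] isomorphic_sym[OF chart]])
  have mC: "has_model (induced ?P C)"
    unfolding C_def
  proof (rule has_model_proj_set[OF E q d])
    show "\<exists>d. homogeneous d p" if "p \<in> insert (mvar i) P" for p
      using that P homogeneous_mvar[of i] by (elim insertE) (simp only:, rule exI)
  qed
  have isoC: "isomorphic (induced ?P C) (induced ?Y C)" and isoU: "isomorphic (induced ?P U) (induced ?Y U)"
    by (intro isomorphic_sym[OF isomorphic_induced_induced[OF sh]] CY UY)+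
  have "openin (zar ?Y) U"
    unfolding openin_induced U_def using openin_proj_nonzero[OF homogeneous_mvar[of i]] YE by blast
  then have "closedin (zar ?Y) C"
    unfolding closedin_def using CY ptsY CU diff by simp
  moreover have "has_model ?Y"
    unfolding Y_def by (rule has_model_proj_set[OF E q d P])
  ultimately have "K0_class ?Y = K0_class (induced ?Y C) + K0_class (induced ?Y U)"
    using K0_class_split[of ?Y C] has_model_isomorphic[OF mC isoC] has_model_isomorphic[OF mU isoU] diff by simp
  then show ?thesis
    using K0_class_cong[OF mC isoC] K0_class_cong[OF mU isoU] K0_class_cong[OF mU chart]
    by (simp add: Y_def C_def aff_class_def add.commute)
qed

text \<open>
  The empty set is a closed subset of itself with empty complement, so its class is twice itself.
\<close>

lemma K0_class_empty:
  assumes "has_model (induced A {})"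
  shows "K0_class (induced A {}) = 0"
proof -
  let ?A = "induced A {}"
  have "isomorphic ?A (induced ?A {})"
    by (rule isomorphicI[of _ _ "\<lambda>x. x" "\<lambda>x. x"])
      (auto intro!: morphismI simp: openin_induced locally_regular_def)
  from has_model_isomorphic[OF assms this] K0_class_cong[OF assms this] K0_class_split[OF assms, of "{}"] assms
  show ?thesis by simp
qed

text \<open>
  Sorting the points by the first of the coordinates \<open>x\<^sub>i\<close>, \<open>i \<in> is\<close>, that does not vanish there cuts
  the complement of a hypersurface into quasi-affine pieces, provided that it contains no point where
  all of these coordinates vanish.
\<close>

lemma K0_class_proj_set_strata:
  fixes q :: "('e, 'k::field) mpoly"
  assumes E: "finite E" and q: "homogeneous d q" and d: "d > 0"
    and "\<And>p. p \<in> P \<Longrightarrow> \<exists>d. homogeneous d p" and "set is \<subseteq> E"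
    and "\<And>v. v \<in> coord_space E \<Longrightarrow> (\<And>i. i \<in> set is \<Longrightarrow> v i = 0) \<Longrightarrow> (\<And>p. p \<in> P \<Longrightarrow> mpoly_at p v = 0) \<Longrightarrow>
      mpoly_at q v = 0"
  shows "K0_class (induced (proj_space E) (proj_set E P q)) =
    (\<Sum>n<length is. aff_class E {v\<in>coord_space E. v (is ! n) = 1 \<and> (\<forall>j\<in>set (take n is). v j = 0) \<and>
       (\<forall>p\<in>P. mpoly_at p v = 0) \<and> mpoly_at q v \<noteq> 0})"
  using assms(4-)
proof (induction "is" arbitrary: P)
  case Nil
  have "L \<notin> proj_set E P q" for L
  proof
    assume L: "L \<in> proj_set E P q"
    then have LE: "L \<in> lines E" by (simp add: proj_set_def)
    note sv = spanning_vector[OF LE]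
    have "mpoly_at p (spanning_vector L) = 0" if "p \<in> P" for p
      using L that sv(1) by (auto simp: proj_set_def vanishes_on_def)
    with Nil.prems(3)[OF sv(3)] have "mpoly_at q (spanning_vector L) = 0"
      by simp
    with vanishes_on_iff[OF q LE sv(1,2)] L show False
      by (simp add: proj_set_def)
  qed
  then have "proj_set E P q = {}" by blast
  then show ?case
    using K0_class_empty[of "proj_space E"] has_model_proj_set[OF E q d, of P] Nil.prems(1) by simp
next
  case (Cons i "is")
  have i: "i \<in> E" and "is": "set is \<subseteq> E"
    using Cons.prems(2) by auto
  have P': "\<exists>d. homogeneous d p" if "p \<in> insert (mvar i) P" for p
    using that Cons.prems(1) homogeneous_mvar[of i] by (elim insertE) (simp only:, rule exI)
  have IH: "K0_class (induced (proj_space E) (proj_set E (insert (mvar i) P) q)) =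
    (\<Sum>n<length is. aff_class E {v\<in>coord_space E. v (is ! n) = 1 \<and> (\<forall>j\<in>set (take n is). v j = 0) \<and>
       (\<forall>p\<in>insert (mvar i) P. mpoly_at p v = 0) \<and> mpoly_at q v \<noteq> 0})"
    by (rule Cons.IH[OF P' "is"]) (use Cons.prems(3) in force)+
  have eq: "{v\<in>coord_space E. v (is ! n) = 1 \<and> (\<forall>j\<in>set (take n is). v j = 0) \<and>
       (\<forall>p\<in>insert (mvar i) P. mpoly_at p v = 0) \<and> mpoly_at q v \<noteq> 0} =
     {v\<in>coord_space E. v ((i # is) ! Suc n) = 1 \<and> (\<forall>j\<in>set (take (Suc n) (i # is)). v j = 0) \<and>
       (\<forall>p\<in>P. mpoly_at p v = 0) \<and> mpoly_at q v \<noteq> 0}" for n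
    by auto
  have "K0_class (induced (proj_space E) (proj_set E P q)) =
    aff_class E {v\<in>coord_space E. v i = 1 \<and> (\<forall>p\<in>P. mpoly_at p v = 0) \<and> mpoly_at q v \<noteq> 0} +
    K0_class (induced (proj_space E) (proj_set E (insert (mvar i) P) q))"
    by (rule K0_class_proj_set_split[OF E q d _ i]) (rule Cons.prems(1))
  then show ?case
    unfolding IH eq by (simp add: sum.lessThan_Suc_shift del: sum.lessThan_Suc)
qed

section \<open>Computation modulo the torus\<close>

lemma torus_multiple: "torus_class * a \<in> ideal_generated {torus_class}"
  using ideal_generated_mult[of torus_class "{torus_class}" a]
  by (simp add: ideal_generated_incl mult.commute)

lemma ideal_generated_sum: "(\<And>x. x \<in> S \<Longrightarrow> f x \<in> ideal_generated I) \<Longrightarrow> sum f S \<in> ideal_generated I"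
  by (induction S rule: infinite_finite_induct) (auto intro: ideal_generated_0 ideal_generated_add)

lemma coord_space_insert_upd:
  "v \<in> coord_space (insert t J) \<Longrightarrow> v(t := x) \<in> coord_space (insert t J)"
  by (auto simp: coord_space_def)

lemma coord_space_upd_0: "v \<in> coord_space (insert t J) \<Longrightarrow> t \<notin> J \<Longrightarrow> v(t := 0) \<in> coord_space J"
  by (auto simp: coord_space_def)

text \<open>
  Where \<open>G \<noteq> 0\<close>, the substitution \<open>x\<^sub>t \<mapsto> x\<^sub>t G + H\<close> is an automorphism over the remaining coordinates.
  It turns the condition \<open>x\<^sub>t G + H \<noteq> 0\<close> into \<open>x\<^sub>t \<noteq> 0\<close>, that is, into a factor \<open>G\<^sub>m\<close>.
\<close>

lemma aff_class_affine_linear_nonzero: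
  fixes S :: "('i \<Rightarrow> 'k::field alg_closure) set"
  assumes J: "finite J" and S: "quasi_affine J S" and t: "t \<notin> J"
    and G: "G \<in> polyfuns" "\<And>v x. G (v(t := x)) = G v" "\<And>v. v \<in> S \<Longrightarrow> G v \<noteq> 0"
    and H: "H \<in> polyfuns" "\<And>v x. H (v(t := x)) = H v"
  shows "aff_class (insert t J) {v\<in>coord_space (insert t J). v t * G v + H v \<noteq> 0 \<and> v(t := 0) \<in> S} =
    torus_class * aff_class J S"
proof -
  define R where "R = {v\<in>coord_space (insert t J). v t * G v + H v \<noteq> 0 \<and> v(t := 0) \<in> S}"
  define R' where "R' = {v\<in>coord_space (insert t J). v t \<noteq> 0 \<and> v(t := 0) \<in> S}"
  define \<phi> where "\<phi> v = v(t := v t * G v + H v)" for v :: "'i \<Rightarrow> 'k alg_closure"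
  define \<psi> where "\<psi> v = v(t := (v t - H v) / G v)" for v :: "'i \<Rightarrow> 'k alg_closure"
  have nz: "G v \<noteq> 0" if "v(t := 0) \<in> S" for v
    using G(3)[OF that] G(2)[of v 0] by simp
  have cyl: "quasi_affine (insert t J) {v\<in>coord_space (insert t J). v(t := 0) \<in> S}"
    by (rule quasi_affine_cylinder[OF S t])
  have "R = {v\<in>{v\<in>coord_space (insert t J). v(t := 0) \<in> S}. v t * G v + H v \<noteq> 0}"
    by (auto simp: R_def)
  then have qa: "quasi_affine (insert t J) R"
    using quasi_affine_nonzero[OF cyl, of "\<lambda>v. v t * G v + H v"] G(1) H(1)
    by (simp add: polyfuns_intros)
  have \<phi>: "\<phi> v \<in> R'" if "v \<in> R" for v
    using that by (auto simp: R_def R'_def \<phi>_def intro: coord_space_insert_upd)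
  have \<psi>: "\<psi> v \<in> R" if "v \<in> R'" for v
    using that nz[of v] by (auto simp: R_def R'_def \<psi>_def G(2) H(2) intro: coord_space_insert_upd)
  have "isomorphic (induced (aff (insert t J)) R) (induced (aff (insert t J)) R')"
  proof (rule isomorphicI)
    show "morphism (induced (aff (insert t J)) R) (induced (aff (insert t J)) R') \<phi>"
    proof (rule morphism_aff_affI)
      show "\<phi> v \<in> coord_space (insert t J) \<inter> R'" if "v \<in> R" for v
        using \<phi>[OF that] by (auto simp: R'_def)
      show "(\<lambda>v. \<phi> v j) \<in> aff_fractions (coord_space (insert t J) \<inter> R)" for j
      proof (cases "j = t")
        case True
        moreover have "(\<lambda>v. v t * G v + H v) \<in> polyfuns"
          by (intro polyfuns_add polyfuns_mult polyfuns_var G(1) H(1))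
        ultimately show ?thesis
          by (intro polyfun_in_aff_fractions[of "\<lambda>v. v t * G v + H v"]) (auto simp: \<phi>_def)
      next
        case False
        then show ?thesis
          by (intro polyfun_in_aff_fractions[OF polyfuns_var[of j]]) (auto simp: \<phi>_def)
      qed
    qed
    show "morphism (induced (aff (insert t J)) R') (induced (aff (insert t J)) R) \<psi>"
    proof (rule morphism_aff_affI)
      show "\<psi> v \<in> coord_space (insert t J) \<inter> R" if "v \<in> R'" for v
        using \<psi>[OF that] by (auto simp: R_def)
      show "(\<lambda>v. \<psi> v j) \<in> aff_fractions (coord_space (insert t J) \<inter> R')" for j
      proof (cases "j = t")
        case True
        have "(\<lambda>v. v t - H v) \<in> polyfuns"
          by (intro polyfuns_diff polyfuns_var H(1))
        with True show ?thesis
          by (intro aff_fractionsI[of "\<lambda>v. v t - H v" G]) (auto simp: \<psi>_def R'_def nz G(1))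
      next
        case False
        then show ?thesis
          by (intro polyfun_in_aff_fractions[OF polyfuns_var[of j]]) (auto simp: \<psi>_def)
      qed
    qed
  next
    show "\<psi> (\<phi> v) = v" if "v \<in> pts (induced (aff (insert t J)) R)" for v
      using that nz[of v] by (simp add: \<psi>_def \<phi>_def G(2) H(2) R_def)
    show "\<phi> (\<psi> v) = v" if "v \<in> pts (induced (aff (insert t J)) R')" for v
      using that nz[of v] by (simp add: \<psi>_def \<phi>_def G(2) H(2) R'_def)
  qed
  from aff_class_cong[OF _ qa this] J aff_class_times_Gm[OF J S t] show ?thesis
    by (simp add: R_def R'_def)
qed

text \<open>
  The identity on one stratum.  Modulo \<open>T\<close>, a factor \<open>G\<^sub>m\<close> kills a class and a factor \<open>A\<^sup>1\<close> preserves it.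
  The part \<open>G \<noteq> 0\<close> of the first set and the part \<open>D = 0\<close> of the second have a factor \<open>G\<^sub>m\<close>.  The part
  \<open>G = 0\<close> of the first set is an \<open>A\<^sup>1\<close> times \<open>C = {G = 0, D \<noteq> 0}\<close>, and \<open>C\<close> together with the part \<open>D \<noteq> 0\<close>
  of the second set is an \<open>A\<^sup>1\<close> times the third set.
\<close>

lemma series_identity_affine:
  fixes B :: "('i \<Rightarrow> 'k::field alg_closure) set" and a :: 'k
  assumes J: "finite J" and B: "quasi_affine J B" and e: "e \<notin> J" and f: "f \<notin> J" and ef: "e \<noteq> f"
    and a: "a \<noteq> 0"
    and poly: "G \<in> polyfuns" "D \<in> polyfuns" "H \<in> polyfuns"
    and G: "\<And>v. G v = D v + v f * H v" "\<And>v x. G (v(e := x)) = G v"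
    and D: "\<And>v x. D (v(e := x)) = D v" "\<And>v x. D (v(f := x)) = D v"
    and H: "\<And>v x. H (v(f := x)) = H v"
  shows "aff_class (insert e (insert f J)) {v\<in>coord_space (insert e (insert f J)).
        v(e := 0, f := 0) \<in> B \<and> v e * G v + to_ac a * v f * D v \<noteq> 0}
     + aff_class (insert f J) {v\<in>coord_space (insert f J). v(f := 0) \<in> B \<and> G v \<noteq> 0}
     - aff_class J {v\<in>B. D v \<noteq> 0} \<in> ideal_generated {torus_class}"
proof -
  define F where "F v = v e * G v + to_ac a * v f * D v" for v
  have F: "F \<in> polyfuns"
    unfolding F_def by (intro polyfuns_add polyfuns_mult polyfuns_var polyfuns_const poly)
  have H': "(\<lambda>v. to_ac a * v f * D v) \<in> polyfuns"
    by (intro polyfuns_mult polyfuns_var polyfuns_const poly)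
  define cyl where "cyl = {v\<in>coord_space (insert f J). v(f := 0) \<in> B}"
  have cyl: "quasi_affine (insert f J) cyl"
    unfolding cyl_def by (rule quasi_affine_cylinder[OF B f])
  define S1 where "S1 = {v\<in>coord_space (insert e (insert f J)). v(e := 0, f := 0) \<in> B \<and> F v \<noteq> 0}"
  define S2 where "S2 = {v\<in>cyl. G v \<noteq> 0}"
  define S3 where "S3 = {v\<in>B. D v \<noteq> 0}"
  define C where "C = {v\<in>{v\<in>cyl. D v \<noteq> 0}. G v = 0}"
  define B0 where "B0 = {v\<in>{v\<in>B. D v = 0}. H v \<noteq> 0}"
  have e': "e \<notin> insert f J" using e ef by simp
  have fin: "finite (insert f J)" "finite (insert e (insert f J))" using J by auto
  have S2: "quasi_affine (insert f J) S2" and S3: "quasi_affine J S3" and C: "quasi_affine (insert f J) C"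
    and B0: "quasi_affine J B0"
    unfolding S2_def S3_def C_def B0_def
    by (intro quasi_affine_nonzero quasi_affine_zero cyl B poly)+
  have BJ: "B \<subseteq> coord_space J"
    by (rule quasi_affine_subset[OF B])
  have S1_eq: "S1 = {v\<in>{v\<in>coord_space (insert e (insert f J)). v(e := 0) \<in> cyl}. F v \<noteq> 0}"
    using coord_space_upd_0[OF _ e'] by (auto simp: S1_def cyl_def)
  then have S1: "quasi_affine (insert e (insert f J)) S1"
    using quasi_affine_nonzero[OF quasi_affine_cylinder[OF cyl e'] F] by simp
  have "{v\<in>S1. G v \<noteq> 0} = {v\<in>coord_space (insert e (insert f J)).
      v e * G v + to_ac a * v f * D v \<noteq> 0 \<and> v(e := 0) \<in> S2}"
    unfolding S1_eq S2_def F_def by (auto simp: G(2))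
  then have S1_nz: "aff_class (insert e (insert f J)) {v\<in>S1. G v \<noteq> 0} = torus_class * aff_class (insert f J) S2"
    using aff_class_affine_linear_nonzero[OF fin(1) S2 e' poly(1) G(2) _ H'] ef
    by (simp add: D(1) S2_def)
  have "{v\<in>S1. G v = 0} = {v\<in>coord_space (insert e (insert f J)). v(e := 0) \<in> C}"
  proof -
    have "F v \<noteq> 0 \<longleftrightarrow> D v \<noteq> 0" if "G v = 0" for v
      using that a G(1)[of v] by (auto simp: F_def)
    then show ?thesis
      unfolding S1_eq C_def by (auto simp: G(2) D(1))
  qed
  then have S1_z: "aff_class (insert e (insert f J)) {v\<in>S1. G v = 0} =
      torus_class * aff_class (insert f J) C + aff_class (insert f J) C"
    using aff_class_cylinder[OF fin(1) C e'] by simp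
  have "{v\<in>S2. D v = 0} = {v\<in>coord_space (insert f J). v f \<noteq> 0 \<and> v(f := 0) \<in> B0}"
    unfolding S2_def cyl_def B0_def by (auto simp: D(2) H G(1))
  then have S2_z: "aff_class (insert f J) {v\<in>S2. D v = 0} = torus_class * aff_class J B0"
    using aff_class_times_Gm[OF J B0 f] by simp
  let ?U = "{v\<in>coord_space (insert f J). v(f := 0) \<in> S3}"
  have "{v\<in>?U. G v = 0} = C" "{v\<in>?U. G v \<noteq> 0} = {v\<in>S2. D v \<noteq> 0}"
    unfolding S2_def S3_def C_def cyl_def by (auto simp: D(2))
  then have U: "torus_class * aff_class J S3 + aff_class J S3 =
      aff_class (insert f J) C + aff_class (insert f J) {v\<in>S2. D v \<noteq> 0}"
    using aff_class_split[OF fin(1) quasi_affine_cylinder[OF S3 f] poly(1)] aff_class_cylinder[OF J S3 f]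
    by simp
  have "aff_class (insert e (insert f J)) S1 + aff_class (insert f J) S2 - aff_class J S3 =
      torus_class * aff_class (insert f J) S2 + torus_class * aff_class (insert f J) C
      + torus_class * aff_class J B0
      + (aff_class (insert f J) C + aff_class (insert f J) {v\<in>S2. D v \<noteq> 0}) - aff_class J S3"
    using aff_class_split[OF fin(2) S1 poly(1)] aff_class_split[OF fin(1) S2 poly(2)] S1_nz S1_z S2_z
    by (simp add: algebra_simps)
  also have "\<dots> = torus_class * (aff_class (insert f J) S2 + aff_class (insert f J) C + aff_class J B0 + aff_class J S3)"
    unfolding U[symmetric] by (simp add: algebra_simps)
  finally show ?thesis
    using torus_multiple by (simp add: S1_def S2_def S3_def cyl_def F_def conj_assoc)
qed

section \<open>Bordered determinants\<close>

definition bordered :: "nat \<Rightarrow> 'a \<Rightarrow> (nat \<Rightarrow> 'a) \<Rightarrow> (nat \<Rightarrow> 'a) \<Rightarrow> (nat \<Rightarrow> nat \<Rightarrow> 'a) \<Rightarrow> 'a mat" where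
  "bordered n a b c B = mat (Suc n) (Suc n) (\<lambda>(i, j). case i of
     0 \<Rightarrow> (case j of 0 \<Rightarrow> a | Suc j \<Rightarrow> b j)
   | Suc i \<Rightarrow> (case j of 0 \<Rightarrow> c i | Suc j \<Rightarrow> B i j))"

lemma bordered_carrier: "bordered n a b c B \<in> carrier_mat (Suc n) (Suc n)"
  by (simp add: bordered_def)

lemma bordered_four_block:
  "bordered n a b c B = four_block_mat (mat 1 1 (\<lambda>_. a)) (mat 1 n (\<lambda>(_, j). b j))
     (mat n 1 (\<lambda>(i, _). c i)) (mat n n (\<lambda>(i, j). B i j))"
  by (rule eq_matI) (auto simp: bordered_def split: nat.splits)

lemma det_bordered_upper_zero:
  fixes a :: "'a::idom"
  shows "det (bordered n a (\<lambda>_. 0) c B) = a * det (mat n n (\<lambda>(i, j). B i j))"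
  unfolding bordered_four_block
  by (subst det_four_block_mat_upper_right_zero[where n = 1 and m = n])
    (auto simp: det_single intro!: eq_matI)

lemma det_bordered_lower_zero:
  fixes a :: "'a::idom"
  shows "det (bordered n a b (\<lambda>_. 0) B) = a * det (mat n n (\<lambda>(i, j). B i j))"
  unfolding bordered_four_block
  by (subst det_four_block_mat_lower_left_zero[where n = 1 and m = n])
    (auto simp: det_single intro!: eq_matI)

text \<open>Column \<open>t i * a\<close> is cleared with the first row; the other entries change by a rank-one matrix.\<close>

lemma det_bordered_eliminate:
  fixes a :: "'a::idom"
  shows "det (bordered n a b (\<lambda>i. t i * a) B) = a * det (mat n n (\<lambda>(i, j). B i j - t i * b j))"
proof -
  let ?L = "bordered n 1 (\<lambda>_. 0) t (\<lambda>i j. if i = j then 1 else 0)"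
  let ?R = "bordered n a b (\<lambda>_. 0) (\<lambda>i j. B i j - t i * b j)"
  have "bordered n a b (\<lambda>i. t i * a) B = ?L * ?R"
  proof (rule eq_matI)
    fix i j assume "i < dim_row (?L * ?R)" "j < dim_col (?L * ?R)"
    then have ij: "i < Suc n" "j < Suc n"
      by (simp_all add: bordered_def)
    have "(?L * ?R) $$ (i, j) = (\<Sum>k<Suc n. ?L $$ (i, k) * ?R $$ (k, j))"
      using ij by (simp add: bordered_def scalar_prod_def atLeast0LessThan del: sum.lessThan_Suc)
    also have "\<dots> = ?L $$ (i, 0) * ?R $$ (0, j) + (\<Sum>k<n. ?L $$ (i, Suc k) * ?R $$ (Suc k, j))"
      by (rule sum.lessThan_Suc_shift)
    also have "\<dots> = bordered n a b (\<lambda>i. t i * a) B $$ (i, j)"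
    proof (cases i)
      case 0
      with ij show ?thesis
        by (simp add: bordered_def)
    next
      case (Suc i')
      have "?L $$ (i, Suc k) * ?R $$ (Suc k, j) = (if k = i' then ?R $$ (i, j) else 0)" if "k < n" for k
        using that ij Suc by (cases "k = i'") (simp_all add: bordered_def)
      then have "(\<Sum>k<n. ?L $$ (i, Suc k) * ?R $$ (Suc k, j)) = ?R $$ (i, j)"
        using ij Suc by simp
      then show ?thesis
        using ij Suc by (simp add: bordered_def split: nat.splits)
    qed
    finally show "bordered n a b (\<lambda>i. t i * a) B $$ (i, j) = (?L * ?R) $$ (i, j)" ..
  qed (simp_all add: bordered_def)
  then have "det (bordered n a b (\<lambda>i. t i * a) B) = det ?L * det ?R"
    using det_mult[OF bordered_carrier bordered_carrier] by simp
  moreover have "mat n n (\<lambda>(i, j). if i = j then 1 else 0) = (1\<^sub>m n :: 'a mat)"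
    by (rule eq_matI) auto
  ultimately show ?thesis
    by (simp add: det_bordered_upper_zero det_bordered_lower_zero)
qed

lemma det_bordered_row_linear:
  fixes a :: "'a::comm_ring_1"
  shows "det (bordered n (x * a + y * a') (\<lambda>j. x * b j + y * b' j) c B) =
    x * det (bordered n a b c B) + y * det (bordered n a' b' c B)"
proof -
  have cof: "cofactor (bordered n a b c B) 0 j = cofactor (bordered n a' b' c B) 0 j"
    for a a' :: 'a and b b' j
  proof -
    have "mat_delete (bordered n a b c B) 0 j = mat_delete (bordered n a' b' c B) 0 j"
      by (rule eq_matI) (auto simp: mat_delete_def bordered_def)
    then show ?thesis
      by (simp add: cofactor_def)
  qed
  let ?C = "\<lambda>j. cofactor (bordered n 0 (\<lambda>_. 0) c B) 0 j"
  have lap: "det (bordered n a b c B) = (\<Sum>j<Suc n. (case j of 0 \<Rightarrow> a | Suc j \<Rightarrow> b j) * ?C j)"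
    for a :: 'a and b
    unfolding laplace_expansion_row[OF bordered_carrier zero_less_Suc]
  proof (rule sum.cong[OF refl])
    fix j assume "j \<in> {..<Suc n}"
    then have "bordered n a b c B $$ (0, j) = (case j of 0 \<Rightarrow> a | Suc j \<Rightarrow> b j)"
      by (simp add: bordered_def)
    then show "bordered n a b c B $$ (0, j) * cofactor (bordered n a b c B) 0 j =
        (case j of 0 \<Rightarrow> a | Suc j \<Rightarrow> b j) * ?C j"
      using cof[of a b j 0 "\<lambda>_. 0"] by simp
  qed
  show ?thesis
    unfolding lap sum_distrib_left sum.distrib[symmetric]
    by (rule sum.cong) (auto simp: algebra_simps split: nat.split)
qed

text \<open>
  The perturbed determinant arises by elimination from a matrix in which the parameter \<open>x\<close> occurs in a
  single row only, hence it is affine-linear in \<open>x\<close>.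
\<close>

lemma det_rank_one_affine:
  fixes x :: "'a::idom"
  shows "det (mat n n (\<lambda>(i, j). B i j + x * (u i * u j))) =
    det (mat n n (\<lambda>(i, j). B i j)) +
      x * (det (mat n n (\<lambda>(i, j). B i j + u i * u j)) - det (mat n n (\<lambda>(i, j). B i j)))"
proof -
  have el: "det (bordered n 1 (\<lambda>j. - (y * u j)) u B) = det (mat n n (\<lambda>(i, j). B i j + y * (u i * u j)))" for y
    using det_bordered_eliminate[of n 1 "\<lambda>j. - (y * u j)" u B] by (simp add: mult.left_commute)
  have "det (bordered n 1 (\<lambda>j. - (x * u j)) u B) =
      (1 - x) * det (bordered n 1 (\<lambda>_. 0) u B) + x * det (bordered n 1 (\<lambda>j. - u j) u B)"
    using det_bordered_row_linear[of n "1 - x" 1 x 1 "\<lambda>_. 0" "\<lambda>j. - u j" u B] by simp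
  then show ?thesis
    using el[of x] el[of 0] el[of 1] by (simp add: algebra_simps)
qed

text \<open>
  Write the first row as \<open>x (1, 0) + y (c\<^sup>2, c u)\<close>.  The first summand leaves the determinant of the
  perturbed block; in the second, elimination with the first row removes the perturbation.
\<close>

lemma det_series:
  fixes c :: "'a::field"
  assumes c: "c \<noteq> 0"
  shows "det (bordered n (x + c * c * y) (\<lambda>j. c * y * u j) (\<lambda>i. c * y * u i) (\<lambda>i j. B i j + y * (u i * u j))) =
    x * det (mat n n (\<lambda>(i, j). B i j + y * (u i * u j))) + c * c * y * det (mat n n (\<lambda>(i, j). B i j))"
proof -
  let ?g = "\<lambda>i. c * y * u i" and ?B = "\<lambda>i j. B i j + y * (u i * u j)"
  have row1: "x + c * c * y = x * 1 + y * (c * c)"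
    by (simp add: mult.commute)
  have row2: "(\<lambda>j. c * y * u j) = (\<lambda>j. x * 0 + y * (c * u j))"
    by (rule ext) (simp add: ac_simps)
  have "det (bordered n (x + c * c * y) (\<lambda>j. c * y * u j) ?g ?B) =
      x * det (bordered n 1 (\<lambda>_. 0) ?g ?B) + y * det (bordered n (c * c) (\<lambda>j. c * u j) ?g ?B)"
    using det_bordered_row_linear[of n x 1 y "c * c" "\<lambda>_. 0" "\<lambda>j. c * u j" ?g ?B]
    unfolding row1[symmetric] row2[symmetric] .
  moreover have "det (bordered n (c * c) (\<lambda>j. c * u j) ?g ?B) = c * c * det (mat n n (\<lambda>(i, j). B i j))"
  proof -
    have "c * y * u i = (y * u i / c) * (c * c)" "?B i j - (y * u i / c) * (c * u j) = B i j" for i j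
      using c by (simp_all add: field_simps)
    then show ?thesis
      using det_bordered_eliminate[of n "c * c" "\<lambda>j. c * u j" "\<lambda>i. y * u i / c" ?B] by simp
  qed
  ultimately show ?thesis
    by (simp only: det_bordered_upper_zero mult_1_left mult.assoc mult.left_commute[of y])
qed

section \<open>Configuration polynomials\<close>

definition form_det :: "'e set \<Rightarrow> ('e \<Rightarrow> 'k::field) list \<Rightarrow> ('e, 'k) mpoly" where
  "form_det E bs = det (mat (length bs) (length bs) (\<lambda>(i, j). config_form E (bs ! i) (bs ! j)))"

definition form_at :: "'e set \<Rightarrow> ('e \<Rightarrow> 'k::field alg_closure) \<Rightarrow> ('e \<Rightarrow> 'k) \<Rightarrow> ('e \<Rightarrow> 'k) \<Rightarrow> 'k alg_closure" where
  "form_at E v w w' = (\<Sum>e\<in>E. to_ac (w e * w' e) * v e)"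

lemma mpoly_at_form_det:
  "mpoly_at (form_det E bs) v = det (mat (length bs) (length bs) (\<lambda>(i, j). form_at E v (bs ! i) (bs ! j)))"
proof -
  have "map_mat (\<lambda>p. mpoly_at p v) (mat (length bs) (length bs) (\<lambda>(i, j). config_form E (bs ! i) (bs ! j))) =
      mat (length bs) (length bs) (\<lambda>(i, j). form_at E v (bs ! i) (bs ! j))"
    by (rule eq_matI) (auto simp: config_form_def form_at_def)
  then show ?thesis
    unfolding form_det_def by (metis mpoly_at.hom_det)
qed

lemma homogeneous_form_det: "homogeneous (length bs) (form_det E bs)"
proof -
  let ?n = "length bs" and ?f = "\<lambda>i j. config_form E (bs ! i) (bs ! j)"
  have f: "homogeneous 1 (?f i j)" for i j
    unfolding config_form_def
    using homogeneous_mult[OF homogeneous_const homogeneous_mvar] by (intro homogeneous_sum) simp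
  have "homogeneous ?n (signof p * (\<Prod>i = 0..<?n. ?f i (p i)))" for p
  proof -
    have "homogeneous 0 (signof p :: ('a, 'b) mpoly)"
      using homogeneous_const[of "- 1 :: 'b"] homogeneous_1
      by (cases "sign p = 1") (auto simp: sign_def single_uminus)
    from homogeneous_mult[OF this, of ?n] homogeneous_prod[of "{0..<?n}" "\<lambda>i. ?f i (p i)", OF f]
    show ?thesis by simp
  qed
  then have "homogeneous ?n (\<Sum>p | p permutes {0..<?n}. signof p * (\<Prod>i = 0..<?n. ?f i (p i)))"
    by (rule homogeneous_sum)
  moreover have "(\<Prod>i = 0..<?n. mat ?n ?n (\<lambda>(i, j). ?f i j) $$ (i, p i)) = (\<Prod>i = 0..<?n. ?f i (p i))"
    if "p permutes {0..<?n}" for p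
  proof (rule prod.cong)
    fix i assume i: "i \<in> {0..<?n}"
    then have "p i \<in> {0..<?n}"
      using permutes_in_image[OF that] by blast
    with i show "mat ?n ?n (\<lambda>(i, j). ?f i j) $$ (i, p i) = ?f i (p i)"
      by simp
  qed simp
  ultimately show ?thesis
    unfolding form_det_def det_def by simp
qed

lemma basis_list_exists:
  fixes W :: "('e \<Rightarrow> 'k::field) set"
  assumes E: "finite E" and W: "configuration E W"
  shows "\<exists>bs. is_basis_list W bs"
proof -
  obtain B where B: "B \<subseteq> W" "fun_vs.independent B" "W \<subseteq> fun_vs.span B"
    using fun_vs.basis_exists[of W] by metis
  define d where "d = (\<lambda>(e :: 'e) i. if i = e then 1 else 0 :: 'k)"
  have "coord_space E \<subseteq> fun_vs.span (d ` E)"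
  proof
    fix v :: "'e \<Rightarrow> 'k" assume v: "v \<in> coord_space E"
    have "v = (\<Sum>e\<in>E. (\<lambda>i. v e * d e i))"
    proof
      fix i
      have "(\<Sum>e\<in>E. (\<lambda>i. v e * d e i)) i = (\<Sum>e\<in>E. v e * d e i)"
        by (induction E rule: infinite_finite_induct) auto
      also have "\<dots> = v i"
        using v E by (auto simp: d_def coord_space_def if_distrib[of "(*) _"] cong: if_cong)
      finally show "v i = (\<Sum>e\<in>E. (\<lambda>i. v e * d e i)) i" ..
    qed
    also have "\<dots> \<in> fun_vs.span (d ` E)"
      by (intro fun_vs.span_sum fun_vs.span_scale fun_vs.span_base) auto
    finally show "v \<in> fun_vs.span (d ` E)" .
  qed
  then have "B \<subseteq> fun_vs.span (d ` E)"
    using B W by (auto simp: configuration_def)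
  then have "finite B"
    using fun_vs.independent_span_bound[OF _ B(2)] E by blast
  then obtain bs where "set bs = B" "distinct bs"
    using finite_distinct_list by blast
  moreover have "fun_vs.span B = W"
    using B W fun_vs.span_minimal[of B W] by (auto simp: configuration_def)
  ultimately show ?thesis
    using B unfolding is_basis_list_def by blast
qed

lemma span_list_coeffs:
  assumes "distinct bs" "w \<in> fun_vs.span (set bs)"
  shows "\<exists>a. w = (\<lambda>e. \<Sum>j<length bs. a j * (bs ! j) e)"
proof -
  from assms(2) obtain u where u: "w = (\<Sum>b\<in>set bs. (\<lambda>e. u b * b e))"
    unfolding fun_vs.span_finite[OF finite_set] by blast
  have "(\<Sum>b\<in>S. (\<lambda>e. u b * b e)) = (\<lambda>e. \<Sum>b\<in>S. u b * b e)" for S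
    by (induction S rule: infinite_finite_induct) (auto simp: fun_eq_iff)
  with u have "w e = (\<Sum>b\<in>set bs. u b * b e)" for e
    by simp
  also have "(\<Sum>b\<in>set bs. u b * b e) = (\<Sum>j<length bs. u (bs ! j) * (bs ! j) e)" for e
    by (rule sum.reindex_bij_betw[OF bij_betw_nth[OF assms(1) refl refl], symmetric])
  finally show ?thesis
    by (intro exI[of _ "\<lambda>j. u (bs ! j)"] ext)
qed

lemma basis_list_length:
  assumes "is_basis_list W bs" "is_basis_list W bs'"
  shows "length bs = length bs'"
  using assms fun_vs.dim_span_eq_card_independent[of "set bs"] fun_vs.dim_span_eq_card_independent[of "set bs'"]
  by (auto simp: is_basis_list_def distinct_card)

text \<open>
  A change of basis multiplies the determinant of the form by the square of a constant, so the vanishing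
  of the configuration polynomial can be tested with any basis.
\<close>

lemma form_det_change_basis:
  assumes bs: "is_basis_list W bs" and bs': "is_basis_list W bs'"
    and zero: "mpoly_at (form_det E bs) v = 0"
  shows "mpoly_at (form_det E bs') v = 0"
proof -
  define n where "n = length bs"
  have n': "length bs' = n"
    using basis_list_length[OF bs bs'] by (simp add: n_def)
  have "\<exists>a. bs' ! i = (\<lambda>e. \<Sum>j<n. a j * (bs ! j) e)" if "i < n" for i
  proof -
    have "bs' ! i \<in> W"
      using bs' that n' fun_vs.span_base[of "bs' ! i" "set bs'"] by (auto simp: is_basis_list_def)
    then show ?thesis
      using span_list_coeffs[of bs "bs' ! i"] bs by (simp add: is_basis_list_def n_def)
  qed
  then obtain a where a: "\<And>i. i < n \<Longrightarrow> bs' ! i = (\<lambda>e. \<Sum>j<n. a i j * (bs ! j) e)"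
    by metis
  define A where "A = mat n n (\<lambda>(i, j). form_at E v (bs ! i) (bs ! j))"
  define P where "P = mat n n (\<lambda>(i, j). to_ac (a i j))"
  have "mat n n (\<lambda>(i, j). form_at E v (bs' ! i) (bs' ! j)) = P * A * transpose_mat P"
  proof (rule eq_matI)
    fix i j assume "i < dim_row (P * A * transpose_mat P)" "j < dim_col (P * A * transpose_mat P)"
    then have ij: "i < n" "j < n" by (simp_all add: P_def)
    have "(P * A * transpose_mat P) $$ (i, j) =
        (\<Sum>l<n. (\<Sum>k<n. to_ac (a i k) * form_at E v (bs ! k) (bs ! l)) * to_ac (a j l))"
      using ij by (simp add: P_def A_def scalar_prod_def atLeast0LessThan)
    also have "\<dots> = (\<Sum>l<n. \<Sum>k<n. \<Sum>e\<in>E. to_ac (a i k) * to_ac ((bs ! k) e) * (to_ac ((bs ! l) e) * to_ac (a j l)) * v e)"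
      by (simp add: form_at_def sum_distrib_left sum_distrib_right mult_ac)
    also have "\<dots> = (\<Sum>l<n. \<Sum>e\<in>E. \<Sum>k<n. to_ac (a i k) * to_ac ((bs ! k) e) * (to_ac ((bs ! l) e) * to_ac (a j l)) * v e)"
      by (intro sum.cong refl sum.swap)
    also have "\<dots> = (\<Sum>e\<in>E. \<Sum>l<n. \<Sum>k<n. to_ac (a i k) * to_ac ((bs ! k) e) * (to_ac ((bs ! l) e) * to_ac (a j l)) * v e)"
      by (rule sum.swap)
    also have "\<dots> = (\<Sum>e\<in>E. to_ac ((bs' ! i) e * (bs' ! j) e) * v e)"
    proof (rule sum.cong[OF refl])
      fix e
      have "to_ac ((bs' ! i) e * (bs' ! j) e) * v e =
          (\<Sum>k<n. to_ac (a i k) * to_ac ((bs ! k) e)) * (\<Sum>l<n. to_ac (a j l) * to_ac ((bs ! l) e)) * v e"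
        using ij a by (simp add: to_ac_sum)
      also have "\<dots> = (\<Sum>k<n. \<Sum>l<n. to_ac (a i k) * to_ac ((bs ! k) e) * (to_ac ((bs ! l) e) * to_ac (a j l)) * v e)"
        unfolding sum_product unfolding sum_distrib_right by (intro sum.cong refl) (simp add: mult_ac)
      also have "\<dots> = (\<Sum>l<n. \<Sum>k<n. to_ac (a i k) * to_ac ((bs ! k) e) * (to_ac ((bs ! l) e) * to_ac (a j l)) * v e)"
        by (rule sum.swap)
      finally show "(\<Sum>l<n. \<Sum>k<n. to_ac (a i k) * to_ac ((bs ! k) e) * (to_ac ((bs ! l) e) * to_ac (a j l)) * v e) =
          to_ac ((bs' ! i) e * (bs' ! j) e) * v e" ..
    qed
    finally show "mat n n (\<lambda>(i, j). form_at E v (bs' ! i) (bs' ! j)) $$ (i, j) = (P * A * transpose_mat P) $$ (i, j)"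
      using ij by (simp add: form_at_def)
  qed (simp_all add: P_def)
  then have "mpoly_at (form_det E bs') v = det (P * A * transpose_mat P)"
    by (simp add: mpoly_at_form_det n')
  also have "\<dots> = det P * det A * det (transpose_mat P)"
  proof -
    have "P \<in> carrier_mat n n" "A \<in> carrier_mat n n" "transpose_mat P \<in> carrier_mat n n"
      by (simp_all add: P_def A_def)
    then show ?thesis
      by (simp add: det_mult[of _ n])
  qed
  also have "det A = 0"
    using zero by (simp add: mpoly_at_form_det A_def n_def)
  finally show ?thesis by simp
qed

lemma config_poly_form_det:
  assumes "is_basis_list W bs"
  obtains bs' where "is_basis_list W bs'" "config_poly E W = form_det E bs'"
proof -
  define bs' where "bs' = (SOME bs. is_basis_list W bs)"
  have "is_basis_list W bs'"
    unfolding bs'_def using assms by (rule someI)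
  moreover have "config_poly E W = form_det E bs'"
    by (simp add: config_poly_def form_det_def Let_def bs'_def)
  ultimately show thesis by (rule that)
qed

lemma config_poly_zero_iff:
  assumes "is_basis_list W bs"
  shows "mpoly_at (config_poly E W) v = 0 \<longleftrightarrow> mpoly_at (form_det E bs) v = 0"
  using config_poly_form_det[OF assms, of E] form_det_change_basis[of W] assms by metis

lemma homogeneous_config_poly:
  assumes "is_basis_list W bs"
  shows "homogeneous (length bs) (config_poly E W)"
  using config_poly_form_det[OF assms, of E] homogeneous_form_det basis_list_length[OF assms] by metis

lemma config_complement_eq:
  "config_complement E W = induced (proj_space E) (proj_set E {} (config_poly E W))"
proof -
  have "lines E - config_hypersurface E W = proj_set E {} (config_poly E W)"
    by (auto simp: config_hypersurface_def proj_set_def)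
  then show ?thesis by (simp add: config_complement_def)
qed

lemma basis_list_nonempty:
  assumes "is_basis_list W bs" "w \<in> W" "w \<noteq> 0"
  shows "length bs > 0"
  using assms by (auto simp: is_basis_list_def)

text \<open>
  A nonzero vector of \<open>W\<close> whose support avoids that of \<open>v\<close> lies in the radical of the form
  specialised at \<open>v\<close>.
\<close>

lemma config_poly_vanishes:
  assumes W: "is_basis_list W bs" and w: "w \<in> W" "w \<noteq> 0" and v: "\<And>e. e \<in> E \<Longrightarrow> w e = 0 \<or> v e = 0"
  shows "mpoly_at (config_poly E W) v = 0"
proof -
  define n where "n = length bs"
  obtain a where a: "w = (\<lambda>e. \<Sum>j<n. a j * (bs ! j) e)"
    using span_list_coeffs[of bs w] W w by (auto simp: is_basis_list_def n_def)
  define A where "A = mat n n (\<lambda>(i, j). form_at E v (bs ! i) (bs ! j))"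
  define x where "x = vec n (\<lambda>j. to_ac (a j))"
  have "\<exists>j<n. a j \<noteq> 0"
  proof (rule ccontr)
    assume "\<not> (\<exists>j<n. a j \<noteq> 0)"
    with a have "w = 0" by (simp add: fun_eq_iff)
    with w show False by simp
  qed
  then obtain j where j: "j < n" "a j \<noteq> 0" by blast
  have "x \<noteq> 0\<^sub>v n"
  proof
    assume "x = 0\<^sub>v n"
    then have "x $ j = 0" using j by simp
    with j show False by (simp add: x_def)
  qed
  moreover have "A *\<^sub>v x = 0\<^sub>v n"
  proof (rule eq_vecI)
    fix i assume "i < dim_vec (0\<^sub>v n)"
    then have i: "i < n" by simp
    have "(A *\<^sub>v x) $ i = (\<Sum>j<n. form_at E v (bs ! i) (bs ! j) * to_ac (a j))"
      using i by (simp add: A_def x_def scalar_prod_def atLeast0LessThan)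
    also have "\<dots> = (\<Sum>j<n. \<Sum>e\<in>E. to_ac ((bs ! i) e) * v e * (to_ac (a j) * to_ac ((bs ! j) e)))"
      unfolding form_at_def sum_distrib_right by (intro sum.cong refl) (simp add: mult_ac)
    also have "\<dots> = (\<Sum>e\<in>E. \<Sum>j<n. to_ac ((bs ! i) e) * v e * (to_ac (a j) * to_ac ((bs ! j) e)))"
      by (rule sum.swap)
    also have "\<dots> = (\<Sum>e\<in>E. to_ac ((bs ! i) e) * v e * to_ac (w e))"
      by (simp add: a to_ac_sum sum_distrib_left)
    also have "\<dots> = 0"
      by (rule sum.neutral) (use v in auto)
    finally show "(A *\<^sub>v x) $ i = 0\<^sub>v n $ i"
      using i by simp
  qed (simp add: A_def)
  moreover have "A \<in> carrier_mat n n" "x \<in> carrier_vec n"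
    by (simp_all add: A_def x_def)
  ultimately have "det A = 0"
    using det_0_iff_vec_prod_zero_field by blast
  then show ?thesis
    unfolding config_poly_zero_iff[OF W] by (simp add: mpoly_at_form_det A_def n_def)
qed

section \<open>Matroid hypotheses in terms of vectors\<close>

lemma subspace_config:
  assumes "configuration E W"
  shows config_0: "0 \<in> W"
    and config_add: "w \<in> W \<Longrightarrow> w' \<in> W \<Longrightarrow> (\<lambda>i. w i + w' i) \<in> W"
    and config_scale: "w \<in> W \<Longrightarrow> (\<lambda>i. c * w i) \<in> W"
    and config_diff: "w \<in> W \<Longrightarrow> w' \<in> W \<Longrightarrow> (\<lambda>i. w i - w' i) \<in> W"
    and config_outside: "w \<in> W \<Longrightarrow> i \<notin> E \<Longrightarrow> w i = 0"
proof -
  have W: "fun_vs.subspace W" "W \<subseteq> coord_space E"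
    using assms by (auto simp: configuration_def)
  show "0 \<in> W" "w \<in> W \<Longrightarrow> (\<lambda>i. c * w i) \<in> W"
    using W fun_vs.subspace_0 fun_vs.subspace_scale by auto
  show "w \<in> W \<Longrightarrow> w' \<in> W \<Longrightarrow> (\<lambda>i. w i + w' i) \<in> W"
    using W fun_vs.subspace_add[of W w w'] by (simp add: plus_fun_def)
  show "w \<in> W \<Longrightarrow> w' \<in> W \<Longrightarrow> (\<lambda>i. w i - w' i) \<in> W"
    using W fun_vs.subspace_diff[of W w w'] by (simp add: fun_diff_def)
  show "w \<in> W \<Longrightarrow> i \<notin> E \<Longrightarrow> w i = 0"
    using W by (auto simp: coord_space_def)
qed

lemma config_contract_configuration:
  assumes "configuration E W"
  shows "configuration (E - S) (config_contract W S)"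
proof -
  note W = subspace_config[OF assms]
  have "fun_vs.subspace (config_contract W S)"
    unfolding fun_vs.subspace_def config_contract_def
    using W by (auto simp: plus_fun_def)
  then show ?thesis
    using W(5) by (auto simp: configuration_def config_contract_def coord_space_def)
qed

text \<open>
  Linear duality for coordinate functions, by induction on their number: restrict to the kernel of one of
  them, then correct its coefficient with the help of a vector outside this kernel.
\<close>

lemma coordinate_combination:
  assumes "finite S" and "configuration E W" and "\<And>w. w \<in> W \<Longrightarrow> (\<And>i. i \<in> S \<Longrightarrow> w i = 0) \<Longrightarrow> w x = 0"
  shows "\<exists>a. \<forall>w\<in>W. w x = (\<Sum>i\<in>S. a i * w i)"
  using assms
proof (induction S arbitrary: E W rule: finite_induct)
  case (insert s S)
  note W = subspace_config[OF insert.prems(1)]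
  let ?W = "config_contract W {s}"
  have "\<exists>a. \<forall>w\<in>?W. w x = (\<Sum>i\<in>S. a i * w i)"
    by (rule insert.IH[OF config_contract_configuration[OF insert.prems(1)]])
      (use insert.prems(2) in \<open>auto simp: config_contract_def\<close>)
  then obtain a where a: "\<And>w. w \<in> W \<Longrightarrow> w s = 0 \<Longrightarrow> w x = (\<Sum>i\<in>S. a i * w i)"
    by (auto simp: config_contract_def)
  show ?case
  proof (cases "\<exists>w\<in>W. w s \<noteq> 0")
    case False
    have "\<forall>w\<in>W. w x = (\<Sum>i\<in>insert s S. a i * w i)"
      using False a insert.hyps by auto
    then show ?thesis by blast
  next
    case True
    then obtain u where u: "u \<in> W" "u s \<noteq> 0" by blast
    define b where "b = (u x - (\<Sum>i\<in>S. a i * u i)) / u s"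
    have "w x = (\<Sum>i\<in>insert s S. (a(s := b)) i * w i)" if w: "w \<in> W" for w
    proof -
      let ?w = "\<lambda>i. w i - (w s / u s) * u i"
      have "?w \<in> W"
        by (rule W(4)[OF w W(3)[OF u(1)]])
      then have "?w x = (\<Sum>i\<in>S. a i * ?w i)"
        by (rule a) (use u(2) in simp)
      also have "\<dots> = (\<Sum>i\<in>S. a i * w i) - (w s / u s) * (\<Sum>i\<in>S. a i * u i)"
        by (simp add: right_diff_distrib sum_subtractf sum_distrib_left mult.left_commute)
      finally have "w x = (\<Sum>i\<in>S. a i * w i) + b * w s"
        using u(2) by (simp add: b_def field_simps)
      moreover have "(\<Sum>i\<in>S. (a(s := b)) i * w i) = (\<Sum>i\<in>S. a i * w i)"
        using insert.hyps(2) by (intro sum.cong) auto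
      ultimately show ?thesis
        using insert.hyps by simp
    qed
    then show ?thesis by blast
  qed
qed auto

lemma indep_config_iff:
  "S \<in> indep (config_matroid E W) \<longleftrightarrow>
     S \<subseteq> E \<and> (\<forall>a. (\<forall>w\<in>W. (\<Sum>e\<in>S. a e * w e) = 0) \<longrightarrow> (\<forall>e\<in>S. a e = 0))"
  by (simp add: config_matroid_def)

lemma indep_insert:
  assumes E: "finite E" and I: "I \<in> indep (config_matroid E W)" and x: "x \<in> E"
    and w: "w \<in> W" "\<And>i. i \<in> I \<Longrightarrow> w i = 0" "w x \<noteq> 0"
  shows "insert x I \<in> indep (config_matroid E W)"
proof -
  have "x \<notin> I" and fin: "finite I"
    using w I E finite_subset by (auto simp: indep_config_iff)
  have "\<forall>e\<in>insert x I. a e = 0" if rel: "\<forall>w\<in>W. (\<Sum>e\<in>insert x I. a e * w e) = 0" for a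
  proof -
    have "a x = 0"
      using rel w \<open>x \<notin> I\<close> fin by force
    with rel have "\<forall>w\<in>W. (\<Sum>e\<in>I. a e * w e) = 0"
      using \<open>x \<notin> I\<close> fin by simp
    with I \<open>a x = 0\<close> show ?thesis
      by (auto simp: indep_config_iff)
  qed
  with I x show ?thesis
    by (auto simp: indep_config_iff)
qed

text \<open>
  If a coordinate from \<open>S\<close> did not vanish at some common zero of the coordinates in \<open>I\<close>, it could be added to \<open>I\<close>.
\<close>

lemma maximal_indep_subset:
  assumes E: "finite E" and S: "S \<subseteq> E"
  obtains I where "I \<in> indep (config_matroid E W)" "I \<subseteq> S"
    "\<And>w x. w \<in> W \<Longrightarrow> (\<And>i. i \<in> I \<Longrightarrow> w i = 0) \<Longrightarrow> x \<in> S \<Longrightarrow> w x = 0"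
proof -
  let ?F = "{I \<in> indep (config_matroid E W). I \<subseteq> S}"
  have "finite ?F"
    using finite_subset[OF S E] by (intro finite_subset[of ?F "Pow S"]) auto
  moreover have "{} \<in> ?F"
    by (simp add: indep_config_iff)
  ultimately obtain I where I: "I \<in> ?F" "\<And>J. J \<in> ?F \<Longrightarrow> I \<subseteq> J \<Longrightarrow> J = I"
    using finite_has_maximal[of ?F] by (metis (no_types, lifting) empty_iff)
  show thesis
  proof (rule that[of I])
    show "w x = 0" if w: "w \<in> W" "\<And>i. i \<in> I \<Longrightarrow> w i = 0" "x \<in> S" for w x
    proof (rule ccontr)
      assume "w x \<noteq> 0"
      then have "insert x I \<in> ?F"
        using indep_insert[OF E _ _ w(1,2)] I(1) w(3) S by auto
      with I(2)[of "insert x I"] have "x \<in> I" by blast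
      with w \<open>w x \<noteq> 0\<close> show False by blast
    qed
  qed (use I in auto)
qed

text \<open>
  By duality, all coordinates are combinations of those in \<open>I\<close>.
\<close>

lemma mbasis_config:
  assumes E: "finite E" and W: "configuration E W" and I: "I \<in> indep (config_matroid E W)"
    and ker: "\<And>w x. w \<in> W \<Longrightarrow> (\<And>i. i \<in> I \<Longrightarrow> w i = 0) \<Longrightarrow> x \<in> E \<Longrightarrow> w x = 0"
  shows "mbasis (config_matroid E W) I"
  unfolding mbasis_def
proof (intro conjI I ballI impI)
  fix J assume J: "J \<in> indep (config_matroid E W)" "I \<subseteq> J"
  have fin: "finite J"
    using J E finite_subset by (auto simp: indep_config_iff)
  show "J = I"
  proof (rule ccontr)
    assume "J \<noteq> I"
    with J obtain x where x: "x \<in> J" "x \<notin> I" by blast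
    then have "x \<in> E" using J by (auto simp: indep_config_iff)
    obtain a where a: "\<forall>w\<in>W. w x = (\<Sum>i\<in>I. a i * w i)"
      using coordinate_combination[OF finite_subset[OF J(2) fin] W, of x] ker[OF _ _ \<open>x \<in> E\<close>] by blast
    define b where "b i = (if i = x then - 1 else if i \<in> I then a i else 0)" for i
    have "(\<Sum>i\<in>J. b i * w i) = 0" if w: "w \<in> W" for w
    proof -
      have "(\<Sum>i\<in>J. b i * w i) = (\<Sum>i\<in>insert x I. b i * w i)"
        using fin x J(2) by (intro sum.mono_neutral_right) (auto simp: b_def)
      also have "\<dots> = - w x + (\<Sum>i\<in>I. b i * w i)"
        using x finite_subset[OF J(2) fin] by (simp add: b_def)
      also have "(\<Sum>i\<in>I. b i * w i) = (\<Sum>i\<in>I. a i * w i)"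
        using x by (intro sum.cong) (auto simp: b_def)
      finally show ?thesis
        using a w by simp
    qed
    with J(1) x(1) have "b x = 0"
      by (auto simp: indep_config_iff)
    then show False by (simp add: b_def)
  qed
qed

text \<open>
  The coordinate \<open>x\<close> is independent of any others, as they vanish on the multiples of the unit vector.
\<close>

lemma unit_vector_coloop:
  assumes E: "finite E" and B: "mbasis (config_matroid E W) B" and x: "x \<in> E"
    and w: "w \<in> W" "w x \<noteq> 0" "\<And>i. i \<noteq> x \<Longrightarrow> w i = 0"
  shows "x \<in> B"
proof (rule ccontr)
  assume "x \<notin> B"
  then have "w i = 0" if "i \<in> B" for i
    using w(3)[of i] that by metis
  with B w(2) have "insert x B \<in> indep (config_matroid E W)"
    unfolding mbasis_def by (intro indep_insert[OF E _ x w(1)]) simp_all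
  with B \<open>x \<notin> B\<close> show False
    unfolding mbasis_def by blast
qed

text \<open>
  Otherwise the coordinates outside \<open>S\<close> have no common zero in \<open>W\<close> except \<open>0\<close>, and among them there is a basis,
  which avoids \<open>S\<close>.  For \<open>S = {e, f}\<close> this gives the vector that expresses that \<open>e\<close> and \<open>f\<close> are in series.
\<close>

lemma vector_supported_on_codependent:
  assumes E: "finite E" and W: "configuration E W"
    and S: "\<And>B. mbasis (config_matroid E W) B \<Longrightarrow> B \<inter> S \<noteq> {}"
  shows "\<exists>w\<in>W. w \<noteq> 0 \<and> (\<forall>i. i \<notin> S \<longrightarrow> w i = 0)"
proof (rule ccontr)
  assume no: "\<not> ?thesis"
  obtain I where I: "I \<in> indep (config_matroid E W)" "I \<subseteq> E - S"
    "\<And>w x. w \<in> W \<Longrightarrow> (\<And>i. i \<in> I \<Longrightarrow> w i = 0) \<Longrightarrow> x \<in> E - S \<Longrightarrow> w x = 0"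
    by (rule maximal_indep_subset[OF E, of "E - S" W]) auto
  have "mbasis (config_matroid E W) I"
  proof (rule mbasis_config[OF E W I(1)])
    fix w x assume w: "w \<in> W" "\<And>i. i \<in> I \<Longrightarrow> w i = 0"
    then have "\<forall>i. i \<notin> S \<longrightarrow> w i = 0"
      using I(3)[of w] subspace_config(5)[OF W w(1)] by blast
    with no w(1) have "w = 0" by blast
    then show "w x = 0" by simp
  qed
  from S[OF this] I(2) show False by blast
qed

lemma in_seriesD:
  assumes "in_series (config_matroid E W) e f"
  shows "\<And>B. mbasis (config_matroid E W) B \<Longrightarrow> B \<inter> {e, f} \<noteq> {}"
    and "e \<noteq> f \<Longrightarrow> \<exists>B. mbasis (config_matroid E W) B \<and> e \<notin> B"
    and "e \<noteq> f \<Longrightarrow> \<exists>B. mbasis (config_matroid E W) B \<and> f \<notin> B"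
proof -
  let ?M = "config_matroid E W"
  have c: "circuit (mdual ?M) {e, f}" "e \<in> E" "f \<in> E"
    using assms by (auto simp: in_series_def parallel_def mdual_def config_matroid_def)
  show "B \<inter> {e, f} \<noteq> {}" if "mbasis ?M B" for B
    using c that by (auto simp: circuit_def mdual_def config_matroid_def)
  show "\<exists>B. mbasis ?M B \<and> e \<notin> B" if "e \<noteq> f"
  proof -
    from that have "{e} \<subset> {e, f}" by auto
    with c(1) have "{e} \<in> indep (mdual ?M)"
      unfolding circuit_def by blast
    then show ?thesis by (auto simp: mdual_def)
  qed
  show "\<exists>B. mbasis ?M B \<and> f \<notin> B" if "e \<noteq> f"
  proof -
    from that have "{f} \<subset> {e, f}" by auto
    with c(1) have "{f} \<in> indep (mdual ?M)"
      unfolding circuit_def by blast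
    then show ?thesis by (auto simp: mdual_def)
  qed
qed

text \<open>
  For \<open>e \<noteq> f\<close>, a vector supported on one of the two elements would make this element a coloop, whereas
  some basis avoids it because \<open>{e, f}\<close> is a circuit of the dual.
\<close>

lemma series_vector:
  assumes E: "finite E" and W: "configuration E W" and e: "e \<in> E" and f: "f \<in> E"
    and ser: "in_series (config_matroid E W) e f"
  shows "\<exists>w\<in>W. w e = 1 \<and> (e \<noteq> f \<longrightarrow> w f \<noteq> 0) \<and> (\<forall>i. i \<notin> {e, f} \<longrightarrow> w i = 0)"
proof -
  obtain w where w: "w \<in> W" "w \<noteq> 0" "\<And>i. i \<notin> {e, f} \<Longrightarrow> w i = 0"
    using vector_supported_on_codependent[OF E W in_seriesD(1)[OF ser]] by blast
  have ne: "w e \<noteq> 0 \<and> (e \<noteq> f \<longrightarrow> w f \<noteq> 0)"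
  proof (cases "e = f")
    case True
    with w show ?thesis
      by (auto simp: fun_eq_iff) (metis)
  next
    case False
    have "w e \<noteq> 0"
    proof
      assume "w e = 0"
      with w(3) have z: "w i = 0" if "i \<noteq> f" for i
        using that by (cases "i = e") auto
      with w(2) have "w f \<noteq> 0"
        by (auto simp: fun_eq_iff) (metis)
      with unit_vector_coloop[OF E _ f w(1) _ z] in_seriesD(3)[OF ser False] show False by blast
    qed
    moreover have "w f \<noteq> 0"
    proof
      assume "w f = 0"
      with w(3) have z: "w i = 0" if "i \<noteq> e" for i
        using that by (cases "i = f") auto
      with unit_vector_coloop[OF E _ e w(1) \<open>w e \<noteq> 0\<close> z] in_seriesD(2)[OF ser False] show False by blast
    qed
    ultimately show ?thesis by simp
  qed
  have "(\<lambda>i. (1 / w e) * w i) \<in> W"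
    by (rule subspace_config(3)[OF W w(1)])
  then show ?thesis
    using ne w(3) by (intro bexI[of _ "\<lambda>i. (1 / w e) * w i"]) auto
qed

text \<open>
  The coordinates in \<open>K\<close> are combinations of those in \<open>I\<close>, and the vectors of coefficients inherit their
  independence.
\<close>

lemma card_indep_le:
  assumes E: "finite E" and W: "configuration E W"
    and I: "I \<subseteq> E" and ker: "\<And>w x. w \<in> W \<Longrightarrow> (\<And>i. i \<in> I \<Longrightarrow> w i = 0) \<Longrightarrow> w x = 0"
    and K: "K \<in> indep (config_matroid E W)"
  shows "card K \<le> card I"
proof -
  have finI: "finite I" and finK: "finite K"
    using I K E finite_subset by (auto simp: indep_config_iff)
  have "\<exists>a. (\<forall>w\<in>W. w k = (\<Sum>i\<in>I. a i * w i)) \<and> (\<forall>i. i \<notin> I \<longrightarrow> a i = 0)" for k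
  proof -
    obtain a where a: "\<forall>w\<in>W. w k = (\<Sum>i\<in>I. a i * w i)"
      using coordinate_combination[OF finI W, of k] ker by blast
    show ?thesis
      using a by (intro exI[of _ "\<lambda>i. if i \<in> I then a i else 0"]) auto
  qed
  then obtain a where a: "\<And>k w. w \<in> W \<Longrightarrow> w k = (\<Sum>i\<in>I. a k i * w i)"
    "\<And>k i. i \<notin> I \<Longrightarrow> a k i = 0"
    by metis
  have rel: "b k = 0" if b: "\<And>i. (\<Sum>k\<in>K. b k * a k i) = 0" and k: "k \<in> K" for b k
  proof -
    have "(\<Sum>k\<in>K. b k * w k) = 0" if w: "w \<in> W" for w
    proof -
      have "(\<Sum>k\<in>K. b k * w k) = (\<Sum>k\<in>K. \<Sum>i\<in>I. b k * a k i * w i)"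
      proof (rule sum.cong[OF refl])
        fix k
        show "b k * w k = (\<Sum>i\<in>I. b k * a k i * w i)"
          by (subst a(1)[OF w, of k]) (simp only: sum_distrib_left mult.assoc)
      qed
      also have "\<dots> = (\<Sum>i\<in>I. (\<Sum>k\<in>K. b k * a k i) * w i)"
        by (subst sum.swap) (simp add: sum_distrib_right)
      finally show ?thesis
        using b by simp
    qed
    with K k show ?thesis
      by (auto simp: indep_config_iff)
  qed
  have inj: "inj_on a K"
  proof (rule inj_onI, rule ccontr)
    fix k l assume kl: "k \<in> K" "l \<in> K" "a k = a l" "k \<noteq> l"
    define b where "b j = (if j = k then 1 else if j = l then - 1 else 0 :: 'b)" for j
    have "(\<Sum>j\<in>K. b j * a j i) = (\<Sum>j\<in>{k, l}. b j * a j i)" for i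
      using finK kl by (intro sum.mono_neutral_right) (auto simp: b_def)
    then have "(\<Sum>j\<in>K. b j * a j i) = 0" for i
      using kl by (simp add: b_def)
    from rel[OF this kl(1)] show False by (simp add: b_def)
  qed
  have "fun_vs.independent (a ` K)"
  proof (rule fun_vs.independent_if_scalars_zero)
    fix u x assume u: "(\<Sum>x\<in>a ` K. (\<lambda>i. u x * x i)) = 0" and x: "x \<in> a ` K"
    have ev: "(\<Sum>x\<in>S. (\<lambda>i. u x * x i)) i = (\<Sum>x\<in>S. u x * x i)" for S i
      by (induction S rule: infinite_finite_induct) auto
    have "(\<Sum>k\<in>K. u (a k) * a k i) = 0" for i
      using fun_cong[OF u, of i] unfolding ev by (simp add: sum.reindex[OF inj])
    from rel[OF this] x show "u x = 0" by auto
  qed (use finK in simp)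
  moreover have "a ` K \<subseteq> fun_vs.span ((\<lambda>i j. if j = i then 1 else 0) ` I)"
  proof
    fix x assume "x \<in> a ` K"
    then have x: "\<And>i. i \<notin> I \<Longrightarrow> x i = 0" using a(2) by auto
    have ev: "(\<Sum>i\<in>S. (\<lambda>j. x i * (if j = i then 1 else 0))) j = (\<Sum>i\<in>S. x i * (if j = i then 1 else 0))" for S j
      by (induction S rule: infinite_finite_induct) auto
    have "x = (\<Sum>i\<in>I. (\<lambda>j. x i * (if j = i then 1 else 0)))"
      unfolding fun_eq_iff ev using finI x by (auto simp: if_distrib[of "(*) _"] cong: if_cong)
    also have "\<dots> \<in> fun_vs.span ((\<lambda>i j. if j = i then 1 else 0) ` I)"
      by (intro fun_vs.span_sum fun_vs.span_scale fun_vs.span_base) auto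
    finally show "x \<in> fun_vs.span ((\<lambda>i j. if j = i then 1 else 0) ` I)" .
  qed
  ultimately have "card (a ` K) \<le> card ((\<lambda>i j. if j = i then 1 else 0 :: 'b) ` I)"
    using fun_vs.independent_span_bound[OF finite_imageI[OF finI]] by blast
  also have "\<dots> \<le> card I"
    by (rule card_image_le[OF finI])
  finally show ?thesis
    by (simp add: card_image[OF inj])
qed

text \<open>
  If the coordinates in \<open>S\<close> had no common zero in \<open>W\<close> except \<open>0\<close>, they would span the dual of \<open>W\<close>, and \<open>S\<close>
  would have full rank.
\<close>

lemma vector_vanishing_on_nonspanning:
  assumes E: "finite E" and W: "configuration E W" and S: "S \<subseteq> E"
    and cl: "mclosure (config_matroid E W) S \<noteq> E"
  shows "\<exists>w\<in>W. w \<noteq> 0 \<and> (\<forall>i\<in>S. w i = 0)"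
proof (rule ccontr)
  assume no: "\<not> ?thesis"
  let ?M = "config_matroid E W"
  obtain I where I: "I \<in> indep ?M" "I \<subseteq> S"
    "\<And>w x. w \<in> W \<Longrightarrow> (\<And>i. i \<in> I \<Longrightarrow> w i = 0) \<Longrightarrow> x \<in> S \<Longrightarrow> w x = 0"
    by (rule maximal_indep_subset[OF E S, of W]) auto
  have ker: "w x = 0" if "w \<in> W" "\<And>i. i \<in> I \<Longrightarrow> w i = 0" for w x
  proof -
    have "w = 0" using I(3)[OF that] no that(1) by blast
    then show ?thesis by simp
  qed
  have rank: "mrank_of ?M T = card I" if T: "I \<subseteq> T" "T \<subseteq> E" for T
    unfolding mrank_of_def
  proof (rule Max_eqI)
    show "finite (card ` {J \<in> indep ?M. J \<subseteq> T})"
      using finite_subset[OF T(2) E] by simp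
    show "card I \<in> card ` {J \<in> indep ?M. J \<subseteq> T}"
      using I T by blast
    have IE: "I \<subseteq> E"
      using I(2) S by blast
    have "card J \<le> card I" if "J \<in> indep ?M" for J
      by (rule card_indep_le[OF E W IE _ that]) (rule ker)
    then show "y \<le> card I" if "y \<in> card ` {J \<in> indep ?M. J \<subseteq> T}" for y
      using that by blast
  qed
  have "mclosure ?M S = E"
    using rank[of S] rank[of "insert _ S"] I(2) S by (auto simp: mclosure_def config_matroid_def)
  with cl show False by simp
qed

section \<open>Series pairs\<close>

lemma basis_list_insert:
  assumes W: "configuration E W" and bs: "is_basis_list (config_contract W {e}) bs"
    and w: "w \<in> W" "w e = 1"
  shows "is_basis_list W (w # bs)"
proof -
  note sub = subspace_config[OF W]
  have span: "fun_vs.span (set bs) = config_contract W {e}" and ind: "fun_vs.independent (set bs)" "distinct bs"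
    using bs by (auto simp: is_basis_list_def)
  have "w \<notin> fun_vs.span (set bs)"
    unfolding span using w by (simp add: config_contract_def)
  then have "fun_vs.independent (set (w # bs))" "distinct (w # bs)"
    using ind fun_vs.independent_insertI fun_vs.span_base by auto
  moreover have "fun_vs.span (set (w # bs)) = W"
  proof -
    have "(x - (\<lambda>i. k * w i) \<in> config_contract W {e}) \<longleftrightarrow> x \<in> W \<and> k = x e" for x k
    proof
      assume "x - (\<lambda>i. k * w i) \<in> config_contract W {e}"
      then have x: "x - (\<lambda>i. k * w i) \<in> W" "x e = k"
        using w by (auto simp: config_contract_def)
      have "(\<lambda>i. (x - (\<lambda>i. k * w i)) i + k * w i) \<in> W"
        by (rule sub(2)[OF x(1) sub(3)[OF w(1)]])
      with x(2) show "x \<in> W \<and> k = x e" by simp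
    next
      assume "x \<in> W \<and> k = x e"
      then show "x - (\<lambda>i. k * w i) \<in> config_contract W {e}"
        using sub(4)[OF _ sub(3)[OF w(1)], of x k] w(2) by (simp add: config_contract_def fun_diff_def)
    qed
    then show ?thesis
      by (auto simp: fun_vs.span_insert span)
  qed
  ultimately show ?thesis
    by (simp add: is_basis_list_def)
qed

interpretation fun_vs_pair: vector_space_pair "\<lambda>(c::'k::field) (v::'e \<Rightarrow> 'k) i. c * v i"
    "\<lambda>(c::'k::field) (v::'e \<Rightarrow> 'k) i. c * v i"
  by standard

text \<open>
  Forgetting the coordinates \<open>e\<close> and \<open>f\<close> kills \<open>w\<close>.  It is injective on \<open>W/e\<close>, as \<open>W\<close> contains no vector
  supported on \<open>f\<close>.
\<close>

lemma basis_list_delete: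
  assumes W: "configuration E W" and bs: "is_basis_list (config_contract W {e}) bs"
    and w: "w \<in> W" "w e = 1" "w f \<noteq> 0" "\<And>i. i \<notin> {e, f} \<Longrightarrow> w i = 0"
    and no_unit: "\<And>u. u \<in> W \<Longrightarrow> (\<And>i. i \<noteq> f \<Longrightarrow> u i = 0) \<Longrightarrow> u = 0"
  shows "is_basis_list (config_delete W {e, f}) (map (\<lambda>u i. if i \<in> {e, f} then 0 else u i) bs)"
proof -
  note sub = subspace_config[OF W]
  define d where "d = (\<lambda>(u :: 'a \<Rightarrow> 'b) i. if i \<in> {e, f} then 0 else u i)"
  let ?s = "\<lambda>c (v :: 'a \<Rightarrow> 'b) i. c * v i"
  have lin: "Vector_Spaces.linear ?s ?s d"
    unfolding Vector_Spaces.linear_iff using fun_vs.vector_space_axioms by (auto simp: d_def fun_eq_iff)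
  have span: "fun_vs.span (set bs) = config_contract W {e}" and ind: "fun_vs.independent (set bs)" "distinct bs"
    using bs by (auto simp: is_basis_list_def)
  have inj: "inj_on d (fun_vs.span (set bs))"
  proof (rule inj_onI)
    fix x y assume "x \<in> fun_vs.span (set bs)" "y \<in> fun_vs.span (set bs)" "d x = d y"
    then have xy: "x \<in> W" "y \<in> W" "x e = 0" "y e = 0" "d x = d y"
      unfolding span by (auto simp: config_contract_def)
    have "x i - y i = 0" if "i \<noteq> f" for i
      using fun_cong[OF xy(5), of i] that xy(3,4) by (cases "i = e") (auto simp: d_def)
    with no_unit[OF sub(4)[OF xy(1,2)]] have "(\<lambda>i. x i - y i) = 0" by blast
    then show "x = y" by (auto simp: fun_eq_iff)
  qed
  have "d ` W = d ` config_contract W {e}"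
  proof (intro equalityI subsetI)
    fix y assume "y \<in> d ` W"
    then obtain x where x: "x \<in> W" "y = d x" by blast
    let ?x = "\<lambda>i. x i - x e * w i"
    have "?x \<in> config_contract W {e}"
      using sub(4)[OF x(1) sub(3)[OF w(1)]] w(2) by (simp add: config_contract_def)
    moreover have "d ?x = y"
      using w(4) x(2) by (auto simp: d_def fun_eq_iff)
    ultimately show "y \<in> d ` config_contract W {e}" by blast
  qed (auto simp: config_contract_def)
  then have "fun_vs.span (d ` set bs) = config_delete W {e, f}"
    unfolding fun_vs_pair.linear_span_image[OF lin] span by (simp add: config_delete_def d_def)
  moreover have "fun_vs.independent (d ` set bs)"
    by (rule fun_vs_pair.linear_independent_injective_image[OF lin ind(1) inj])
  moreover have "distinct (map d bs)"
    using ind(2) inj_on_subset[OF inj fun_vs.span_superset] by (simp add: distinct_map)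
  ultimately show ?thesis
    by (simp add: is_basis_list_def d_def)
qed

text \<open>
  For a vector \<open>w = e + c f\<close> in \<open>W\<close>, a basis of \<open>W/e\<close> extended by \<open>w\<close> brings the form of \<open>W\<close> into a bordered
  shape.  The form of \<open>W/e\<close> is the one of \<open>W \<setminus> {e, f}\<close> plus \<open>x\<^sub>f\<close> times the square of the coordinate \<open>f\<close>.
\<close>

lemma form_at_upd: "a \<notin> E \<Longrightarrow> form_at E (v(a := x)) b b' = form_at E v b b'"
  unfolding form_at_def by (rule sum.cong) auto

lemma form_at_remove:
  "finite E \<Longrightarrow> a \<in> E \<Longrightarrow> form_at E v b b' = to_ac (b a * b' a) * v a + form_at (E - {a}) v b b'"
  unfolding form_at_def by (rule sum.remove)

lemma form_det_series:
  fixes bs :: "('e \<Rightarrow> 'k::field) list"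
  assumes E: "finite E" and ef: "e \<in> E" "f \<in> E" "e \<noteq> f"
    and bs: "\<forall>b\<in>set bs. b e = 0"
    and w: "w e = 1" "w f \<noteq> 0" "\<forall>i. i \<notin> {e, f} \<longrightarrow> w i = 0"
  defines "G \<equiv> mpoly_at (form_det (E - {e}) bs)"
    and "D \<equiv> mpoly_at (form_det (E - {e, f}) (map (\<lambda>u i. if i \<in> {e, f} then 0 else u i) bs))"
  shows "mpoly_at (form_det E (w # bs)) v = v e * G v + to_ac (w f * w f) * v f * D v"
    and "G v = D v + v f * (G (v(f := 1)) - D v)"
    and "G (v(e := x)) = G v" and "D (v(e := x)) = D v" and "D (v(f := x)) = D v"
proof -
  define n where "n = length bs"
  define B where "B v i j = form_at (E - {e, f}) v (bs ! i) (bs ! j)" for v :: "'e \<Rightarrow> 'k alg_closure" and i j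
  define u where "u i = to_ac ((bs ! i) f)" for i
  have E': "E - {e, f} = E - {e} - {f}" by auto
  have D: "D v = det (mat n n (\<lambda>(i, j). B v i j))" for v
  proof -
    have "form_at (E - {e, f}) v (\<lambda>i. if i \<in> {e, f} then 0 else (bs ! i') i) (\<lambda>i. if i \<in> {e, f} then 0 else (bs ! j) i) =
        B v i' j" for i' j
      unfolding form_at_def B_def by (rule sum.cong) auto
    then have "mat n n (\<lambda>(i, j). form_at (E - {e, f}) v (map (\<lambda>u i. if i \<in> {e, f} then 0 else u i) bs ! i)
          (map (\<lambda>u i. if i \<in> {e, f} then 0 else u i) bs ! j)) = mat n n (\<lambda>(i, j). B v i j)"
      by (intro eq_matI) (simp_all add: n_def)
    then show ?thesis
      by (simp add: D_def mpoly_at_form_det n_def)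
  qed
  have inner: "form_at (E - {e}) v (bs ! i) (bs ! j) = B v i j + v f * (u i * u j)" for v i j
    using form_at_remove[of "E - {e}" f v] E ef by (simp add: B_def u_def E' mult_ac)
  have G: "G v = det (mat n n (\<lambda>(i, j). B v i j + v f * (u i * u j)))" for v
    by (simp add: G_def mpoly_at_form_det n_def inner)
  have Bupd: "B (v(a := x)) i j = B v i j" if "a \<in> {e, f}" for v a x i j
    unfolding B_def by (rule form_at_upd) (use that in auto)
  show "D (v(e := x)) = D v" "D (v(f := x)) = D v" "G (v(e := x)) = G v"
    using ef by (simp_all add: D G Bupd)
  show "G v = D v + v f * (G (v(f := 1)) - D v)"
    using det_rank_one_affine[of n "B v" "v f" u] by (simp add: G D Bupd)
  have w_other: "form_at (E - {e, f}) v w b = 0" "form_at (E - {e, f}) v b w = 0" for b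
    unfolding form_at_def using w(3) by (auto intro!: sum.neutral)
  have split: "form_at E v b b' = to_ac (b e * b' e) * v e + (to_ac (b f * b' f) * v f + form_at (E - {e, f}) v b b')"
    for b b'
    using form_at_remove[of E e v b b'] form_at_remove[of "E - {e}" f v b b'] E ef by (simp add: E')
  have be: "(bs ! i) e = 0" if "i < n" for i
    using bs that by (simp add: n_def)
  have entries: "form_at E v w w = v e + to_ac (w f) * to_ac (w f) * v f"
    "i < n \<Longrightarrow> form_at E v w (bs ! i) = to_ac (w f) * v f * u i"
    "i < n \<Longrightarrow> form_at E v (bs ! i) w = to_ac (w f) * v f * u i"
    "i < n \<Longrightarrow> j < n \<Longrightarrow> form_at E v (bs ! i) (bs ! j) = B v i j + v f * (u i * u j)" for i j
    using split[of w w] split[of w "bs ! i"] split[of "bs ! i" w] split[of "bs ! i" "bs ! j"]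
      be[of i] w(1) by (simp_all add: w_other B_def u_def)
  have "mat (Suc n) (Suc n) (\<lambda>(i, j). form_at E v ((w # bs) ! i) ((w # bs) ! j)) =
      bordered n (v e + to_ac (w f) * to_ac (w f) * v f) (\<lambda>j. to_ac (w f) * v f * u j)
        (\<lambda>i. to_ac (w f) * v f * u i) (\<lambda>i j. B v i j + v f * (u i * u j))"
  proof (rule eq_matI)
    fix i j assume "i < dim_row (bordered n (v e + to_ac (w f) * to_ac (w f) * v f) (\<lambda>j. to_ac (w f) * v f * u j)
        (\<lambda>i. to_ac (w f) * v f * u i) (\<lambda>i j. B v i j + v f * (u i * u j)))"
      "j < dim_col (bordered n (v e + to_ac (w f) * to_ac (w f) * v f) (\<lambda>j. to_ac (w f) * v f * u j)
        (\<lambda>i. to_ac (w f) * v f * u i) (\<lambda>i j. B v i j + v f * (u i * u j)))"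
    then have ij: "i < Suc n" "j < Suc n" by (simp_all add: bordered_def)
    show "mat (Suc n) (Suc n) (\<lambda>(i, j). form_at E v ((w # bs) ! i) ((w # bs) ! j)) $$ (i, j) =
        bordered n (v e + to_ac (w f) * to_ac (w f) * v f) (\<lambda>j. to_ac (w f) * v f * u j)
        (\<lambda>i. to_ac (w f) * v f * u i) (\<lambda>i j. B v i j + v f * (u i * u j)) $$ (i, j)"
      using ij by (cases i; cases j) (simp_all add: bordered_def entries)
  qed (simp_all add: bordered_def)
  then have "mpoly_at (form_det E (w # bs)) v =
      det (bordered n (v e + to_ac (w f) * to_ac (w f) * v f) (\<lambda>j. to_ac (w f) * v f * u j)
        (\<lambda>i. to_ac (w f) * v f * u i) (\<lambda>i j. B v i j + v f * (u i * u j)))"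
    by (simp add: mpoly_at_form_det n_def)
  also have "\<dots> = v e * G v + to_ac (w f * w f) * v f * D v"
    using det_series[of "to_ac (w f)" n "v e" "v f" u "B v"] w(2) by (simp add: G D)
  finally show "mpoly_at (form_det E (w # bs)) v = v e * G v + to_ac (w f * w f) * v f * D v" .
qed

lemma form_det_coloop:
  assumes E: "finite E" and e: "e \<in> E" and bs: "\<forall>b\<in>set bs. b e = 0"
    and w: "w e = 1" "\<forall>i. i \<noteq> e \<longrightarrow> w i = 0"
  shows "mpoly_at (form_det E (w # bs)) v = v e * mpoly_at (form_det (E - {e}) bs) v"
proof -
  define n where "n = length bs"
  define B where "B i j = form_at (E - {e}) v (bs ! i) (bs ! j)" for i j
  have w_other: "form_at (E - {e}) v w b = 0" "form_at (E - {e}) v b w = 0" for b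
    unfolding form_at_def using w(2) by (auto intro!: sum.neutral)
  have be: "(bs ! i) e = 0" if "i < n" for i
    using bs that by (simp add: n_def)
  have "mat (Suc n) (Suc n) (\<lambda>(i, j). form_at E v ((w # bs) ! i) ((w # bs) ! j)) =
      bordered n (v e) (\<lambda>_. 0) (\<lambda>_. 0) B"
  proof (rule eq_matI)
    fix i j assume "i < dim_row (bordered n (v e) (\<lambda>_. 0) (\<lambda>_. 0) B)" "j < dim_col (bordered n (v e) (\<lambda>_. 0) (\<lambda>_. 0) B)"
    then have "i < Suc n" "j < Suc n" by (simp_all add: bordered_def)
    then show "mat (Suc n) (Suc n) (\<lambda>(i, j). form_at E v ((w # bs) ! i) ((w # bs) ! j)) $$ (i, j) =
        bordered n (v e) (\<lambda>_. 0) (\<lambda>_. 0) B $$ (i, j)"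
      using be w(1) form_at_remove[OF E e, of v]
      by (cases i; cases j) (simp_all add: bordered_def w_other B_def)
  qed (simp_all add: bordered_def)
  then have "mpoly_at (form_det E (w # bs)) v = det (bordered n (v e) (\<lambda>_. 0) (\<lambda>_. 0) B)"
    by (simp add: mpoly_at_form_det n_def)
  then show ?thesis
    by (simp add: det_bordered_upper_zero mpoly_at_form_det B_def n_def)
qed

section \<open>Strata of configuration complements\<close>

text \<open>
  The part of a projective set where the first nonvanishing coordinate along the list is the one of number
  \<open>n\<close>, in the chart where this coordinate is \<open>1\<close>.
\<close>

definition stratum :: "'e set \<Rightarrow> 'e list \<Rightarrow> nat \<Rightarrow> (('e \<Rightarrow> 'c::field) \<Rightarrow> 'c) \<Rightarrow> ('e \<Rightarrow> 'c) set" where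
  "stratum E is n p = {v\<in>coord_space E. v (is ! n) = 1 \<and> (\<forall>j\<in>set (take n is). v j = 0) \<and> p v \<noteq> 0}"

text \<open>
  By the vector \<open>z\<close>, the form is degenerate at points where all coordinates in the list vanish, so no stratum
  is missing.
\<close>

lemma K0_class_config_complement_strata:
  fixes W :: "('e \<Rightarrow> 'k::field) set"
  assumes E: "finite E" and bs: "is_basis_list W bs" and "is": "set is \<subseteq> E"
    and z: "z \<in> W" "z \<noteq> 0" "\<And>i. i \<in> E \<Longrightarrow> i \<notin> set is \<Longrightarrow> z i = 0"
  shows "K0_class (config_complement E W) =
    (\<Sum>n<length is. aff_class E (stratum E is n (mpoly_at (form_det E bs))))"
proof -
  have "mpoly_at (config_poly E W) v = 0" if "\<And>i. i \<in> set is \<Longrightarrow> v i = 0" for v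
    by (rule config_poly_vanishes[OF bs z(1,2)]) (use that z(3) in blast)
  with K0_class_proj_set_strata[OF E homogeneous_config_poly[OF bs, of E] basis_list_nonempty[OF bs z(1,2)],
      of "{}" "is"] "is"
  show ?thesis
    unfolding config_complement_eq stratum_def by (simp add: config_poly_zero_iff[OF bs])
qed

lemma quasi_affine_stratum_base: "quasi_affine J (stratum J is n (\<lambda>_. 1))"
proof (rule quasi_affineI[of "insert (\<lambda>v. v (is ! n) - 1) ((\<lambda>j v. v j) ` set (take n is))" "\<lambda>_. 1"])
  show "insert (\<lambda>v. v (is ! n) - 1) ((\<lambda>j v. v j) ` set (take n is)) \<subseteq> polyfuns"
    using polyfuns_diff[OF polyfuns_var polyfuns_1] polyfuns_var by auto
qed (auto simp: stratum_def intro: polyfuns_1)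

lemma stratum_base_iff:
  assumes "u \<in> coord_space J" "\<forall>j\<in>J. u j = v j" "set is \<subseteq> J" "n < length is"
  shows "u \<in> stratum J is n (\<lambda>_. 1) \<longleftrightarrow> v (is ! n) = 1 \<and> (\<forall>j\<in>set (take n is). v j = 0)"
proof -
  have "is ! n \<in> J" "set (take n is) \<subseteq> J"
    using assms(3,4) set_take_subset[of n "is"] nth_mem by auto
  with assms(2) have "u (is ! n) = v (is ! n)" "\<forall>j\<in>set (take n is). u j = v j"
    by blast+
  with assms(1) show ?thesis
    by (simp add: stratum_def)
qed

lemma coloop_stratum:
  fixes D :: "('e \<Rightarrow> 'k::field alg_closure) \<Rightarrow> 'k alg_closure"
  assumes J: "finite J" "e \<notin> J" and "is": "set is \<subseteq> J" "n < length is"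
    and D: "D \<in> polyfuns" "\<And>v x. D (v(e := x)) = D v"
  shows "aff_class (insert e J) (stratum (insert e J) is n (\<lambda>v. v e * D v)) = torus_class * aff_class J (stratum J is n D)"
proof -
  have "stratum J is n D = {v\<in>stratum J is n (\<lambda>_. 1). D v \<noteq> 0}"
    by (auto simp: stratum_def)
  with quasi_affine_nonzero[OF quasi_affine_stratum_base D(1), of J "is" n]
  have qa: "quasi_affine J (stratum J is n D)"
    by simp
  have "v(e := 0) \<in> stratum J is n (\<lambda>_. 1) \<longleftrightarrow> v (is ! n) = 1 \<and> (\<forall>j\<in>set (take n is). v j = 0)"
    if "v \<in> coord_space (insert e J)" for v :: "'e \<Rightarrow> 'k alg_closure"
    by (rule stratum_base_iff[OF coord_space_upd_0[OF that J(2)] _ "is"]) (use J(2) in auto)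
  then have "{v\<in>coord_space (insert e J). v e \<noteq> 0 \<and> v(e := 0) \<in> stratum J is n D} =
      stratum (insert e J) is n (\<lambda>v. v e * D v)"
    unfolding \<open>stratum J is n D = _\<close> by (auto simp: D(2) stratum_def[of "insert e J"])
  with aff_class_times_Gm[OF J(1) qa J(2)] show ?thesis by simp
qed

text \<open>
  The linear coefficient of \<open>G\<close> in \<open>x\<^sub>f\<close> is recovered as \<open>G|\<^bsub>x_f=1\<^esub> - D\<close>, a polynomial over \<open>k\<close>.
\<close>

lemma series_stratum:
  fixes G D :: "('e \<Rightarrow> 'k::field alg_closure) \<Rightarrow> 'k alg_closure"
  assumes J: "finite J" "e \<notin> J" "f \<notin> J" "e \<noteq> f" and "is": "set is \<subseteq> J" "n < length is" and a: "a \<noteq> 0"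
    and poly: "G \<in> polyfuns" "D \<in> polyfuns"
    and G: "\<And>v. G v = D v + v f * (G (v(f := 1)) - D v)" "\<And>v x. G (v(e := x)) = G v"
    and D: "\<And>v x. D (v(e := x)) = D v" "\<And>v x. D (v(f := x)) = D v"
  shows "aff_class (insert e (insert f J)) (stratum (insert e (insert f J)) is n (\<lambda>v. v e * G v + to_ac a * v f * D v))
     + aff_class (insert f J) (stratum (insert f J) is n G)
     - aff_class J (stratum J is n D) \<in> ideal_generated {torus_class}"
proof -
  let ?B = "stratum J is n (\<lambda>_. 1) :: ('e \<Rightarrow> 'k alg_closure) set"
  define H where "H v = G (v(f := 1)) - D v" for v
  have "(\<lambda>v. G (\<lambda>i. if i = f then 1 else v i)) \<in> polyfuns"
    by (rule polyfuns_subst[OF poly(1), of "\<lambda>i v. if i = f then 1 else v i"])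
      (intro polyfuns_if polyfuns_var polyfuns_1)
  then have H: "H \<in> polyfuns"
    unfolding H_def fun_upd_def by (intro polyfuns_diff poly(2))
  have e': "e \<notin> insert f J"
    using J by simp
  have in_B: "v(f := 0) \<in> ?B \<longleftrightarrow> v (is ! n) = 1 \<and> (\<forall>j\<in>set (take n is). v j = 0)"
    if "v \<in> coord_space (insert f J)" for v
    by (rule stratum_base_iff[OF coord_space_upd_0[OF that J(3)] _ "is"]) (use J(3) in auto)
  have in_B': "v(e := 0, f := 0) \<in> ?B \<longleftrightarrow> v (is ! n) = 1 \<and> (\<forall>j\<in>set (take n is). v j = 0)"
    if "v \<in> coord_space (insert e (insert f J))" for v
    by (rule stratum_base_iff[OF coord_space_upd_0[OF coord_space_upd_0[OF that e'] J(3)] _ "is"])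
      (use J(2,3) in auto)
  have "aff_class (insert e (insert f J)) {v\<in>coord_space (insert e (insert f J)).
        v(e := 0, f := 0) \<in> ?B \<and> v e * G v + to_ac a * v f * D v \<noteq> 0}
      + aff_class (insert f J) {v\<in>coord_space (insert f J). v(f := 0) \<in> ?B \<and> G v \<noteq> 0}
      - aff_class J {v\<in>?B. D v \<noteq> 0} \<in> ideal_generated {torus_class}"
  proof (rule series_identity_affine[OF J(1) quasi_affine_stratum_base J(2,3,4) a poly H])
    show "G v = D v + v f * H v" "H (v(f := x)) = H v" for v x
      unfolding H_def using G(1)[of v] D(2)[of v x] by simp_all
  qed (rule G(2) D)+
  moreover have "{v\<in>coord_space (insert e (insert f J)).
        v(e := 0, f := 0) \<in> ?B \<and> v e * G v + to_ac a * v f * D v \<noteq> 0} =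
      stratum (insert e (insert f J)) is n (\<lambda>v. v e * G v + to_ac a * v f * D v)"
    using in_B' by (auto simp: stratum_def[of "insert e (insert f J)"])
  moreover have "{v\<in>coord_space (insert f J). v(f := 0) \<in> ?B \<and> G v \<noteq> 0} = stratum (insert f J) is n G"
    using in_B by (auto simp: stratum_def[of "insert f J"])
  moreover have "{v\<in>?B. D v \<noteq> 0} = stratum J is n D"
    by (auto simp: stratum_def)
  ultimately show ?thesis by simp
qed

section \<open>The series identity\<close>

lemma contract_basis_vanishes:
  assumes "is_basis_list (config_contract W {e}) bs"
  shows "\<forall>b\<in>set bs. b e = 0"
  using assms fun_vs.span_base[of _ "set bs"] by (auto simp: is_basis_list_def config_contract_def)

text \<open>A coloop \<open>e\<close> contributes the factor \<open>x\<^sub>e\<close> to the polynomial, and \<open>x\<^sub>e \<noteq> 0\<close> is a factor \<open>G\<^sub>m\<close> on each stratum.\<close>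

lemma K0_class_coloop:
  fixes W :: "('e \<Rightarrow> 'k::field) set"
  assumes E: "finite E" and W: "configuration E W" and e: "e \<in> E"
    and w: "w \<in> W" "w e = 1" "\<forall>i. i \<noteq> e \<longrightarrow> w i = 0" and z: "z \<in> W" "z \<noteq> 0" "z e = 0"
  shows "K0_class (config_complement E W) \<in> ideal_generated {torus_class}"
proof -
  define J where "J = E - {e}"
  have J: "finite J" "e \<notin> J" "E = insert e J" "E - {e} = J"
    using E e by (auto simp: J_def)
  obtain "is" where "is": "set is = J"
    using finite_list[OF J(1)] by blast
  obtain bs where bs: "is_basis_list (config_contract W {e}) bs"
    using basis_list_exists[OF _ config_contract_configuration[OF W]] E by blast
  let ?D = "mpoly_at (form_det J bs)"
  have "mpoly_at (form_det E (w # bs)) = (\<lambda>v. v e * ?D v)"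
    using form_det_coloop[OF E e contract_basis_vanishes[OF bs] w(2,3)] J(4) by auto
  then have "K0_class (config_complement E W) =
      (\<Sum>n<length is. aff_class E (stratum E is n (\<lambda>v. v e * ?D v)))"
    using K0_class_config_complement_strata[OF E basis_list_insert[OF W bs w(1,2)] _ z(1,2), of "is"] "is" J z(3)
    by auto
  also have "\<dots> = (\<Sum>n<length is. torus_class * aff_class J (stratum J is n ?D))"
  proof (rule sum.cong[OF refl])
    fix n assume "n \<in> {..<length is}"
    then show "aff_class E (stratum E is n (\<lambda>v. v e * ?D v)) = torus_class * aff_class J (stratum J is n ?D)"
      unfolding J(3)
    proof (intro coloop_stratum[OF J(1,2)])
      show "?D \<in> polyfuns"
        by (simp add: polyfuns_def)
      show "?D (v(e := x)) = ?D v" for v x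
        using J(2) by (simp add: mpoly_at_form_det form_at_upd)
    qed (use "is" in auto)
  qed
  also have "\<dots> \<in> ideal_generated {torus_class}"
    by (intro ideal_generated_sum torus_multiple)
  finally show ?thesis .
qed

lemma config_delete_coloop:
  assumes W: "configuration E W" and w: "w \<in> W" "w e = 1" "\<forall>i. i \<noteq> e \<longrightarrow> w i = 0"
  shows "config_delete W {e} = config_contract W {e}"
proof (intro equalityI subsetI)
  fix y assume "y \<in> config_delete W {e}"
  then obtain x where x: "x \<in> W" "y = (\<lambda>i. if i \<in> {e} then 0 else x i)"
    by (auto simp: config_delete_def)
  have "y = (\<lambda>i. x i - x e * w i)"
    using x(2) w(2,3) by (auto simp: fun_eq_iff)
  with config_diff[OF W x(1) config_scale[OF W w(1)]] w(2) show "y \<in> config_contract W {e}"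
    by (simp add: config_contract_def)
next
  fix y assume "y \<in> config_contract W {e}"
  then have "y \<in> W" and "(\<lambda>i. if i \<in> {e} then 0 else y i) = y"
    by (auto simp: config_contract_def fun_eq_iff)
  then show "y \<in> config_delete W {e}"
    unfolding config_delete_def by (metis (no_types, lifting) image_eqI)
qed

text \<open>
  The vector \<open>z\<close> ensures that the three polynomials vanish where all coordinates other than \<open>x\<^sub>e\<close> and \<open>x\<^sub>f\<close> do.
  So the same strata, indexed by the remaining coordinates, exhaust all three complements, and the identity
  can be proved stratum by stratum.
\<close>

lemma K0_class_series_pair:
  fixes W :: "('e \<Rightarrow> 'k::field) set"
  assumes E: "finite E" and W: "configuration E W" and ef: "e \<in> E" "f \<in> E" "e \<noteq> f"
    and w: "w \<in> W" "w e = 1" "w f \<noteq> 0" "\<forall>i. i \<notin> {e, f} \<longrightarrow> w i = 0"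
    and no_unit: "\<And>u. u \<in> W \<Longrightarrow> (\<And>i. i \<noteq> f \<Longrightarrow> u i = 0) \<Longrightarrow> u = 0"
    and z: "z \<in> W" "z \<noteq> 0" "z e = 0" "z f = 0"
  shows "K0_class (config_complement E W)
       + K0_class (config_complement (E - {e}) (config_contract W {e}))
       - K0_class (config_complement (E - {e, f}) (config_delete W {e, f}))
       \<in> ideal_generated {torus_class}"
proof -
  define J where "J = E - {e, f}"
  have J: "finite J" "e \<notin> J" "f \<notin> J" and EJ: "E = insert e (insert f J)" "E - {e} = insert f J" "E - {e, f} = J"
    using E ef by (auto simp: J_def)
  obtain "is" where "is": "set is = J"
    using finite_list[OF J(1)] by blast
  let ?d = "\<lambda>u i. if i \<in> {e, f} then 0 else u i"
  obtain bs where bs: "is_basis_list (config_contract W {e}) bs"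
    using basis_list_exists[OF _ config_contract_configuration[OF W]] E by blast
  have bsD: "is_basis_list (config_delete W {e, f}) (map ?d bs)"
    by (rule basis_list_delete[OF W bs w(1-3) _ no_unit]) (use w(4) in auto)
  define G where "G = mpoly_at (form_det (E - {e}) bs)"
  define D where "D = mpoly_at (form_det (E - {e, f}) (map ?d bs))"
  note form = form_det_series[OF E ef contract_basis_vanishes[OF bs] w(2-4), folded G_def D_def]
  have poly: "G \<in> polyfuns" "D \<in> polyfuns"
    by (simp_all add: G_def D_def polyfuns_def)
  have strataW: "K0_class (config_complement E W) =
      (\<Sum>n<length is. aff_class E (stratum E is n (\<lambda>v. v e * G v + to_ac (w f * w f) * v f * D v)))"
    using K0_class_config_complement_strata[OF E basis_list_insert[OF W bs w(1,2)] _ z(1,2), of "is"] "is" EJ z(3,4)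
    unfolding form(1)[abs_def] by auto
  have strataC: "K0_class (config_complement (E - {e}) (config_contract W {e})) =
      (\<Sum>n<length is. aff_class (E - {e}) (stratum (E - {e}) is n G))"
    unfolding G_def
    by (rule K0_class_config_complement_strata[OF _ bs _ _ z(2)])
      (use E "is" EJ z in \<open>auto simp: config_contract_def\<close>)
  have strataD: "K0_class (config_complement (E - {e, f}) (config_delete W {e, f})) =
      (\<Sum>n<length is. aff_class (E - {e, f}) (stratum (E - {e, f}) is n D))"
    unfolding D_def
  proof (rule K0_class_config_complement_strata[OF _ bsD, where z = z])
    have "z = ?d z"
      using z by (auto simp: fun_eq_iff)
    then show "z \<in> config_delete W {e, f}"
      unfolding config_delete_def using z(1) by (rule image_eqI)
  qed (use E "is" EJ z in auto)
  have step: "aff_class E (stratum E is n (\<lambda>v. v e * G v + to_ac (w f * w f) * v f * D v))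
      + aff_class (E - {e}) (stratum (E - {e}) is n G) - aff_class (E - {e, f}) (stratum (E - {e, f}) is n D)
      \<in> ideal_generated {torus_class}" if "n < length is" for n
    using series_stratum[OF J ef(3) equalityD1[OF "is"] that _ poly form(2-5), of "w f * w f"] w(3)
    unfolding EJ(1)[symmetric] unfolding EJ(2)[symmetric] unfolding EJ(3)[symmetric] by simp
  have "K0_class (config_complement E W) + K0_class (config_complement (E - {e}) (config_contract W {e}))
      - K0_class (config_complement (E - {e, f}) (config_delete W {e, f})) =
    (\<Sum>n<length is. aff_class E (stratum E is n (\<lambda>v. v e * G v + to_ac (w f * w f) * v f * D v))
      + aff_class (E - {e}) (stratum (E - {e}) is n G) - aff_class (E - {e, f}) (stratum (E - {e, f}) is n D))"
    unfolding strataW strataC strataD by (simp only: sum.distrib sum_subtractf)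
  also have "\<dots> \<in> ideal_generated {torus_class}"
    by (rule ideal_generated_sum) (use step in blast)
  finally show ?thesis .
qed

theorem corollary7p6:
  fixes E :: "'e set" and W :: "('e \<Rightarrow> 'k::field) set" and e f :: 'e
  assumes "finite E" and "E \<noteq> {}"
    and "configuration E W"
    and "e \<in> E" and "f \<in> E"
    and "in_series (config_matroid E W) e f"
    and "mrank (mcontract (config_matroid E W) {e}) > 0"
    and "mrank (mdelete (config_matroid E W) {e, f}) > 0"
    and "mclosure (config_matroid E W) {e, f} \<noteq> E"
    and "\<not> coloop (mcontract (config_matroid E W) {e}) f"
  shows "K0_class (config_complement E W)
       + K0_class (config_complement (E - {e}) (config_contract W {e}))
       - K0_class (config_complement (E - {e, f}) (config_delete W {e, f}))
       \<in> ideal_generated {torus_class}"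
proof -
  note E = assms(1) and W = assms(3) and e = assms(4) and f = assms(5) and ser = assms(6)
  obtain w where w: "w \<in> W" "w e = 1" "e \<noteq> f \<longrightarrow> w f \<noteq> 0" "\<forall>i. i \<notin> {e, f} \<longrightarrow> w i = 0"
    using series_vector[OF E W e f ser] by blast
  obtain z where z: "z \<in> W" "z \<noteq> 0" "z e = 0" "z f = 0"
    using vector_vanishing_on_nonspanning[OF E W _ assms(9)] e f by auto
  show ?thesis
  proof (cases "e = f")
    case True
    have w': "\<forall>i. i \<noteq> e \<longrightarrow> w i = 0"
      using w(4) True by simp
    show ?thesis
      using K0_class_coloop[OF E W e w(1,2) w' z(1-3)] config_delete_coloop[OF W w(1,2) w'] True by simp
  next
    case False
    have "u = 0" if u: "u \<in> W" "\<And>i. i \<noteq> f \<Longrightarrow> u i = 0" for u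
    proof (rule ccontr)
      assume "u \<noteq> 0"
      then obtain i where "u i \<noteq> 0" using nonzero_coordinate by blast
      then have "u f \<noteq> 0" using u(2)[of i] by metis
      then show False
        using unit_vector_coloop[OF E _ f u(1) _ u(2)] in_seriesD(3)[OF ser False] by blast
    qed
    then show ?thesis
      using w(3) False by (intro K0_class_series_pair[OF E W e f False w(1,2) _ w(4) _ z]) simp_all
  qed
qed
end
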